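(* Let $(N, C_1, C_2, \dots)$ be a nonnegative random vector with $N \in \{0,1,2,\dots\} \cup \{\infty\}$. Suppose that there exists $j \geq 1$ with $P(N\ge j,\,C_j>0)>0$ such that the measure $P(\log C_j\in du,\, C_j > 0,\, N\ge j)$ is nonarithmetic. Suppose further that for some $\alpha > 1$, $E\left[ \left( \sum_{i=1}^N C_i \right)^\alpha \right] < \infty$, $E \left[ \sum_{i=1}^N C_i^\alpha \log^+ C_i \right] < \infty$ and $E\left[ \sum_{i=1}^N C_i \right] = E \left[ \sum_{i=1}^N C_i^\alpha \right] = 1$. Then the equation $$R \stackrel{\mathcal{D}}{=} \sum_{i=1}^N C_i R_i$$ has a solution $R$ with $0<E[R] <\infty$ such that $$P(R > t) \sim H t^{-\alpha}, \qquad t \to \infty,$$ where $0 \leq H < \infty$ is given by $$H = \frac{1}{E\left[ \sum_{i=1}^N C_i^\alpha \log C_i \right] } \int_{0}^\infty v^{\alpha-1} \left( P(R > v) - E\left[ \sum_{i=1}^{N} 1(C_{i} R > v ) \right] \right) dv = \frac{E\left[ \left( \sum_{i=1}^N C_i R_i \right)^\alpha - \sum_{i=1}^N (C_i R_i )^\alpha \right]}{\alpha E\left[ \sum_{i=1}^N C_i^\alpha \log C_i \right] }.$$ Furthermore, if $P(\tilde{N} \geq 2) >0$, where $\tilde{N}= \sum_{i=1}^N 1(C_i>0)$, then $H>0$.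
   Context: A solution $R$ is a nonnegative random variable such that the displayed equality in distribution holds when $\{R_i\}$ are iid copies of $R$, independent of $(N,C_1,C_2,\dots)$. The same $\{R_i\}$ appear in the second expression for $H$; in the first expression $R$ is taken independent of $(N,C_1,C_2,\dots)$. $1(\cdot)$ is the indicator function, $\log^+x=\max(\log x,0)$, and $0^\alpha\log 0=0$ for $\alpha>0$. When $N=\infty$, $\sum_{i=1}^N$ is an infinite series. A measure on $\mathbb{R}$ is nonarithmetic if it is not concentrated on $d\mathbb{Z}$ for any $d>0$. $P(R>t)\sim Ht^{-\alpha}$ means $\lim_{t\to\infty}t^\alpha P(R>t)=H$. *)

theory Defs
  imports "HOL-Probability.Probability"
begin

text \<open>
  Sequences are indexed from 0: \<open>C i\<close> stands for the weight usually written with index \<open>i + 1\<close>.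
  Accordingly a sum over indices \<open>1, \<dots>, n\<close> runs over all \<open>i\<close> with \<open>enat i < n\<close>, and it is an
  infinite series for \<open>n = \<infinity>\<close>.
\<close>

definition sum_upto :: "enat \<Rightarrow> (nat \<Rightarrow> 'b) \<Rightarrow> 'b::{topological_space, comm_monoid_add}"
  where "sum_upto n f = (\<Sum>i. if enat i < n then f i else 0)"

definition nonarithmetic :: "real measure \<Rightarrow> bool"
  where "nonarithmetic \<mu> \<longleftrightarrow> (\<forall>d>0. emeasure \<mu> (UNIV - range (\<lambda>k::int. d * of_int k)) > 0)"

text \<open>The measure \<open>P(log X \<in> du, X > 0, A)\<close>; it is a sub-probability measure.\<close>

definition log_law_on :: "'a measure \<Rightarrow> ('a \<Rightarrow> bool) \<Rightarrow> ('a \<Rightarrow> real) \<Rightarrow> real measure"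
  where "log_law_on M A X =
    distr (restrict_space M {\<omega> \<in> space M. X \<omega> > 0 \<and> A \<omega>}) borel (\<lambda>\<omega>. ln (X \<omega>))"

abbreviation weight_space :: "(enat \<times> (nat \<Rightarrow> real)) measure"
  where "weight_space \<equiv> count_space UNIV \<Otimes>\<^sub>M (\<Pi>\<^sub>M i\<in>(UNIV::nat set). borel)"

text \<open>
  The library's \<open>indep_var\<close> forces both variables to have the same value type, hence
  this version: independence of the generated sigma-algebras.
\<close>

definition indep_rv ::
  "'a measure \<Rightarrow> 'b measure \<Rightarrow> ('a \<Rightarrow> 'b) \<Rightarrow> 'c measure \<Rightarrow> ('a \<Rightarrow> 'c) \<Rightarrow> bool"
  where "indep_rv \<Omega> S X T Y \<longleftrightarrow> X \<in> measurable \<Omega> S \<and> Y \<in> measurable \<Omega> T \<and>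
    prob_space.indep_set \<Omega> (sets (vimage_algebra (space \<Omega>) X S)) (sets (vimage_algebra (space \<Omega>) Y T))"

text \<open>
  \<open>R\<close>, with iid copies \<open>Rs\<close> independent of \<open>(N, C)\<close>, solves the equation in distribution.
  The laws are compared on \<open>[0, \<infinity>]\<close>; since \<open>R\<close> is real-valued, the equality entails that the series
  on the right converges almost surely.
\<close>

definition smoothing_solution ::
  "'a measure \<Rightarrow> ('a \<Rightarrow> enat) \<Rightarrow> (nat \<Rightarrow> 'a \<Rightarrow> real) \<Rightarrow> ('a \<Rightarrow> real) \<Rightarrow> (nat \<Rightarrow> 'a \<Rightarrow> real) \<Rightarrow> bool"
  where "smoothing_solution \<Omega> N C R Rs \<longleftrightarrow>
    R \<in> borel_measurable \<Omega> \<and> (AE \<omega> in \<Omega>. 0 \<le> R \<omega>) \<and>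
    prob_space.indep_vars \<Omega> (\<lambda>_. borel) Rs UNIV \<and>
    (\<forall>i. distr \<Omega> borel (Rs i) = distr \<Omega> borel R) \<and>
    indep_rv \<Omega> weight_space (\<lambda>\<omega>. (N \<omega>, \<lambda>i. C i \<omega>))
      (\<Pi>\<^sub>M i\<in>UNIV. borel) (\<lambda>\<omega> i. Rs i \<omega>) \<and>
    distr \<Omega> borel (\<lambda>\<omega>. ennreal (R \<omega>)) =
      distr \<Omega> borel (\<lambda>\<omega>. sum_upto (N \<omega>) (\<lambda>i. ennreal (C i \<omega> * Rs i \<omega>)))"

end

theory Submission
  imports Defs "HOL-Real_Asymp.Real_Asymp"
begin

text \<open>
  The solution is the limit of the iterates of \<open>\<rho> \<mapsto>\<close> law of \<open>\<Sum> C\<^sub>i R\<^sub>i\<close> started at the point mass 1.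
  Characteristic functions contract under one step by the factor \<open>E[\<Sum> C\<^sub>i\<^sup>p] < 1\<close> in the metric
  \<open>sup |\<phi>(t) - \<psi>(t)| / |t|\<^sup>p\<close> for \<open>1 < p < min \<alpha> 2\<close>, and all moments of order below \<open>\<alpha>\<close> stay
  bounded, because \<open>(\<Sum> x\<^sub>i)\<^sup>\<beta> - \<Sum> x\<^sub>i\<^sup>\<beta>\<close> is controlled by \<open>V = \<Sum> x\<^sub>j (\<Sum>\<^bsub>i\<noteq>j\<^esub> x\<^sub>i)\<^bsup>\<beta>-1\<^esup>\<close>, whose two factors
  are conditionally independent.

  For the tail, \<open>f t = exp ((\<alpha> - 1) t) E[max (R - exp t) 0]\<close> solves the renewal equation
  \<open>f = \<eta> * f + g\<close> for the tilted step law \<open>\<eta>(du) = E[\<Sum> C\<^sub>i\<^sup>\<alpha>; log C\<^sub>i \<in> du]\<close>. Working with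
  \<open>max (x - v) 0\<close> instead of the indicator of \<open>x > v\<close> makes \<open>g\<close> nonnegative and \<open>exp (- \<alpha> t) g t\<close>
  monotone. No key renewal theorem is needed: integrating the equation over \<open>(-\<infinity>, x]\<close> shows that every limit
  of translates of \<open>f\<close> is a bounded \<open>\<eta>\<close>-harmonic function whose mean against the step law is \<open>\<integral> g\<close>, and
  such a function is asymptotically constant at minus infinity if it attains its maximum. Hence \<open>limsup f\<close> and
  \<open>liminf f\<close> both equal \<open>\<integral> g\<close> divided by the mean of \<open>\<eta>\<close>; the monotonicity of \<open>P(R > v)\<close> transfers
  the limit to the tail.
\<close>

section \<open>A renewal theorem on the line\<close>

text \<open>The power p > 1 in the metric is usable because all iterates have mean 1: their
  characteristic functions agree to first order at 0, hence differ by O(|t|^p) once the p-th moments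
  are bounded. The factor is below 1 by strict convexity: \<open>power_sum\<close> at \<beta> is an
  exponential moment of the step law and equals 1 at \<beta> = 1 and at \<beta> = \<alpha>. The
  obstacle is that the moment of order \<alpha> of the solution is infinite whenever H > 0. The
  difference of powers in H therefore cannot be split into two expectations; it is integrated only
  after a pathwise bound by cross terms, which need moments of order at most max (\<alpha> - 1) 1.
  For the same reason \<open>f\<close> is not known to be bounded at the start: moments of order
  \<alpha> - \<epsilon> give only growth like exp (\<epsilon> t), and boundedness must come out of
  the renewal equation. The bounds that make translates of \<open>f\<close> equicontinuous are
  linear in \<open>f\<close> for this purpose: they survive rescaling and pointwise limits, so one
  compactness argument serves both for boundedness and for the limit.\<close>

lemma additive_semigroup_asymptotically_dense:
  fixes G :: "real set"
  assumes zero: "0 \<in> G" and add: "\<And>x y. x \<in> G \<Longrightarrow> y \<in> G \<Longrightarrow> x + y \<in> G"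
    and pos: "e \<in> G" "e > 0"
    and nonarith: "\<And>d. d > 0 \<Longrightarrow> \<exists>x\<in>G. x \<notin> range (\<lambda>k::int. d * of_int k)"
    and \<delta>: "\<delta> > 0"
  shows "\<exists>A. \<forall>s\<ge>A. \<exists>u\<in>G. \<bar>u - s\<bar> \<le> \<delta>"
proof -
  have mult: "of_nat n * x \<in> G" if "x \<in> G" for n :: nat and x
    by (induction n) (use that zero add in \<open>auto simp: algebra_simps\<close>)
  \<comment> \<open>Differences form a group, and a nontrivial subgroup of the reals without small
    positive elements consists of the integer multiples of one number.\<close>
  define \<Gamma> where "\<Gamma> = {a - b |a b. a \<in> G \<and> b \<in> G}"
  have \<Gamma>_diff: "x - y \<in> \<Gamma>" if "x \<in> \<Gamma>" "y \<in> \<Gamma>" for x y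
  proof -
    from that obtain a b c d where "a \<in> G" "b \<in> G" "c \<in> G" "d \<in> G" "x = a - b" "y = c - d"
      by (auto simp: \<Gamma>_def)
    then have "x - y = (a + d) - (b + c)" "a + d \<in> G" "b + c \<in> G" using add by auto
    then show ?thesis unfolding \<Gamma>_def by blast
  qed
  have \<Gamma>_0: "0 \<in> \<Gamma>" using zero by (force simp: \<Gamma>_def)
  have \<Gamma>_neg: "- x \<in> \<Gamma>" if "x \<in> \<Gamma>" for x using \<Gamma>_diff[OF \<Gamma>_0 that] by simp
  have \<Gamma>_add: "x + y \<in> \<Gamma>" if "x \<in> \<Gamma>" "y \<in> \<Gamma>" for x y
    using \<Gamma>_diff[OF that(1) \<Gamma>_neg[OF that(2)]] by simp
  have \<Gamma>_nat: "of_nat n * x \<in> \<Gamma>" if "x \<in> \<Gamma>" for n :: nat and x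
    by (induction n) (use that \<Gamma>_0 \<Gamma>_add in \<open>auto simp: algebra_simps\<close>)
  have \<Gamma>_int: "of_int n * x \<in> \<Gamma>" if "x \<in> \<Gamma>" for n :: int and x
    using \<Gamma>_nat[OF that, of "nat n"] \<Gamma>_neg[OF \<Gamma>_nat[OF that, of "nat (-n)"]]
    by (cases "n \<ge> 0") auto
  have G_sub: "x \<in> \<Gamma>" if "x \<in> G" for x using that zero by (force simp: \<Gamma>_def)
  have "\<exists>\<gamma>\<in>\<Gamma>. 0 < \<gamma> \<and> \<gamma> \<le> \<delta>"
  proof (rule ccontr)
    assume "\<not> ?thesis"
    then have big: "\<gamma> > \<delta>" if "\<gamma> \<in> \<Gamma>" "\<gamma> > 0" for \<gamma> using that by force
    define P where "P = {\<gamma>\<in>\<Gamma>. \<gamma> > 0}"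
    have P_ne: "P \<noteq> {}" and P_bdd: "bdd_below P" using pos G_sub
      by (auto simp: P_def intro!: bdd_belowI[of _ 0])
    define d where "d = Inf P"
    have d_le: "d \<le> \<gamma>" if "\<gamma> \<in> P" for \<gamma>
      unfolding d_def by (rule cInf_lower[OF that P_bdd])
    have "d \<ge> \<delta>"
      unfolding d_def by (rule cInf_greatest[OF P_ne]) (use big in \<open>force simp: P_def\<close>)
    then have "d > 0" using \<delta> by simp
    obtain \<gamma>1 where g1: "\<gamma>1 \<in> P" "\<gamma>1 < d + \<delta>"
      using cInf_lessD[OF P_ne, of "d + \<delta>"] \<delta> by (auto simp: d_def)
    \<comment> \<open>If the infimum were not attained, two members of \<open>P\<close> would lie
      within \<delta> of each other, while positive elements of \<Gamma> all exceed
      \<delta>.\<close>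
    have "d \<in> \<Gamma>"
    proof (cases "\<gamma>1 = d")
      case False
      then obtain \<gamma>2 where g2: "\<gamma>2 \<in> P" "\<gamma>2 < \<gamma>1"
        using cInf_lessD[OF P_ne, of \<gamma>1] d_le[OF g1(1)] by (auto simp: d_def)
      have "\<gamma>1 - \<gamma>2 > \<delta>" using big \<Gamma>_diff g1 g2 by (auto simp: P_def)
      then show ?thesis using d_le[OF g2(1)] g1 by auto
    qed (use g1 in \<open>auto simp: P_def\<close>)
    have "x \<in> range (\<lambda>k::int. d * of_int k)" if "x \<in> G" for x
    proof -
      let ?k = "\<lfloor>x / d\<rfloor>"
      have r: "x - of_int ?k * d \<in> \<Gamma>" using \<Gamma>_diff[OF G_sub[OF that] \<Gamma>_int[OF \<open>d \<in> \<Gamma>\<close>]] .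
      have "0 \<le> x - of_int ?k * d" "x - of_int ?k * d < d"
        using \<open>d > 0\<close> floor_divide_lower[of d x] floor_divide_upper[of d x]
        by (auto simp: algebra_simps)
      then have "x - of_int ?k * d = 0" using d_le[of "x - of_int ?k * d"] r by (force simp: P_def)
      then show ?thesis by (auto simp: mult.commute intro!: image_eqI[of _ _ ?k])
    qed
    then show False using nonarith[OF \<open>d > 0\<close>] by blast
  qed
  then obtain \<gamma> where \<gamma>: "\<gamma> \<in> \<Gamma>" "0 < \<gamma>" "\<gamma> \<le> \<delta>" by blast
  then obtain a0 b0 where ab0: "a0 \<in> G" "b0 \<in> G" "\<gamma> = a0 - b0" by (auto simp: \<Gamma>_def)
  obtain k :: nat where k: "\<bar>b0\<bar> < of_nat k * e" using reals_Archimedean3[OF pos(2)] by blast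
  \<comment> \<open>Adding the same multiple of \<open>e\<close> to both leaves the difference
    \<gamma> unchanged and makes \<open>b\<close> positive.\<close>
  define a where "a = a0 + of_nat k * e"
  define b where "b = b0 + of_nat k * e"
  have ab: "a \<in> G" "b \<in> G" "\<gamma> = a - b" "b > 0"
    using ab0 add mult[OF pos(1)] k by (auto simp: a_def b_def)
  \<comment> \<open>The sums m a + (n - m) b with m \<le> n equal n b + m \<gamma>: a grid of mesh
    \<gamma> \<le> \<delta> that covers the gap from n b to (n + 1) b as soon as n \<gamma> >
    b.\<close>
  obtain n0 :: nat where n0: "b < of_nat n0 * \<gamma>" using reals_Archimedean3[OF \<gamma>(2)] by blast
  show ?thesis
  proof (intro exI[of _ "of_nat n0 * b"] allI impI)
    fix s assume s: "s \<ge> of_nat n0 * b"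
    define n where "n = nat \<lfloor>s / b\<rfloor>"
    have "s / b \<ge> of_nat n0" using s ab by (simp add: field_simps)
    then have n_ge: "n \<ge> n0" unfolding n_def by linarith
    have "s / b \<ge> 0" using \<open>s / b \<ge> of_nat n0\<close> by (meson of_nat_0_le_iff order_trans)
    then have n1: "real n \<le> s / b" "s / b < real n + 1" unfolding n_def by linarith+
    then have n2: "real n * b \<le> s" "s < real n * b + b" using ab
      by (auto simp: field_simps)
    define m where "m = nat \<lfloor>(s - n * b) / \<gamma>\<rfloor>"
    have "(s - n * b) / \<gamma> \<ge> 0" using n2 \<gamma> by simp
    then have m1: "real m \<le> (s - n * b) / \<gamma>" "(s - n * b) / \<gamma> < real m + 1"
      unfolding m_def by linarith+
    then have m2: "real m * \<gamma> \<le> s - n * b" "s - n * b < real m * \<gamma> + \<gamma>" using \<gamma>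
      by (auto simp: field_simps)
    have "real n0 * \<gamma> \<le> real n * \<gamma>" using n_ge \<gamma> by (intro mult_right_mono) auto
    then have "real m * \<gamma> < real n * \<gamma>" using m2 n2 n0 by linarith
    then have "m \<le> n" using \<gamma> by simp
    define u where "u = of_nat m * a + of_nat (n - m) * b"
    have "u \<in> G" unfolding u_def using add mult ab by auto
    moreover have "u = real n * b + real m * \<gamma>"
      using \<open>m \<le> n\<close> by (simp add: u_def of_nat_diff ab(3) algebra_simps)
    ultimately show "\<exists>u\<in>G. \<bar>u - s\<bar> \<le> \<delta>" using m2 \<gamma> by (intro bexI[of _ u]) auto
  qed
qed

definition msupport :: "real measure \<Rightarrow> real set" where
  "msupport \<eta> = {u. \<forall>\<delta>>0. emeasure \<eta> {u-\<delta><..<u+\<delta>} > 0}"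

text \<open>The complement of the support is covered by null intervals with rational endpoints, and
  there are only countably many of those.\<close>

lemma AE_in_msupport:
  assumes sets: "sets \<eta> = sets borel"
  shows "AE u in \<eta>. u \<in> msupport \<eta>"
proof -
  have sp: "space \<eta> = UNIV" using sets_eq_imp_space_eq[OF sets] by simp
  define I where "I = {(p, q). p \<in> \<rat> \<and> q \<in> \<rat> \<and> emeasure \<eta> {p<..<q::real} = 0}"
  have "countable I"
    by (rule countable_subset[of _ "\<rat> \<times> \<rat>"]) (auto simp: I_def countable_rat)
  have "u \<in> (\<Union>(p, q)\<in>I. {p<..<q})" if u: "u \<notin> msupport \<eta>" for u
  proof -
    from u obtain \<delta> where d: "\<delta> > 0" "emeasure \<eta> {u-\<delta><..<u+\<delta>} = 0"
      by (auto simp: msupport_def not_less)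
    obtain p where p: "p \<in> \<rat>" "u - \<delta> < p" "p < u" using Rats_dense_in_real[of "u-\<delta>" u] d by auto
    obtain q where q: "q \<in> \<rat>" "u < q" "q < u + \<delta>" using Rats_dense_in_real[of u "u+\<delta>"] d by auto
    have "emeasure \<eta> {p<..<q} \<le> emeasure \<eta> {u-\<delta><..<u+\<delta>}"
      by (rule emeasure_mono) (use p q sets in auto)
    then show ?thesis using d p q by (force simp: I_def)
  qed
  moreover have "(\<Union>(p, q)\<in>I. {p<..<q}) \<in> null_sets \<eta>"
    by (rule null_sets_UN'[OF \<open>countable I\<close>]) (auto simp: I_def null_sets_def sets)
  ultimately show ?thesis
    by (intro AE_I'[of "\<Union>(p, q)\<in>I. {p<..<q}"]) auto
qed

text \<open>A diagonal subsequence converges at all rationals, and equicontinuity carries the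
  convergence to every point. Pointwise limits suffice, since they are later passed only through
  inequalities and dominated integrals.\<close>

lemma pointwise_convergent_subsequence:
  fixes \<phi> :: "nat \<Rightarrow> real \<Rightarrow> real"
  assumes bdd: "\<And>t. \<exists>B. \<forall>n. \<bar>\<phi> n t\<bar> \<le> B"
    and equi: "\<And>t \<kappa>. \<kappa> > 0 \<Longrightarrow> \<exists>\<delta>>0. \<forall>n s. \<bar>s - t\<bar> < \<delta> \<longrightarrow> \<bar>\<phi> n s - \<phi> n t\<bar> < \<kappa>"
  shows "\<exists>r \<psi>. strict_mono (r::nat\<Rightarrow>nat) \<and> (\<forall>t. (\<lambda>n. \<phi> (r n) t) \<longlonglongrightarrow> \<psi> t)"
proof -
  define q :: "nat \<Rightarrow> real" where "q = from_nat_into \<rat>"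
  define P where "P k r \<longleftrightarrow> convergent (\<lambda>n. \<phi> (r n) (q k))" for k and r :: "nat \<Rightarrow> nat"
  interpret subseqs P
  proof
    fix k and s :: "nat \<Rightarrow> nat" assume "strict_mono s"
    obtain B where B: "\<bar>\<phi> n (q k)\<bar> \<le> B" for n using bdd by blast
    have "bounded (range (\<lambda>n. \<phi> (s n) (q k)))" using B by (auto simp: bounded_iff)
    then obtain l r where "strict_mono (r::nat\<Rightarrow>nat)" "((\<lambda>n. \<phi> (s n) (q k)) \<circ> r) \<longlonglongrightarrow> l"
      using bounded_imp_convergent_subsequence by blast
    then show "\<exists>r'. strict_mono r' \<and> P k (s \<circ> r')" by (auto simp: P_def convergent_def o_def)
  qed
  define r where "r = diagseq"
  have r: "strict_mono r" unfolding r_def by (rule subseq_diagseq)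
  have conv_q: "convergent (\<lambda>n. \<phi> (r n) (q k))" for k
  proof -
    have "P k (diagseq \<circ> ((+) (Suc k)))"
      by (rule diagseq_holds) (auto simp: P_def o_def convergent_def intro: LIMSEQ_subseq_LIMSEQ[unfolded o_def])
    then have "convergent (\<lambda>n. \<phi> (r (n + Suc k)) (q k))" by (simp add: P_def o_def r_def add_ac)
    then show ?thesis using convergent_ignore_initial_segment by blast
  qed
  have "convergent (\<lambda>n. \<phi> (r n) t)" for t
  proof -
    have "Cauchy (\<lambda>n. \<phi> (r n) t)"
    proof (rule metric_CauchyI)
      fix \<kappa> :: real assume "\<kappa> > 0"
      then obtain \<delta> where d: "\<delta> > 0" "\<And>n s. \<bar>s - t\<bar> < \<delta> \<Longrightarrow> \<bar>\<phi> n s - \<phi> n t\<bar> < \<kappa>/3"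
        using equi[of "\<kappa>/3" t] by auto
      obtain p where p: "p \<in> \<rat>" "t < p" "p < t + \<delta>" using Rats_dense_in_real[of t "t+\<delta>"] d by auto
      then obtain k where k: "p = q k"
        using from_nat_into_surj[OF countable_rat] unfolding q_def by metis
      have "Cauchy (\<lambda>n. \<phi> (r n) p)" using conv_q k Cauchy_convergent_iff by auto
      then obtain M where M: "\<And>m n. m \<ge> M \<Longrightarrow> n \<ge> M \<Longrightarrow> dist (\<phi> (r m) p) (\<phi> (r n) p) < \<kappa>/3"
        using metric_CauchyD[of _ "\<kappa>/3"] \<open>\<kappa> > 0\<close> by (metis zero_less_divide_iff zero_less_numeral)
      have "dist (\<phi> (r m) t) (\<phi> (r n) t) < \<kappa>" if "m \<ge> M" "n \<ge> M" for m n
        using M[OF that] d(2)[of p "r m"] d(2)[of p "r n"] p unfolding dist_real_def by linarith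
      then show "\<exists>M. \<forall>m\<ge>M. \<forall>n\<ge>M. dist (\<phi> (r m) t) (\<phi> (r n) t) < \<kappa>" by blast
    qed
    then show ?thesis using Cauchy_convergent_iff by blast
  qed
  then obtain \<psi> where "\<And>t. (\<lambda>n. \<phi> (r n) t) \<longlonglongrightarrow> \<psi> t" unfolding convergent_def by metis
  then show ?thesis using r by blast
qed

text \<open>With \<open>s\<close> uniform on the unit interval, the signed integral of
  \<open>f\<close> from x - u to x is the mean of \<open>u * f (x - u * s)\<close> for either sign
  of \<open>u\<close>. The integrated renewal equation thereby becomes one expectation over a
  product law.\<close>

definition unit_uniform :: "real measure" where
  "unit_uniform = density lborel (indicator {0..1})"

lemma sets_unit_uniform[measurable_cong, simp]: "sets unit_uniform = sets borel"
  by (simp add: unit_uniform_def)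

lemma space_unit_uniform[simp]: "space unit_uniform = UNIV"
  by (simp add: unit_uniform_def)

lemma prob_space_unit_uniform: "prob_space unit_uniform"
  by (rule prob_spaceI) (simp add: unit_uniform_def emeasure_density)

lemma (in prob_space) integral_pair_fst:
  fixes h :: "'b \<Rightarrow> real"
  assumes "h \<in> borel_measurable N"
  shows "integrable (N \<Otimes>\<^sub>M M) (\<lambda>z. h (fst z)) \<longleftrightarrow> integrable N h"
    and "(\<integral>z. h (fst z) \<partial>(N \<Otimes>\<^sub>M M)) = (\<integral>x. h x \<partial>N)"
  using assms integrable_distr_eq[of fst "N \<Otimes>\<^sub>M M" N h] integral_distr[of fst "N \<Otimes>\<^sub>M M" N h]
  by (simp_all add: distr_pair_fst)

section \<open>Harmonic functions of a step law with positive mean\<close>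

locale renewal_step = prob_space \<eta> for \<eta> :: "real measure" +
  fixes a :: real
  assumes sets_\<eta>[measurable_cong]: "sets \<eta> = sets borel"
    and a_pos: "a > 0"
    and integrable_exp: "integrable \<eta> (\<lambda>u. exp (- a * u))"
    and integrable_id: "integrable \<eta> (\<lambda>u. u)"
    and mean_pos: "(\<integral>u. u \<partial>\<eta>) > 0"
    and nonarith: "nonarithmetic \<eta>"
begin

definition mean :: real where "mean = (\<integral>u. u \<partial>\<eta>)"

lemma space_\<eta>[simp]: "space \<eta> = UNIV"
  using sets_eq_imp_space_eq[OF sets_\<eta>] by simp

lemma prob_UNIV[simp]: "prob UNIV = 1"
  using prob_space by simp

sublocale U: prob_space unit_uniform by (rule prob_space_unit_uniform)
sublocale \<eta>U: pair_prob_space \<eta> unit_uniform ..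

lemma msupport_pos: "\<exists>e\<in>msupport \<eta>. e > 0"
proof (rule ccontr)
  assume "\<not> ?thesis"
  then have "AE u in \<eta>. u \<le> 0"
    by (intro AE_mp[OF AE_in_msupport[OF sets_\<eta>] AE_I2]) (auto simp: not_less)
  then have "(\<integral>u. - u \<partial>\<eta>) \<ge> 0" by (intro integral_nonneg_AE) auto
  then show False using mean_pos by simp
qed

lemma msupport_nonarith:
  assumes "d > 0"
  shows "\<exists>x\<in>msupport \<eta>. x \<notin> range (\<lambda>k::int. d * of_int k)"
proof (rule ccontr)
  define Z where "Z = range (\<lambda>k::int. d * of_int k)"
  assume "\<not> ?thesis"
  then have sub: "msupport \<eta> \<subseteq> Z" unfolding Z_def by blast
  have "AE u in \<eta>. u \<notin> UNIV - Z"
    by (intro AE_mp[OF AE_in_msupport[OF sets_\<eta>] AE_I2]) (use sub in blast)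
  moreover have "countable Z" by (simp add: Z_def)
  then have "Z \<in> sets borel" by (rule sets.countable[rotated]) auto
  then have "UNIV - Z \<in> sets \<eta>" using sets_\<eta> by auto
  ultimately have "emeasure \<eta> (UNIV - Z) = 0"
    proof -
    have "{x \<in> space \<eta>. \<not> x \<notin> UNIV - Z} = UNIV - Z" by auto
    then show ?thesis if "AE u in \<eta>. u \<notin> UNIV - Z" "UNIV - Z \<in> sets \<eta>"
      using AE_iff_measurable[OF that(2), of "\<lambda>u. u \<notin> UNIV - Z"] that(1) by simp
  qed
  then show False using nonarith assms unfolding nonarithmetic_def Z_def by fastforce
qed

text \<open>The maximal value \<open>L\<close> is an average of values at most \<open>L\<close>, so
  \<open>\<phi> (t - u) = L\<close> for almost every step \<open>u\<close>; continuity extends this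
  to every point of the support.\<close>

lemma harmonic_at_maximum:
  fixes \<phi> :: "real \<Rightarrow> real"
  assumes cont: "continuous_on UNIV \<phi>" and bdd: "\<And>t. \<bar>\<phi> t\<bar> \<le> B"
    and harm: "\<And>t. \<phi> t = (\<integral>u. \<phi> (t - u) \<partial>\<eta>)"
    and le: "\<And>t. \<phi> t \<le> L" and eq: "\<phi> t = L" and u: "u \<in> msupport \<eta>"
  shows "\<phi> (t - u) = L"
proof (rule ccontr)
  assume "\<phi> (t - u) \<noteq> L"
  then have less: "\<phi> (t - u) < L" using le[of "t - u"] by simp
  have [measurable]: "\<phi> \<in> borel_measurable borel" by (rule borel_measurable_continuous_onI[OF cont])
  have int: "integrable \<eta> (\<lambda>u. \<phi> (t - u))"
    by (rule integrable_const_bound[of _ B]) (auto simp: bdd)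
  then have "(\<integral>u. L - \<phi> (t - u) \<partial>\<eta>) = L - (\<integral>u. \<phi> (t - u) \<partial>\<eta>)"
    by (subst Bochner_Integration.integral_diff) auto
  then have "(\<integral>u. L - \<phi> (t - u) \<partial>\<eta>) = 0" using harm[of t] eq by simp
  then have ae: "AE u in \<eta>. L - \<phi> (t - u) = 0"
    by (subst (asm) integral_nonneg_eq_0_iff_AE) (use int le in auto)
  have "open ((\<lambda>v. \<phi> (t - v)) -` {..<L})"
    by (intro open_vimage continuous_intros continuous_on_compose2[OF cont]) auto
  then obtain \<delta> where \<delta>: "\<delta> > 0" "\<And>v. dist v u < \<delta> \<Longrightarrow> \<phi> (t - v) < L"
    using less unfolding open_dist by force
  have "AE v in \<eta>. v \<notin> {u-\<delta><..<u+\<delta>}"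
  proof (rule AE_mp[OF ae], rule AE_I2, intro impI notI)
    fix v assume "L - \<phi> (t - v) = 0" "v \<in> {u-\<delta><..<u+\<delta>}"
    moreover from this have "dist v u < \<delta>" unfolding dist_real_def by (auto simp: abs_less_iff)
    ultimately show False using \<delta>(2)[of v] by linarith
  qed
  then have "emeasure \<eta> {u-\<delta><..<u+\<delta>} = 0"
    by (subst (asm) AE_iff_measurable[of "{u-\<delta><..<u+\<delta>}"]) (auto simp: sets_\<eta>)
  then show False using u \<delta> by (auto simp: msupport_def)
qed

text \<open>
  The maximum propagates along the semigroup generated by the support of the step law, which is
  asymptotically dense at infinity.
\<close>

lemma harmonic_tendsto_sup:
  fixes \<phi> :: "real \<Rightarrow> real"
  assumes uc: "uniformly_continuous_on UNIV \<phi>" and bdd: "\<And>t. \<bar>\<phi> t\<bar> \<le> B"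
    and harm: "\<And>t. \<phi> t = (\<integral>u. \<phi> (t - u) \<partial>\<eta>)"
    and le: "\<And>t. \<phi> t \<le> L" and eq: "\<phi> 0 = L"
  shows "(\<phi> \<longlongrightarrow> L) at_bot"
proof -
  define G where "G = sum_list ` {xs. set xs \<subseteq> msupport \<eta>}"
  have "\<phi> (- sum_list xs) = L" if "set xs \<subseteq> msupport \<eta>" for xs
    using that
  proof (induction xs)
    case (Cons u xs)
    have "\<phi> (- sum_list xs - u) = L"
      by (rule harmonic_at_maximum[OF uniformly_continuous_imp_continuous[OF uc] bdd harm le])
        (use Cons in auto)
    moreover have "- sum_list (u # xs) = - sum_list xs - u" by simp
    ultimately show ?case by (simp only:)
  qed (use eq in auto)
  then have G_eq: "\<phi> (- u) = L" if "u \<in> G" for u using that by (auto simp: G_def)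
  have supp_G: "u \<in> G" if "u \<in> msupport \<eta>" for u
    unfolding G_def using that by (intro image_eqI[of _ _ "[u]"]) auto
  obtain e where e: "e \<in> G" "e > 0" using msupport_pos supp_G by blast
  have zero: "0 \<in> G" unfolding G_def by (intro image_eqI[of _ _ "[]"]) auto
  have add: "x + y \<in> G" if xy: "x \<in> G" "y \<in> G" for x y
  proof -
    obtain xs ys where "set xs \<subseteq> msupport \<eta>" "set ys \<subseteq> msupport \<eta>" "x = sum_list xs" "y = sum_list ys"
      using xy by (auto simp: G_def)
    then show ?thesis unfolding G_def by (intro image_eqI[of _ _ "xs @ ys"]) auto
  qed
  show ?thesis
  proof (rule tendstoI)
    fix \<epsilon> :: real assume "\<epsilon> > 0"
    then obtain \<delta> where \<delta>: "\<delta> > 0" "\<And>x y. dist y x < \<delta> \<Longrightarrow> dist (\<phi> y) (\<phi> x) < \<epsilon>"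
      using uc unfolding uniformly_continuous_on_def by (metis UNIV_I)
    obtain A where A: "\<And>s. s \<ge> A \<Longrightarrow> \<exists>u\<in>G. \<bar>u - s\<bar> \<le> \<delta> / 2"
      using additive_semigroup_asymptotically_dense[OF zero add e, of "\<delta>/2"]
        msupport_nonarith supp_G \<delta> by (auto; blast)
    show "\<forall>\<^sub>F t in at_bot. dist (\<phi> t) L < \<epsilon>"
      unfolding eventually_at_bot_linorder
    proof (intro exI[of _ "- A"] allI impI)
      fix t assume "t \<le> - A"
      then obtain u where "u \<in> G" "\<bar>u - (-t)\<bar> \<le> \<delta> / 2" using A[of "-t"] by auto
      then show "dist (\<phi> t) L < \<epsilon>"
        using \<delta>(2)[of t "- u"] \<delta>(1) G_eq[of u] by (auto simp: dist_real_def abs_if split: if_splits)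
    qed
  qed
qed

text \<open>The mean value \<kappa> does not depend on \<open>x\<close>. Letting \<open>x\<close>
  tend to minus infinity, where \<phi> tends to \<open>L\<close>, evaluates it by dominated
  convergence.\<close>

lemma harmonic_mean_value:
  fixes \<phi> :: "real \<Rightarrow> real"
  assumes uc: "uniformly_continuous_on UNIV \<phi>" and bdd: "\<And>t. \<bar>\<phi> t\<bar> \<le> B"
    and harm: "\<And>t. \<phi> t = (\<integral>u. \<phi> (t - u) \<partial>\<eta>)"
    and le: "\<And>t. \<phi> t \<le> L" and eq: "\<phi> 0 = L"
    and \<kappa>: "\<And>x. (\<integral>z. fst z * \<phi> (x - fst z * snd z) \<partial>(\<eta> \<Otimes>\<^sub>M unit_uniform)) = \<kappa>"
  shows "L * mean = \<kappa>"
proof -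
  have lim: "(\<phi> \<longlongrightarrow> L) at_bot" by (rule harmonic_tendsto_sup[OF uc bdd harm le eq])
  have [measurable]: "\<phi> \<in> borel_measurable borel"
    by (rule borel_measurable_continuous_onI[OF uniformly_continuous_imp_continuous[OF uc]])
  let ?Q = "\<eta> \<Otimes>\<^sub>M unit_uniform"
  have int_abs: "integrable ?Q (\<lambda>z. \<bar>fst z\<bar> * B)"
  proof -
    have "integrable \<eta> (\<lambda>u. \<bar>u\<bar> * B)" using integrable_id by auto
    then show ?thesis using U.integral_pair_fst(1)[of "\<lambda>u. \<bar>u\<bar> * B" \<eta>] by simp
  qed
  have "(\<lambda>n. \<integral>z. fst z * \<phi> (- real n - fst z * snd z) \<partial>?Q) \<longlonglongrightarrow> (\<integral>z. fst z * L \<partial>?Q)"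
  proof (rule integral_dominated_convergence[OF _ _ int_abs])
    show "AE z in ?Q. (\<lambda>n. fst z * \<phi> (- real n - fst z * snd z)) \<longlonglongrightarrow> fst z * L"
    proof (intro AE_I2 tendsto_mult tendsto_const filterlim_compose[OF lim])
      fix z :: "real \<times> real"
      have "filterlim (\<lambda>n. - real n - c) at_bot sequentially" for c by real_asymp
      then show "filterlim (\<lambda>n. - real n - fst z * snd z) at_bot sequentially" .
    qed
    show "AE z in ?Q. norm (fst z * \<phi> (- real n - fst z * snd z)) \<le> \<bar>fst z\<bar> * B" for n
      by (intro AE_I2) (simp add: abs_mult mult_left_mono[OF bdd])
  qed measurable
  then have "(\<lambda>n::nat. \<kappa>) \<longlonglongrightarrow> (\<integral>z. fst z * L \<partial>(\<eta> \<Otimes>\<^sub>M unit_uniform))"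
    by (simp only: \<kappa>)
  moreover have "(\<integral>z. fst z * L \<partial>(\<eta> \<Otimes>\<^sub>M unit_uniform)) = L * mean"
    using U.integral_pair_fst(2)[of "\<lambda>u. u * L" \<eta>] by (simp add: mean_def)
  ultimately show ?thesis using LIMSEQ_unique tendsto_const by metis
qed

end

section \<open>Limits of translates of a renewal solution\<close>

lemma exists_limsup_sequence:
  fixes h :: "real \<Rightarrow> real"
  assumes bdd: "\<And>t. \<bar>h t\<bar> \<le> B"
  shows "\<exists>L x. filterlim x at_top sequentially \<and> (\<lambda>n. h (x n)) \<longlonglongrightarrow> L \<and>
           (\<forall>e>0. \<forall>\<^sub>F t in at_top. h t \<le> L + e)"
proof -
  \<comment> \<open>The upper limit is the infimum of all eventual upper bounds; the bound
    \<open>B\<close> makes this set nonempty and bounded below.\<close>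
  define S where "S = {l. \<forall>\<^sub>F t in at_top. h t \<le> l}"
  have "B \<in> S" using bdd by (auto simp: S_def abs_le_iff)
  have lower: "- B \<le> l" if l: "l \<in> S" for l
  proof -
    obtain t where "h t \<le> l"
      using l eventually_happens'[of at_top "\<lambda>t. h t \<le> l"] unfolding S_def by auto
    then show ?thesis using bdd[of t] by linarith
  qed
  define L where "L = Inf S"
  have up: "\<forall>\<^sub>F t in at_top. h t \<le> L + e" if "e > 0" for e
  proof -
    have "Inf S < L + e" using that by (simp add: L_def)
    then obtain l where "l \<in> S" "l < L + e" using cInf_lessD[of S "L + e"] \<open>B \<in> S\<close> by blast
    then show ?thesis by (auto simp: S_def elim!: eventually_mono)
  qed
  have "\<exists>t\<ge>real n. h t > L - 1 / (real n + 1)" for n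
  proof (rule ccontr)
    assume "\<not> ?thesis"
    then have "L - 1 / (real n + 1) \<in> S"
      by (auto simp: S_def eventually_at_top_linorder not_less)
    then have "L \<le> L - 1 / (real n + 1)"
      unfolding L_def by (intro cInf_lower bdd_belowI[of _ "- B"] lower)
    then show False by simp
  qed
  then obtain x where x: "\<And>n. x n \<ge> real n" "\<And>n. h (x n) > L - 1 / (real n + 1)" by metis
  have x_lim: "filterlim x at_top sequentially"
    by (rule filterlim_at_top_mono[OF filterlim_real_sequentially]) (auto simp: x)
  moreover have "(\<lambda>n. h (x n)) \<longlonglongrightarrow> L"
  proof (rule order_tendstoI)
    fix l assume "l < L"
    have "(\<lambda>n. L - 1 / (real n + 1)) \<longlonglongrightarrow> L" by real_asymp
    then have "\<forall>\<^sub>F n in sequentially. l < L - 1 / (real n + 1)" using \<open>l < L\<close> by (rule order_tendstoD)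
    then show "\<forall>\<^sub>F n in sequentially. l < h (x n)"
      by (rule eventually_mono) (use x(2) in \<open>auto intro: less_trans\<close>)
  next
    fix l assume "L < l"
    then have "\<forall>\<^sub>F t in at_top. h t \<le> L + (l - L) / 2" by (intro up) auto
    then have "\<forall>\<^sub>F n in sequentially. h (x n) \<le> L + (l - L) / 2"
      using x_lim by (rule eventually_compose_filterlim)
    then show "\<forall>\<^sub>F n in sequentially. h (x n) < l"
      by (rule eventually_mono) (use \<open>L < l\<close> in \<open>simp add: field_simps\<close>)
  qed
  ultimately show ?thesis using up by blast
qed

lemma set_integrable_exp_atMost:
  fixes a x :: real
  assumes "a > 0"
  shows "set_integrable lborel {..x} (\<lambda>t. exp (a * t))"
proof -
  have "(\<integral>\<^sup>+s. ennreal (exp (a * (x - s))) * indicator {0..} s \<partial>lborel) = ennreal (0 - (- exp (a * (x - 0)) / a))"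
  proof (rule nn_integral_FTC_atLeast)
    show "((\<lambda>s. - exp (a * (x - s)) / a) \<longlongrightarrow> 0) at_top" using assms by real_asymp
    show "((\<lambda>s. - exp (a * (x - s)) / a) has_real_derivative exp (a * (x - s))) (at s)" for s
      using assms by (auto intro!: derivative_eq_intros)
  qed auto
  then have "integrable lborel (\<lambda>s. exp (a * (x - s)) * indicator {0..} s)"
    by (intro integrableI_nonneg) (auto simp: ennreal_mult' ennreal_indicator less_top[symmetric] mult.commute)
  then have "integrable lborel (\<lambda>s. indicator {..x} (x + (-1) * s) * exp (a * (x + (-1) * s)))"
    by (rule Bochner_Integration.integrable_cong[THEN iffD1, rotated -1]) (auto simp: indicator_def)
  then have "integrable lborel (\<lambda>t. indicator {..x} t * exp (a * t))"
    by (subst lborel_integrable_real_affine_iff[of "-1" _ x, symmetric]) auto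
  then show ?thesis by (simp add: set_integrable_def)
qed

text \<open>\<open>f_upper\<close> and \<open>f_lower\<close> control the rise and the fall of
  \<open>f\<close> over a distance \<open>h\<close> by values of \<open>f\<close> itself, in the
  second case at a point \<open>c\<close> further left. \<open>growth\<close> is what finite moments
  of every order below the critical one provide; boundedness of \<open>f\<close> is a
  consequence.\<close>

locale renewal_equation = renewal_step \<eta> a for \<eta> a +
  fixes f g :: "real \<Rightarrow> real" and b K c Bg :: real
  assumes f_nonneg: "\<And>t. 0 \<le> f t"
    and f_meas[measurable]: "f \<in> borel_measurable borel"
    and g_nonneg: "\<And>t. 0 \<le> g t"
    and g_integrable: "integrable lborel g"
    and g_bdd: "\<And>t. g t \<le> Bg"
    and g_lim: "(g \<longlongrightarrow> 0) at_top"
    and renewal: "\<And>t. f t = (\<integral>u. f (t - u) \<partial>\<eta>) + g t"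
    and growth: "\<And>\<epsilon>. 0 < \<epsilon> \<Longrightarrow> \<epsilon> \<le> a \<Longrightarrow> \<exists>C. \<forall>t. f t \<le> C * exp (\<epsilon> * t)"
    and K_nonneg: "0 \<le> K" and c_nonneg: "0 \<le> c" and b_nonneg: "0 \<le> b"
    and f_upper: "\<And>t h. 0 \<le> h \<Longrightarrow> f (t + h) \<le> exp (b * h) * f t"
    and f_lower: "\<And>t h. 0 \<le> h \<Longrightarrow> f t - f (t + h) \<le> K * (exp h - 1) * f (t - c)"
begin

abbreviation Q where "Q \<equiv> \<eta> \<Otimes>\<^sub>M unit_uniform"

definition F :: "real \<Rightarrow> real" where "F y = (LBINT t:{..y}. f t)"
definition I :: "real \<Rightarrow> real" where "I y = (LBINT t:{..y}. g t)"

text \<open>Up to a factor, an integrable dominator for \<open>u * \<phi> (x - u * s)\<close> when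
  \<phi> grows at most like \<open>1 + exp (a / 2 * t)\<close>; the exponential takes care of
  negative steps.\<close>

definition w :: "real \<Rightarrow> real" where "w u = 2 * \<bar>u\<bar> + 2 / a * exp (- a * u)"

definition modulus :: "real \<Rightarrow> real" where
  "modulus h = (exp (b * h) - 1) + K * (exp h - 1)"

text \<open>The conditions are homogeneous in \<phi>, translation invariant and closed under
  pointwise limits, so rescaled translates of \<open>f\<close> and their limits satisfy them with
  the same constants.\<close>

definition regular :: "(real \<Rightarrow> real) \<Rightarrow> bool" where
  "regular \<phi> \<longleftrightarrow> (\<forall>t. 0 \<le> \<phi> t) \<and> (\<forall>t. \<forall>h\<ge>0. \<phi> (t + h) \<le> exp (b * h) * \<phi> t) \<and>
     (\<forall>t. \<forall>h\<ge>0. \<phi> t - \<phi> (t + h) \<le> K * (exp h - 1) * \<phi> (t - c))"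

lemma regular_modulus:
  assumes "regular \<phi>" and W: "\<And>r. r \<le> max s t \<Longrightarrow> \<phi> r \<le> W"
  shows "\<bar>\<phi> s - \<phi> t\<bar> \<le> modulus \<bar>s - t\<bar> * W"
proof -
  have *: "\<bar>\<phi> l - \<phi> (l + h)\<bar> \<le> modulus h * W" if h: "h \<ge> 0" and le: "l \<le> max s t" for l h
  proof -
    have W0: "W \<ge> 0" using W[OF le] assms(1) by (auto simp: regular_def intro: order_trans)
    have e: "exp (b * h) - 1 \<ge> 0" "K * (exp h - 1) \<ge> 0" using h b_nonneg K_nonneg by auto
    have "\<phi> (l + h) \<le> exp (b * h) * \<phi> l" using assms(1) h by (auto simp: regular_def)
    then have "\<phi> (l + h) - \<phi> l \<le> (exp (b * h) - 1) * \<phi> l" by (simp add: algebra_simps)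
    also have "\<dots> \<le> (exp (b * h) - 1) * W" by (rule mult_left_mono[OF W[OF le] e(1)])
    finally have 1: "\<phi> (l + h) - \<phi> l \<le> (exp (b * h) - 1) * W" .
    have "\<phi> l - \<phi> (l + h) \<le> K * (exp h - 1) * \<phi> (l - c)" using assms(1) h by (auto simp: regular_def)
    also have "\<dots> \<le> K * (exp h - 1) * W"
      by (rule mult_left_mono[OF W e(2)]) (use le c_nonneg in auto)
    finally have 2: "\<phi> l - \<phi> (l + h) \<le> K * (exp h - 1) * W" .
    have "0 \<le> (exp (b * h) - 1) * W" "0 \<le> K * (exp h - 1) * W" using e W0 by auto
    then show ?thesis using 1 2 unfolding modulus_def by (simp only: distrib_right abs_le_iff) linarith
  qed
  show ?thesis
  proof (cases "s \<le> t")
    case True then show ?thesis using *[of "t - s" s] by simp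
  next
    case False then show ?thesis using *[of "s - t" t] by (simp add: abs_minus_commute)
  qed
qed

lemma modulus_small:
  assumes "\<kappa> > 0"
  shows "\<exists>\<delta>>0. \<delta> < 1 \<and> (\<forall>h. \<bar>h\<bar> < \<delta> \<longrightarrow> modulus h * W < \<kappa>)"
proof -
  have "isCont (\<lambda>h. modulus h * W) 0" unfolding modulus_def by (intro continuous_intros)
  then have "((\<lambda>h. modulus h * W) \<longlongrightarrow> modulus 0 * W) (nhds 0)"
    using tendsto_at_iff_tendsto_nhds[of "\<lambda>h. modulus h * W" 0] by (simp add: isCont_def)
  then have "\<forall>\<^sub>F h in nhds 0. modulus h * W < \<kappa>"
    by (rule order_tendstoD) (use assms in \<open>simp add: modulus_def\<close>)
  then obtain d where "d > 0" "\<And>h. dist h 0 < d \<Longrightarrow> modulus h * W < \<kappa>"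
    unfolding eventually_nhds_metric by blast
  then show ?thesis by (intro exI[of _ "min d (1/2)"]) (auto simp: dist_real_def)
qed

lemma regular_uniformly_continuous:
  assumes "regular \<phi>" and W: "\<And>r. \<phi> r \<le> W"
  shows "uniformly_continuous_on UNIV \<phi>"
  unfolding uniformly_continuous_on_def
proof (intro allI impI)
  fix \<kappa> :: real assume "\<kappa> > 0"
  then obtain \<delta> where d: "\<delta> > 0" "\<And>h. \<bar>h\<bar> < \<delta> \<Longrightarrow> modulus h * W < \<kappa>" using modulus_small by blast
  have "dist (\<phi> x') (\<phi> x) < \<kappa>" if "dist x' x < \<delta>" for x x'
    using regular_modulus[OF assms(1), of x' x W] W d(2)[of "\<bar>x' - x\<bar>"] that
    by (simp add: dist_real_def)
  then show "\<exists>d>0. \<forall>x\<in>UNIV. \<forall>x'\<in>UNIV. dist x' x < d \<longrightarrow> dist (\<phi> x') (\<phi> x) < \<kappa>" using d(1) by blast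
qed

lemma regular_equicontinuous:
  assumes "\<And>n. regular (\<phi> n)" and W: "\<And>n t. \<phi> n t \<le> B * (1 + exp (a / 2 * t))" and "\<kappa> > 0"
  shows "\<exists>\<delta>>0. \<forall>n s. \<bar>s - t\<bar> < \<delta> \<longrightarrow> \<bar>\<phi> n s - \<phi> n t\<bar> < \<kappa>"
proof -
  \<comment> \<open>A bound for all points to the left of t + 1, uniform in the index of the
    sequence; this is why \<delta> is required to stay below 1.\<close>
  define W where "W = \<bar>B\<bar> * (1 + exp (a / 2 * (t + 1)))"
  obtain \<delta> where d: "\<delta> > 0" "\<delta> < 1" "\<And>h. \<bar>h\<bar> < \<delta> \<Longrightarrow> modulus h * W < \<kappa>"
    using modulus_small[OF \<open>\<kappa> > 0\<close>] by blast
  have "\<bar>\<phi> n s - \<phi> n t\<bar> < \<kappa>" if "\<bar>s - t\<bar> < \<delta>" for n s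
  proof -
    have "\<phi> n r \<le> W" if "r \<le> max s t" for r
    proof -
      have "r \<le> t + 1" using that \<open>\<bar>s - t\<bar> < \<delta>\<close> d(2) by linarith
      have "\<phi> n r \<le> B * (1 + exp (a / 2 * r))" by (rule W)
      also have "\<dots> \<le> \<bar>B\<bar> * (1 + exp (a / 2 * r))" by (intro mult_right_mono) (auto simp: add_nonneg_nonneg)
      also have "\<dots> \<le> W" unfolding W_def using \<open>r \<le> t + 1\<close> a_pos by (intro mult_left_mono) auto
      finally show ?thesis .
    qed
    then have "\<bar>\<phi> n s - \<phi> n t\<bar> \<le> modulus \<bar>s - t\<bar> * W" by (rule regular_modulus[OF assms(1)])
    also have "\<dots> < \<kappa>" using d(3) that by simp
    finally show ?thesis .
  qed
  then show ?thesis using d(1) by blast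
qed

lemma integrable_w: "integrable \<eta> w"
  unfolding w_def using integrable_id integrable_exp by auto

lemma integrable_w_fst: "integrable Q (\<lambda>z. w (fst z))"
  using U.integral_pair_fst(1)[of w \<eta>] integrable_w by auto

lemma AE_snd_unit: "AE z in Q. snd z \<in> {0..1}"
proof -
  have "AE s in unit_uniform. s \<in> {0..1}"
    unfolding unit_uniform_def by (subst AE_density) (auto simp: indicator_def)
  then have "AE u in \<eta>. AE s in unit_uniform. snd (u, s) \<in> {0..1}" by simp
  then show ?thesis
  proof (rule \<eta>U.AE_pair_measure[rotated])
    show "{z \<in> space Q. snd z \<in> {0..1}} \<in> sets Q" by measurable
  qed
qed

lemma w_dominates:
  assumes "s \<in> {0..1}"
  shows "\<bar>u\<bar> * (1 + exp (a / 2 * (x - u * s))) \<le> (1 + exp (a / 2 * x)) * w u"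
proof -
  have e0: "exp (- a * u) \<ge> 0" by simp
  have w1: "\<bar>u\<bar> \<le> w u" unfolding w_def using a_pos by (simp add: add_nonneg_nonneg)
  have "\<bar>u\<bar> * exp (- (a / 2) * (u * s)) \<le> w u"
  proof (cases "u \<ge> 0")
    case True
    then have "exp (- (a / 2) * (u * s)) \<le> 1" using a_pos assms by simp
    then have "\<bar>u\<bar> * exp (- (a / 2) * (u * s)) \<le> \<bar>u\<bar> * 1" by (intro mult_left_mono) auto
    then show ?thesis using w1 by simp
  next
    case False
    define v where "v = - u"
    have v: "v > 0" "u = - v" using False by (auto simp: v_def)
    have "v * s \<le> v * 1" using v assms by (intro mult_left_mono) auto
    then have "exp (a / 2 * (v * s)) \<le> exp (a / 2 * v)" using a_pos by simp
    \<comment> \<open>The growth exponent a / 2 is only half of what the step law can integrate; the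
      other half absorbs the factor \<open>v\<close>.\<close>
    moreover have "v \<le> 2 / a * exp (a / 2 * v)"
      using exp_ge_add_one_self[of "a / 2 * v"] a_pos by (simp add: field_simps)
    ultimately have "v * exp (a / 2 * (v * s)) \<le> (2 / a * exp (a / 2 * v)) * exp (a / 2 * v)"
      using v a_pos by (intro mult_mono) auto
    also have "\<dots> = 2 / a * exp (a * v)" by (simp add: mult.assoc flip: exp_add)
    finally show ?thesis unfolding w_def v(2) using v by simp
  qed
  then have "exp (a / 2 * x) * (\<bar>u\<bar> * exp (- (a / 2) * (u * s))) \<le> exp (a / 2 * x) * w u"
    by (intro mult_left_mono) auto
  moreover have "exp (a / 2 * (x - u * s)) = exp (a / 2 * x) * exp (- (a / 2) * (u * s))"
    by (simp only: exp_add[symmetric]) (simp add: right_diff_distrib)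
  ultimately have e: "\<bar>u\<bar> * exp (a / 2 * (x - u * s)) \<le> exp (a / 2 * x) * w u"
    by (simp only: mult.left_commute)
  show ?thesis using add_mono[OF w1 e] by (simp only: distrib_left distrib_right mult_1 mult_1_right)
qed

lemma integrable_exp_half: "integrable \<eta> (\<lambda>u. exp (- (a / 2) * u))"
proof (rule Bochner_Integration.integrable_bound[of _ "\<lambda>u. 1 + exp (- a * u)"])
  show "AE u in \<eta>. norm (exp (- (a / 2) * u)) \<le> norm (1 + exp (- a * u))"
  proof (intro AE_I2)
    fix u
    show "norm (exp (- (a / 2) * u)) \<le> norm (1 + exp (- a * u))"
    proof (cases "u \<ge> 0")
      case True
      then have "exp (- (a / 2) * u) \<le> 1" using a_pos by simp
      then show ?thesis by (simp add: add_increasing2)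
    next
      case False
      then have "a * u \<le> a * u / 2" using a_pos by (simp add: mult_le_0_iff)
      then have "exp (- (a / 2) * u) \<le> exp (- a * u)" by simp
      then show ?thesis by (simp add: add_increasing)
    qed
  qed
qed (use integrable_exp in auto)

lemma integrable_dominator: "integrable \<eta> (\<lambda>u. B * (1 + exp (a / 2 * (t - u))))"
proof -
  have "exp (a / 2 * (t - u)) = exp (a / 2 * t) * exp (- (a / 2) * u)" for u
    by (simp only: exp_add[symmetric]) (simp add: right_diff_distrib)
  then show ?thesis using integrable_exp_half by simp
qed

lemma integrable_shift:
  assumes [measurable]: "\<phi> \<in> borel_measurable borel" and le: "\<And>t. \<bar>\<phi> t\<bar> \<le> B * (1 + exp (a / 2 * t))"
  shows "integrable \<eta> (\<lambda>u. \<phi> (t - u))"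
proof (rule Bochner_Integration.integrable_bound[OF integrable_dominator[of B t]])
  show "AE u in \<eta>. norm (\<phi> (t - u)) \<le> norm (B * (1 + exp (a / 2 * (t - u))))"
  proof (intro AE_I2)
    fix u
    show "norm (\<phi> (t - u)) \<le> norm (B * (1 + exp (a / 2 * (t - u))))"
      using le[of "t - u"] abs_ge_self order_trans unfolding real_norm_def by blast
  qed
qed measurable

lemma shift_le_w:
  assumes "\<bar>\<phi> (x - u * s)\<bar> \<le> B * (1 + exp (a / 2 * (x - u * s)))" and "s \<in> {0..1}" "B \<ge> 0"
  shows "\<bar>u * \<phi> (x - u * s)\<bar> \<le> B * ((1 + exp (a / 2 * x)) * w u)"
proof -
  have "\<bar>u * \<phi> (x - u * s)\<bar> \<le> \<bar>u\<bar> * (B * (1 + exp (a / 2 * (x - u * s))))"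
    unfolding abs_mult by (rule mult_left_mono[OF assms(1)]) simp
  also have "\<dots> = B * (\<bar>u\<bar> * (1 + exp (a / 2 * (x - u * s))))" by simp
  also have "\<dots> \<le> B * ((1 + exp (a / 2 * x)) * w u)"
    by (rule mult_left_mono[OF w_dominates]) (use assms in auto)
  finally show ?thesis .
qed

lemma integrable_mean_kernel:
  assumes [measurable]: "\<phi> \<in> borel_measurable borel" and le: "\<And>t. \<bar>\<phi> t\<bar> \<le> B * (1 + exp (a / 2 * t))"
    and "B \<ge> 0"
  shows "integrable Q (\<lambda>z. fst z * \<phi> (x - fst z * snd z))"
proof (rule Bochner_Integration.integrable_bound[of _ "\<lambda>z. B * ((1 + exp (a / 2 * x)) * w (fst z))"])
  show "AE z in Q. norm (fst z * \<phi> (x - fst z * snd z)) \<le> norm (B * ((1 + exp (a / 2 * x)) * w (fst z)))"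
    using AE_snd_unit
  proof eventually_elim
    case (elim z)
    show ?case using shift_le_w[of \<phi> x "fst z" "snd z" B, OF le elim \<open>B \<ge> 0\<close>] abs_ge_self order_trans
      unfolding real_norm_def by blast
  qed
qed (use integrable_w_fst in auto)

lemma f_growth: obtains C where "C \<ge> 0" "\<And>t. f t \<le> C * exp (a / 2 * t)"
proof -
  obtain C where C: "\<And>t. f t \<le> C * exp (a / 2 * t)" using growth[of "a / 2"] a_pos by auto
  have "C \<ge> 0" using C[of 0] f_nonneg[of 0] by simp
  then show ?thesis using C that by blast
qed

lemma f_growth': obtains C where "C \<ge> 0" "\<And>t. \<bar>f t\<bar> \<le> C * (1 + exp (a / 2 * t))"
proof -
  obtain C where "C \<ge> 0" "\<And>t. f t \<le> C * exp (a / 2 * t)" using f_growth by blast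
  then show ?thesis using f_nonneg that[of C] by (simp add: algebra_simps add_increasing)
qed

lemma set_integrable_f: "set_integrable lborel {..y} f"
proof -
  obtain C where C: "C \<ge> 0" "\<And>t. f t \<le> C * exp (a / 2 * t)" using f_growth by blast
  have "set_integrable lborel {..y} (\<lambda>t. C * exp (a / 2 * t))"
    using set_integrable_exp_atMost[of "a / 2" y] a_pos by auto
  then show ?thesis
    unfolding set_integrable_def
  proof (rule Bochner_Integration.integrable_bound)
    show "AE t in lborel. norm (indicator {..y} t *\<^sub>R f t) \<le> norm (indicator {..y} t *\<^sub>R (C * exp (a / 2 * t)))"
    proof (intro AE_I2)
      fix t
      have "\<bar>f t\<bar> \<le> \<bar>C * exp (a / 2 * t)\<bar>" using C(2)[of t] f_nonneg[of t] by linarith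
      then show "norm (indicator {..y} t *\<^sub>R f t) \<le> norm (indicator {..y} t *\<^sub>R (C * exp (a / 2 * t)))"
        by (cases "t \<in> {..y}") simp_all
    qed
  qed auto
qed

lemma set_integrable_g: "set_integrable lborel {..y} g"
  unfolding set_integrable_def using g_integrable by (intro integrable_mult_indicator) auto

lemma F_increment: "F x - F (x - u) = (\<integral>s. u * f (x - u * s) \<partial>unit_uniform)"
proof (cases "u = 0")
  case False
  define H where "H y = (indicator {..x} y - indicator {..x - u} y) * f y" for y
  have "F x - F (x - u) = (\<integral>y. H y \<partial>lborel)"
    unfolding F_def H_def set_lebesgue_integral_def left_diff_distrib
    using set_integrable_f[of x] set_integrable_f[of "x - u"]
    by (subst Bochner_Integration.integral_diff) (auto simp: set_integrable_def)
  also have "\<dots> = \<bar>u\<bar> *\<^sub>R (\<integral>s. H (x + (-u) * s) \<partial>lborel)"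
    using lborel_integral_real_affine[of "-u" H x] False by simp
  also have "\<dots> = (\<integral>s. \<bar>u\<bar> * H (x + (-u) * s) \<partial>lborel)" by simp
  also have "\<dots> = (\<integral>s. indicator {0..1} s * (u * f (x - u * s)) \<partial>lborel)"
  proof (rule integral_cong_AE)
    \<comment> \<open>The difference of indicators selects [0, 1) for positive and (0, 1] for
      negative \<open>u\<close>; the endpoints are discarded as a null set.\<close>
    show "AE s in lborel. \<bar>u\<bar> * H (x + (-u) * s) = indicator {0..1} s * (u * f (x - u * s))"
      using AE_lborel_singleton[of 0] AE_lborel_singleton[of 1]
    proof eventually_elim
      case (elim s)
      show ?case
      proof (cases "u > 0")
        case True
        then have "u * s \<ge> 0 \<longleftrightarrow> s \<ge> 0" "u * s \<ge> u \<longleftrightarrow> s \<ge> 1" by (auto simp: zero_le_mult_iff)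
        then show ?thesis using elim True by (auto simp: H_def indicator_def)
      next
        case F: False
        then have "u < 0" using False by simp
        then have "u * s \<ge> 0 \<longleftrightarrow> s \<le> 0" "u * s \<ge> u \<longleftrightarrow> s \<le> 1" by (auto simp: zero_le_mult_iff)
        then show ?thesis using elim \<open>u < 0\<close> by (auto simp: H_def indicator_def)
      qed
    qed
  qed (auto simp: H_def)
  also have "\<dots> = (\<integral>s. u * f (x - u * s) \<partial>unit_uniform)"
  proof -
    have "unit_uniform = density lborel (\<lambda>s. ennreal (indicator {0..1} s))"
      by (simp add: unit_uniform_def ennreal_indicator)
    then show ?thesis using integral_density[of "\<lambda>s. u * f (x - u * s)" lborel "indicator {0..1}"] by simp
  qed
  finally show ?thesis .
qed simp

text \<open>The renewal equation integrated over (-\<infinity>, x]. Fubini applies because the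
  integrand is nonnegative and, by the equation itself, its inner integral is the integrable
  function \<open>f - g\<close>.\<close>

lemma integral_F_increment: "integrable \<eta> (\<lambda>u. F (x - u)) \<and> (\<integral>u. F (x - u) \<partial>\<eta>) = F x - I x"
proof -
  interpret L: pair_sigma_finite lborel \<eta> ..
  obtain C where C: "\<And>t. \<bar>f t\<bar> \<le> C * (1 + exp (a / 2 * t))" using f_growth' by blast
  define h where "h t u = indicator {..x} t * f (t - u)" for t u
  have [measurable]: "case_prod h \<in> borel_measurable (lborel \<Otimes>\<^sub>M \<eta>)"
    unfolding h_def by measurable
  have inner: "(\<integral>u. h t u \<partial>\<eta>) = indicator {..x} t * (f t - g t)" for t
    using renewal[of t] by (simp add: h_def)
  have h_nonneg: "h t u \<ge> 0" for t u using f_nonneg by (simp add: h_def)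
  have outer: "integrable lborel (\<lambda>t. indicator {..x} t * (f t - g t))"
    using set_integral_diff(1)[OF set_integrable_f set_integrable_g, of x] by (simp add: set_integrable_def)
  have int: "integrable (lborel \<Otimes>\<^sub>M \<eta>) (case_prod h)"
  proof (rule L.Fubini_integrable)
    show "integrable lborel (\<lambda>t. \<integral>u. norm (case (t, u) of (t, u) \<Rightarrow> h t u) \<partial>\<eta>)"
      using outer by (simp add: h_nonneg inner)
    show "AE t in lborel. integrable \<eta> (\<lambda>u. case (t, u) of (t, u) \<Rightarrow> h t u)"
      unfolding h_def using integrable_shift[OF f_meas C] by simp
  qed measurable
  have F: "(\<integral>t. h t u \<partial>lborel) = F (x - u)" for u
  proof -
    have "(\<integral>t. h t u \<partial>lborel) = (\<integral>y. h (u + 1 * y) u \<partial>lborel)"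
      by (subst lborel_integral_real_affine[of 1 _ u]) auto
    also have "\<dots> = F (x - u)" unfolding F_def set_lebesgue_integral_def h_def
      by (intro Bochner_Integration.integral_cong) (auto simp: indicator_def)
    finally show ?thesis .
  qed
  have "integrable \<eta> (\<lambda>u. \<integral>t. h t u \<partial>lborel)" by (rule L.integrable_snd[OF int])
  moreover have "(\<integral>u. (\<integral>t. h t u \<partial>lborel) \<partial>\<eta>) = (\<integral>t. (\<integral>u. h t u \<partial>\<eta>) \<partial>lborel)"
    by (rule L.Fubini_integral[OF int])
  moreover have "(\<integral>t. (\<integral>u. h t u \<partial>\<eta>) \<partial>lborel) = F x - I x"
    unfolding inner F_def I_def
    using set_integral_diff(2)[OF set_integrable_f set_integrable_g, of x] by (simp add: set_lebesgue_integral_def)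
  ultimately show ?thesis unfolding F by simp
qed

text \<open>Since the step law has mass 1, \<open>F x\<close> minus the average of
  \<open>F (x - u)\<close> is an average of increments, and the integrated equation leaves only the
  integral of \<open>g\<close> up to \<open>x\<close>.\<close>

lemma integrated_renewal: "(\<integral>z. fst z * f (x - fst z * snd z) \<partial>Q) = I x"
proof -
  obtain C where C: "C \<ge> 0" "\<And>t. \<bar>f t\<bar> \<le> C * (1 + exp (a / 2 * t))" using f_growth' by blast
  have "(\<integral>z. fst z * f (x - fst z * snd z) \<partial>Q) = (\<integral>u. (\<integral>s. u * f (x - u * s) \<partial>unit_uniform) \<partial>\<eta>)"
    using \<eta>U.integral_fst'[OF integrable_mean_kernel[OF f_meas C(2,1), of x]] by simp
  also have "\<dots> = (\<integral>u. F x - F (x - u) \<partial>\<eta>)" by (simp only: F_increment)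
  also have "\<dots> = I x"
    using integral_F_increment[of x] by (subst Bochner_Integration.integral_diff) auto
  finally show ?thesis .
qed

lemma regular_rescaled:
  assumes "\<sigma> > 0"
  shows "regular (\<lambda>t. f (x + t) / \<sigma>)"
  unfolding regular_def
proof (intro conjI allI impI)
  show "0 \<le> f (x + t) / \<sigma>" for t using f_nonneg assms by simp
  show "f (x + (t + h)) / \<sigma> \<le> exp (b * h) * (f (x + t) / \<sigma>)" if "h \<ge> 0" for t h
    using divide_right_mono[OF f_upper[OF that, of "x + t"], of \<sigma>] assms by (simp add: add.assoc)
  show "f (x + t) / \<sigma> - f (x + (t + h)) / \<sigma> \<le> K * (exp h - 1) * (f (x + (t - c)) / \<sigma>)" if "h \<ge> 0" for t h
    using divide_right_mono[OF f_lower[OF that, of "x + t"], of \<sigma>] assms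
    by (simp add: add.assoc add_diff_eq diff_divide_distrib)
qed

definition stationary :: "real \<Rightarrow> (real \<Rightarrow> real) \<Rightarrow> bool" where
  "stationary \<kappa> \<phi> \<longleftrightarrow> regular \<phi> \<and> (\<forall>t. \<phi> t = (\<integral>u. \<phi> (t - u) \<partial>\<eta>)) \<and>
     (\<forall>t. (\<integral>z. fst z * \<phi> (t - fst z * snd z) \<partial>Q) = \<kappa>)"

lemma stationaryD:
  assumes "stationary \<kappa> \<phi>"
  shows "regular \<phi>" "\<phi> t = (\<integral>u. \<phi> (t - u) \<partial>\<eta>)"
    "(\<integral>z. fst z * \<phi> (t - fst z * snd z) \<partial>Q) = \<kappa>"
  using assms unfolding stationary_def by blast+

text \<open>The normalization \<sigma> is general in order to serve twice: with \<sigma> tending to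
  infinity the forcing term disappears and \<kappa> = 0; with \<sigma> = 1 and \<open>x\<close>
  tending to infinity \<kappa> is the full integral of \<open>g\<close>.\<close>

lemma blowup_limit:
  fixes x \<sigma> :: "nat \<Rightarrow> real"
  assumes \<sigma>: "\<And>n. \<sigma> n > 0" and B0: "B \<ge> 0"
    and B: "\<And>n t. f (x n + t) / \<sigma> n \<le> B * (1 + exp (a / 2 * t))"
    and g0: "\<And>t. (\<lambda>n. g (x n + t) / \<sigma> n) \<longlonglongrightarrow> 0"
    and \<kappa>: "\<And>t. (\<lambda>n. I (x n + t) / \<sigma> n) \<longlonglongrightarrow> \<kappa>"
  obtains r \<phi> where "strict_mono r" "\<And>t. (\<lambda>n. f (x (r n) + t) / \<sigma> (r n)) \<longlonglongrightarrow> \<phi> t"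
    "stationary \<kappa> \<phi>"
proof -
  define \<phi>n where "\<phi>n n t = f (x n + t) / \<sigma> n" for n t
  have [measurable]: "\<phi>n n \<in> borel_measurable borel" for n unfolding \<phi>n_def by measurable
  have reg: "regular (\<phi>n n)" for n unfolding \<phi>n_def by (rule regular_rescaled[OF \<sigma>])
  have \<phi>n0: "0 \<le> \<phi>n n t" for n t using reg by (simp add: regular_def)
  have bnd: "\<phi>n n t \<le> B * (1 + exp (a / 2 * t))" for n t using B by (simp only: \<phi>n_def)
  have bnd': "\<bar>\<phi>n n t\<bar> \<le> B * (1 + exp (a / 2 * t))" for n t using bnd \<phi>n0 by (simp only: abs_of_nonneg)
  obtain r \<phi> where r: "strict_mono r" and lim: "\<And>t. (\<lambda>n. \<phi>n (r n) t) \<longlonglongrightarrow> \<phi> t"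
    using pointwise_convergent_subsequence[of \<phi>n] regular_equicontinuous[OF reg bnd] bnd' by metis
  have [measurable]: "\<phi> \<in> borel_measurable borel"
    by (rule borel_measurable_LIMSEQ_real[of _ "\<lambda>n. \<phi>n (r n)"]) (auto simp: lim)
  have regular: "regular \<phi>"
    unfolding regular_def
  proof (intro conjI allI impI)
    show "0 \<le> \<phi> t" for t by (rule LIMSEQ_le_const[OF lim]) (use \<phi>n0 in auto)
    show "\<phi> (t + h) \<le> exp (b * h) * \<phi> t" if "h \<ge> 0" for t h
      by (rule LIMSEQ_le[OF lim tendsto_mult[OF tendsto_const lim]]) (use reg that in \<open>auto simp: regular_def\<close>)
    show "\<phi> t - \<phi> (t + h) \<le> K * (exp h - 1) * \<phi> (t - c)" if "h \<ge> 0" for t h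
      by (rule LIMSEQ_le[OF tendsto_diff[OF lim lim] tendsto_mult[OF tendsto_const lim]])
        (use reg that in \<open>auto simp: regular_def\<close>)
  qed
  have eqn: "\<phi>n n t = (\<integral>u. \<phi>n n (t - u) \<partial>\<eta>) + g (x n + t) / \<sigma> n" for n t
    using renewal[of "x n + t"] by (simp add: \<phi>n_def add_diff_eq add_divide_distrib)
  have harm: "\<phi> t = (\<integral>u. \<phi> (t - u) \<partial>\<eta>)" for t
  proof -
    have "(\<lambda>n. \<integral>u. \<phi>n (r n) (t - u) \<partial>\<eta>) \<longlonglongrightarrow> (\<integral>u. \<phi> (t - u) \<partial>\<eta>)"
      by (rule integral_dominated_convergence[OF _ _ integrable_dominator[of B t]])
        (auto intro!: AE_I2 lim bnd' simp del: times_divide_eq_left)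
    then have "(\<lambda>n. (\<integral>u. \<phi>n (r n) (t - u) \<partial>\<eta>) + g (x (r n) + t) / \<sigma> (r n)) \<longlonglongrightarrow> (\<integral>u. \<phi> (t - u) \<partial>\<eta>) + 0"
      using LIMSEQ_subseq_LIMSEQ[OF g0 r] by (intro tendsto_add) (auto simp: o_def)
    then show ?thesis using lim[of t] LIMSEQ_unique by (fastforce simp flip: eqn)
  qed
  have "(\<integral>z. fst z * \<phi> (t - fst z * snd z) \<partial>Q) = \<kappa>" for t
  proof -
    have I_eq: "(\<integral>z. fst z * \<phi>n n (t - fst z * snd z) \<partial>Q) = I (x n + t) / \<sigma> n" for n
      using integrated_renewal[of "x n + t"] by (simp add: \<phi>n_def add_diff_eq)
    have "(\<lambda>n. \<integral>z. fst z * \<phi>n (r n) (t - fst z * snd z) \<partial>Q) \<longlonglongrightarrow> (\<integral>z. fst z * \<phi> (t - fst z * snd z) \<partial>Q)"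
    proof (rule integral_dominated_convergence)
      show "integrable Q (\<lambda>z. B * ((1 + exp (a / 2 * t)) * w (fst z)))" using integrable_w_fst by auto
      show "AE z in Q. (\<lambda>n. fst z * \<phi>n (r n) (t - fst z * snd z)) \<longlonglongrightarrow> fst z * \<phi> (t - fst z * snd z)"
        by (intro AE_I2 tendsto_mult tendsto_const lim)
      show "AE z in Q. norm (fst z * \<phi>n (r n) (t - fst z * snd z)) \<le> B * ((1 + exp (a / 2 * t)) * w (fst z))" for n
        using AE_snd_unit
      proof eventually_elim
        case (elim z)
        show ?case using shift_le_w[of "\<phi>n (r n)" t "fst z" "snd z" B, OF bnd' elim B0] by simp
      qed
    qed measurable
    moreover have "(\<lambda>n. I (x (r n) + t) / \<sigma> (r n)) \<longlonglongrightarrow> \<kappa>"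
      using LIMSEQ_subseq_LIMSEQ[OF \<kappa> r] by (simp add: o_def)
    ultimately show ?thesis unfolding I_eq using LIMSEQ_unique by blast
  qed
  then have "stationary \<kappa> \<phi>" unfolding stationary_def using regular harm by blast
  with r lim show ?thesis unfolding \<phi>n_def by (rule that)
qed

lemma g_ratio_tendsto_0:
  assumes "filterlim \<sigma> at_top sequentially"
  shows "(\<lambda>n. g (y n) / \<sigma> n) \<longlonglongrightarrow> 0"
proof (rule Lim_null_comparison)
  show "(\<lambda>n. Bg / \<sigma> n) \<longlonglongrightarrow> 0"
    using assms by (intro tendsto_divide_0[OF tendsto_const]) (auto intro: filterlim_at_top_imp_at_infinity)
  show "\<forall>\<^sub>F n in sequentially. norm (g (y n) / \<sigma> n) \<le> Bg / \<sigma> n"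
  proof -
    have "\<forall>\<^sub>F n in sequentially. 0 < \<sigma> n" using assms filterlim_at_top_dense by blast
    then show ?thesis
      by eventually_elim (simp add: g_nonneg g_bdd divide_right_mono)
  qed
qed

lemma I_bounds: "0 \<le> I y" "I y \<le> (\<integral>t. g t \<partial>lborel)"
proof -
  show "0 \<le> I y" unfolding I_def set_lebesgue_integral_def
    using g_nonneg by (intro Bochner_Integration.integral_nonneg) auto
  show "I y \<le> (\<integral>t. g t \<partial>lborel)" unfolding I_def set_lebesgue_integral_def
    using g_nonneg g_integrable set_integrable_g[of y]
    by (intro integral_mono) (auto simp: set_integrable_def indicator_def)
qed

lemma mean_positive: "mean > 0" using mean_pos by (simp add: mean_def)

text \<open>
  If \<open>f\<close> were unbounded, rescaling it around near-maximizers of \<open>exp (- \<epsilon> * t) * f t\<close> would produce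
  in the limit \<open>\<epsilon> \<rightarrow> 0\<close> a stationary function with maximum 1 and mean value 0.
\<close>

lemma f_bounded: obtains B where "B \<ge> 0" "\<And>t. f t \<le> B"
proof -
  have "\<exists>B. \<forall>t. f t \<le> B"
  proof (rule ccontr)
    assume "\<not> ?thesis"
    then have unb: "\<exists>t. f t > B" for B by (auto simp: not_le)
    obtain Ca where Ca: "\<And>t. f t \<le> Ca * exp (a * t)" using growth[of a] a_pos by auto
    \<comment> \<open>The cap a / 2 keeps the rescaled functions below a common dominator of the
      form B (1 + exp (a t / 2)).\<close>
    define \<epsilon> where "\<epsilon> n = min (a / 2) (1 / (real n + 1))" for n
    have \<epsilon>: "0 < \<epsilon> n" "\<epsilon> n \<le> a / 2" for n using a_pos by (auto simp: \<epsilon>_def)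
    have \<epsilon>_lim: "\<epsilon> \<longlonglongrightarrow> 0"
    proof (rule tendsto_sandwich[OF _ _ tendsto_const])
      show "(\<lambda>n. 1 / (real n + 1)) \<longlonglongrightarrow> 0" by real_asymp
    qed (use a_pos in \<open>auto simp: \<epsilon>_def\<close>)
    define S where "S n = range (\<lambda>t. exp (- \<epsilon> n * t) * f t)" for n
    define Mx where "Mx n = Sup (S n)" for n
    have S_bdd: "bdd_above (S n)" for n
    proof -
      have "\<epsilon> n \<le> a" using \<epsilon>(2)[of n] a_pos by linarith
      then obtain C where C: "\<And>t. f t \<le> C * exp (\<epsilon> n * t)" using growth[OF \<epsilon>(1)] by blast
      have "exp (- \<epsilon> n * t) * f t \<le> C" for t
      proof -
        have "exp (- \<epsilon> n * t) * f t \<le> exp (- \<epsilon> n * t) * (C * exp (\<epsilon> n * t))"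
          by (rule mult_left_mono[OF C]) simp
        then show ?thesis by (simp add: exp_minus field_simps)
      qed
      then show ?thesis by (auto simp: S_def intro!: bdd_aboveI)
    qed
    have le_Mx: "exp (- \<epsilon> n * t) * f t \<le> Mx n" for n t
      unfolding Mx_def by (rule cSup_upper[OF _ S_bdd]) (auto simp: S_def)
    have Mx_pos: "Mx n > 0" for n
    proof -
      obtain t where "f t > 0" using unb by blast
      then have "0 < exp (- \<epsilon> n * t) * f t" by simp
      then show ?thesis using le_Mx[of n t] by linarith
    qed
    \<comment> \<open>The supremum need not be attained. The fraction \<open>q n\<close> tends to 1,
      so the limit function is still bounded by 1, its value at 0.\<close>
    define q where "q n = 1 - 1 / (real n + 2)" for n
    have q: "q n \<ge> 1/2" "q n < 1" for n by (auto simp: q_def field_simps)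
    have q_lim: "q \<longlonglongrightarrow> 1" unfolding q_def by real_asymp
    have "\<exists>t. exp (- \<epsilon> n * t) * f t > q n * Mx n" for n
    proof -
      have "q n * Mx n < Sup (S n)" using q(2)[of n] Mx_pos[of n] by (simp add: Mx_def)
      then obtain y where "y \<in> S n" "q n * Mx n < y"
        using less_cSup_iff[OF _ S_bdd] by (auto simp: S_def)
      then show ?thesis by (auto simp: S_def)
    qed
    then obtain x where x: "\<And>n. exp (- \<epsilon> n * x n) * f (x n) > q n * Mx n" by metis
    define \<sigma> where "\<sigma> n = f (x n)" for n
    have \<sigma>_pos: "\<sigma> n > 0" for n
    proof -
      have "0 < exp (- \<epsilon> n * x n) * \<sigma> n"
        using x[of n] q(1)[of n] Mx_pos[of n] mult_pos_pos[of "q n" "Mx n"] unfolding \<sigma>_def by linarith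
      then show ?thesis by (simp add: zero_less_mult_iff)
    qed
    have \<phi>_le: "f (x n + t) / \<sigma> n \<le> exp (\<epsilon> n * t) / q n" for n t
    proof -
      have "f (x n + t) = exp (\<epsilon> n * (x n + t)) * (exp (- \<epsilon> n * (x n + t)) * f (x n + t))"
        by (simp add: mult.assoc[symmetric] flip: exp_add)
      also have "\<dots> \<le> exp (\<epsilon> n * (x n + t)) * Mx n" by (rule mult_left_mono[OF le_Mx]) simp
      also have "\<dots> \<le> exp (\<epsilon> n * (x n + t)) * (exp (- \<epsilon> n * x n) * f (x n) / q n)"
        using x[of n] q(1)[of n] by (intro mult_left_mono) (auto simp: field_simps)
      also have "\<dots> = \<sigma> n * (exp (\<epsilon> n * t) / q n)"
        by (simp add: \<sigma>_def distrib_left exp_add exp_minus)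
      finally show ?thesis using \<sigma>_pos[of n] by (simp add: pos_divide_le_eq mult.commute)
    qed
    \<comment> \<open>A large value of \<open>f\<close> at a fixed point makes the weighted supremum
      large once \<epsilon> n is small. The near-maximizer cannot then be negative, since there the
      weight is at most exp (- a x) and the product at most \<open>Ca\<close>; and for
      \<open>x n \<ge> 0\<close> the weight is at most 1, so \<open>f (x n)\<close> itself is
      large.\<close>
    have \<sigma>_lim: "filterlim \<sigma> at_top sequentially"
      unfolding filterlim_at_top
    proof
      fix Z :: real
      obtain t where t: "f t > 4 * \<bar>Z\<bar> + 4 * \<bar>Ca\<bar>" using unb by blast
      have "(\<lambda>n. exp (- \<epsilon> n * t)) \<longlonglongrightarrow> exp (- 0 * t)" using \<epsilon>_lim by (intro tendsto_intros)
      then have "\<forall>\<^sub>F n in sequentially. exp (- \<epsilon> n * t) > 1/2" by (rule order_tendstoD) simp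
      then show "\<forall>\<^sub>F n in sequentially. Z \<le> \<sigma> n"
      proof eventually_elim
        case (elim n)
        have "f t / 2 \<le> exp (- \<epsilon> n * t) * f t" using elim f_nonneg[of t] mult_right_mono[of "1/2" "exp (- \<epsilon> n * t)" "f t"] by simp
        then have M: "Mx n \<ge> f t / 2" using le_Mx[of n t] by linarith
        have "q n * Mx n \<ge> 1/2 * Mx n" using q(1)[of n] Mx_pos[of n] by (intro mult_right_mono) auto
        then have big: "exp (- \<epsilon> n * x n) * f (x n) > \<bar>Z\<bar> + \<bar>Ca\<bar>" using x[of n] M t by linarith
        have "x n \<ge> 0"
        proof (rule ccontr)
          assume "\<not> x n \<ge> 0"
          then have "- \<epsilon> n * x n \<le> - a * x n" using \<epsilon>(2)[of n] a_pos by (simp add: mult_right_mono_neg)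
          then have "exp (- \<epsilon> n * x n) * f (x n) \<le> exp (- a * x n) * f (x n)"
            using f_nonneg by (intro mult_right_mono) auto
          also have "\<dots> \<le> exp (- a * x n) * (Ca * exp (a * x n))" by (rule mult_left_mono[OF Ca]) simp
          also have "\<dots> = Ca" by (simp add: exp_minus field_simps)
          finally show False using big by linarith
        qed
        then have "exp (- \<epsilon> n * x n) \<le> 1" using \<epsilon>(1)[of n] by simp
        then have "exp (- \<epsilon> n * x n) * f (x n) \<le> 1 * f (x n)" using f_nonneg by (intro mult_right_mono) auto
        then show ?case using big by (simp add: \<sigma>_def)
      qed
    qed
    have I_lim: "(\<lambda>n. I (x n + t) / \<sigma> n) \<longlonglongrightarrow> 0" for t
    proof (rule Lim_null_comparison)
      show "(\<lambda>n. (\<integral>t. g t \<partial>lborel) / \<sigma> n) \<longlonglongrightarrow> 0"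
        using \<sigma>_lim by (intro tendsto_divide_0[OF tendsto_const]) (auto intro: filterlim_at_top_imp_at_infinity)
      show "\<forall>\<^sub>F n in sequentially. norm (I (x n + t) / \<sigma> n) \<le> (\<integral>t. g t \<partial>lborel) / \<sigma> n"
        using \<sigma>_pos I_bounds by (auto intro!: always_eventually simp: divide_right_mono less_imp_le)
    qed
    have exp_le: "exp (\<epsilon> n * t) \<le> 1 + exp (a / 2 * t)" for n t
    proof (cases "t \<ge> 0")
      case True
      then have "exp (\<epsilon> n * t) \<le> exp (a / 2 * t)" using \<epsilon>(2)[of n] by (simp only: exp_le_cancel_iff mult_right_mono)
      then show ?thesis by linarith
    next
      case False
      then have "exp (\<epsilon> n * t) \<le> 1" using \<epsilon>(1)[of n] by (simp add: mult_le_0_iff)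
      then show ?thesis by (simp add: add_increasing2)
    qed
    have B: "f (x n + t) / \<sigma> n \<le> 2 * (1 + exp (a / 2 * t))" for n t
    proof -
      have "exp (\<epsilon> n * t) / q n \<le> exp (\<epsilon> n * t) / (1/2)" using q(1)[of n] by (intro divide_left_mono) auto
      then show ?thesis using \<phi>_le[of n t] exp_le[of n t] by simp
    qed
    obtain r \<phi> where r: "strict_mono r" and lim: "\<And>t. (\<lambda>n. f (x (r n) + t) / \<sigma> (r n)) \<longlonglongrightarrow> \<phi> t"
      and stat: "stationary 0 \<phi>"
      by (rule blowup_limit[of \<sigma> 2 x 0, OF \<sigma>_pos _ B g_ratio_tendsto_0[OF \<sigma>_lim] I_lim]) auto
    note reg = stationaryD(1)[OF stat]
    have le1: "\<phi> t \<le> 1" for t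
    proof -
      have "(\<lambda>n. exp (\<epsilon> n * t) / q n) \<longlonglongrightarrow> exp (0 * t) / 1"
        using \<epsilon>_lim q_lim by (intro tendsto_intros) auto
      from LIMSEQ_subseq_LIMSEQ[OF this r]
      have "(\<lambda>n. exp (\<epsilon> (r n) * t) / q (r n)) \<longlonglongrightarrow> 1" by (simp add: o_def)
      from LIMSEQ_le[OF lim this] show ?thesis using \<phi>_le by blast
    qed
    have "(\<lambda>n. f (x (r n) + 0) / \<sigma> (r n)) = (\<lambda>n. 1)" using \<sigma>_pos by (auto simp: \<sigma>_def fun_eq_iff less_le)
    then have eq1: "\<phi> 0 = 1" using lim[of 0] LIMSEQ_unique tendsto_const by metis
    have "\<bar>\<phi> t\<bar> \<le> 1" for t using reg le1 by (simp add: regular_def)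
    \<comment> \<open>The mean value of the limit is 0 because the bounded function \<open>I\<close>
      was divided by \<sigma>, which tends to infinity.\<close>
    then have "1 * mean = 0"
      by (rule harmonic_mean_value[OF regular_uniformly_continuous[OF reg le1] _ stationaryD(2)[OF stat] le1 eq1 stationaryD(3)[OF stat]])
    then show False using mean_positive by simp
  qed
  then obtain B where "\<And>t. f t \<le> B" by blast
  then show ?thesis using that[of B] f_nonneg[of 0] order_trans by blast
qed

lemma I_tendsto: "(I \<longlongrightarrow> (\<integral>t. g t \<partial>lborel)) at_top"
  unfolding I_def set_lebesgue_integral_def
  by (rule tendsto_integral_at_top[OF sets_lborel g_integrable])

theorem renewal_limit: "(f \<longlongrightarrow> (\<integral>t. g t \<partial>lborel) / mean) at_top"
proof -
  define J where "J = (\<integral>t. g t \<partial>lborel)"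
  obtain B where B: "B \<ge> 0" "\<And>t. f t \<le> B" using f_bounded by blast
  have extreme: "\<exists>r \<phi>. strict_mono r \<and> (\<forall>t. (\<lambda>n. f (x (r n) + t)) \<longlonglongrightarrow> \<phi> t) \<and>
      uniformly_continuous_on UNIV \<phi> \<and> (\<forall>t. \<bar>\<phi> t\<bar> \<le> B) \<and> stationary J \<phi>"
    if x: "filterlim x at_top sequentially" for x :: "nat \<Rightarrow> real"
  proof -
    have x_t: "filterlim (\<lambda>n. x n + t) at_top sequentially" for t
      using filterlim_tendsto_add_at_top[OF tendsto_const[of t] x] by (simp add: add.commute)
    have bd: "f (x n + t) / 1 \<le> B * (1 + exp (a / 2 * t))" for n t
    proof -
      have "B * 1 \<le> B * (1 + exp (a / 2 * t))" using B(1) by (intro mult_left_mono) auto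
      then show ?thesis using B(2)[of "x n + t"] by simp
    qed
    obtain r \<phi> where r: "strict_mono r" and lim: "\<And>t. (\<lambda>n. f (x (r n) + t) / 1) \<longlonglongrightarrow> \<phi> t"
      and stat: "stationary J \<phi>"
    proof (rule blowup_limit[of "\<lambda>_. 1" B x J, OF _ B(1) bd])
      show "(\<lambda>n. g (x n + t) / 1) \<longlonglongrightarrow> 0" for t using filterlim_compose[OF g_lim x_t] by simp
      show "(\<lambda>n. I (x n + t) / 1) \<longlonglongrightarrow> J" for t using filterlim_compose[OF I_tendsto x_t] by (simp add: J_def)
    qed auto
    note reg = stationaryD(1)[OF stat]
    have leB: "\<phi> t \<le> B" for t by (rule LIMSEQ_le_const2[OF lim]) (use B in auto)
    show ?thesis
      using r lim stat leB regular_uniformly_continuous[OF reg leB] reg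
      by (intro exI[of _ r] exI[of _ \<phi>]) (auto simp: regular_def)
  qed
  \<comment> \<open>The case c = 1 treats the upper limit and c = -1 the lower one. Along a sequence
    realizing it, the limit \<open>c * \<phi>\<close> attains its maximum \<open>L\<close> at 0, and
    the mean value identity forces L = c J / mean.\<close>
  have ev: "\<forall>\<^sub>F t in at_top. c * f t \<le> c * J / mean + e" if c: "c = 1 \<or> c = -1" and "e > 0" for c e
  proof -
    have "\<bar>c * f t\<bar> \<le> B" for t using B f_nonneg c by auto
    then obtain L x where x: "filterlim x at_top sequentially" and L: "(\<lambda>n. c * f (x n)) \<longlonglongrightarrow> L"
      and ev: "\<And>e. e > 0 \<Longrightarrow> \<forall>\<^sub>F t in at_top. c * f t \<le> L + e"
      using exists_limsup_sequence[of "\<lambda>t. c * f t" B] by blast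
    obtain r \<phi> where r: "strict_mono r" and lim: "\<And>t. (\<lambda>n. f (x (r n) + t)) \<longlonglongrightarrow> \<phi> t"
      and uc: "uniformly_continuous_on UNIV \<phi>" and bd: "\<And>t. \<bar>\<phi> t\<bar> \<le> B" and stat: "stationary J \<phi>"
      using extreme[OF x] by blast
    have xr: "filterlim (\<lambda>n. x (r n) + t) at_top sequentially" for t
      using filterlim_tendsto_add_at_top[OF tendsto_const[of t] filterlim_compose[OF x filterlim_subseq[OF r]]]
      by (simp add: add.commute)
    have le: "c * \<phi> t \<le> L" for t
    proof (rule field_le_epsilon)
      fix e :: real assume "e > 0"
      from eventually_compose_filterlim[OF ev[OF this] xr[of t]]
      show "c * \<phi> t \<le> L + e" by (intro tendsto_upperbound[OF tendsto_mult_left[OF lim]]) auto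
    qed
    have eq: "c * \<phi> 0 = L"
      using LIMSEQ_unique[OF tendsto_mult_left[OF lim[of 0], of c]] LIMSEQ_subseq_LIMSEQ[OF L r] by (simp add: o_def)
    have harm: "c * \<phi> t = (\<integral>u. c * \<phi> (t - u) \<partial>\<eta>)" for t by (subst stationaryD(2)[OF stat]) simp
    have mv: "(\<integral>z. fst z * (c * \<phi> (t - fst z * snd z)) \<partial>Q) = c * J" for t
      using stationaryD(3)[OF stat, of t] by (simp add: mult.left_commute)
    have "uniformly_continuous_on UNIV (\<lambda>t. c * \<phi> t)"
      using uniformly_continuous_on_cmul[OF uc, of c] by simp
    from harmonic_mean_value[OF this _ harm le eq mv, of B] have "L * mean = c * J" using bd c by auto
    then have "L = c * J / mean" using mean_positive by (simp add: field_simps)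
    then show ?thesis using ev[OF \<open>e > 0\<close>] by simp
  qed
  show ?thesis
    unfolding J_def[symmetric]
  proof (rule tendstoI)
    fix e :: real assume "e > 0"
    then have "\<forall>\<^sub>F t in at_top. f t \<le> J / mean + e / 2" "\<forall>\<^sub>F t in at_top. - f t \<le> - J / mean + e / 2"
      using ev[of 1 "e / 2"] ev[of "-1" "e / 2"] by auto
    then show "\<forall>\<^sub>F t in at_top. dist (f t) (J / mean) < e"
      by eventually_elim (use \<open>e > 0\<close> in \<open>auto simp: dist_real_def abs_if\<close>)
  qed
qed

end

section \<open>Powers of nonnegative series\<close>

lemma powr_above_tangent:
  fixes m y q :: real
  assumes "q \<ge> 1" "m > 0" "y \<ge> 0"
  shows "m powr q + q * m powr (q - 1) * (y - m) \<le> y powr q"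
\<comment> \<open>The tangent criterion for convex functions is applied on the open half-line, so
  the boundary point is checked by hand.\<close>
proof (cases "y = 0")
  case True
  have "m powr (q - 1) * m = m powr q" using assms powr_mult_base[of m "q - 1"] by (simp add: mult.commute)
  then have "m powr q + q * m powr (q - 1) * (y - m) = (1 - q) * m powr q"
    using True by (simp add: algebra_simps)
  also have "\<dots> \<le> 0" using assms by (intro mult_nonpos_nonneg) auto
  finally show ?thesis using True by simp
next
  case False
  have "q * m powr (q - 1) * (y - m) \<le> y powr q - m powr q"
    using assms False
    by (intro convex_on_imp_above_tangent[OF powr_convex[of q] connected_Ioi])
      (auto intro!: has_real_derivative_powr[THEN DERIV_subset] simp: interior_open)
  then show ?thesis by simp
qed

lemma powr_add_one: "x \<ge> 0 \<Longrightarrow> x powr (b + 1) = x * x powr b" for x b :: real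
  by (cases "x = 0") (auto simp: powr_add)

lemma powr_diff_le:
  fixes S y b :: real
  assumes "b \<ge> 0" "0 \<le> y" "y \<le> S"
  shows "S powr (b + 1) - y powr (b + 1) \<le> (b + 1) * (S powr b * (S - y))"
proof (cases "S = 0")
  case False
  then show ?thesis using powr_above_tangent[of "b + 1" S y] assms by (simp add: algebra_simps)
qed (use assms in auto)

text \<open>Jensen's inequality for countable sums follows from the tangent at the weighted mean.\<close>

lemma powr_suminf_le:
  fixes c r :: "nat \<Rightarrow> real"
  assumes q: "q \<ge> 1" and c: "\<And>i. c i \<ge> 0" "summable c" and r: "\<And>i. r i \<ge> 0"
    and cr: "summable (\<lambda>i. c i * r i)"
  shows "ennreal ((\<Sum>i. c i * r i) powr q) \<le> ennreal (suminf c powr (q - 1)) * (\<Sum>i. ennreal (c i * r i powr q))"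
proof (cases "(\<Sum>i. c i * r i) = 0 \<or> (\<Sum>i. ennreal (c i * r i powr q)) = \<top>")
  case True
  then show ?thesis
  proof
    assume top: "(\<Sum>i. ennreal (c i * r i powr q)) = \<top>"
    show ?thesis
    proof (cases "suminf c = 0")
      case True
      then have "c i = 0" for i using c suminf_eq_zero_iff[of c] by auto
      then show ?thesis by simp
    qed (use top c in \<open>simp add: ennreal_mult_top suminf_nonneg\<close>)
  qed simp
next
  case False
  define X where "X = (\<Sum>i. c i * r i)"
  define s where "s = suminf c"
  have X: "X > 0" using False suminf_nonneg[OF cr] c r by (auto simp: X_def less_le)
  have s: "s > 0"
  proof -
    have "s \<noteq> 0"
    proof
      assume "s = 0"
      then have "c i = 0" for i using c suminf_eq_zero_iff[of c] by (auto simp: s_def)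
      then show False using X by (simp add: X_def)
    qed
    then show ?thesis using suminf_nonneg[OF c(2)] c(1) by (auto simp: s_def less_le)
  qed
  define m where "m = X / s"
  have m: "m > 0" using X s by (simp add: m_def)
  have sq: "summable (\<lambda>i. c i * r i powr q)"
    by (rule summable_suminf_not_top) (use False c r in auto)
  have "c i * (m powr q + q * m powr (q - 1) * (r i - m)) \<le> c i * r i powr q" for i
    using powr_above_tangent[OF q m r] c by (intro mult_left_mono) auto
  moreover have lhs: "(\<lambda>i. c i * (m powr q + q * m powr (q - 1) * (r i - m))) sums
      (s * (m powr q - q * m powr (q - 1) * m) + q * m powr (q - 1) * X)"
  proof -
    have "(\<lambda>i. c i * (m powr q - q * m powr (q - 1) * m) + q * m powr (q - 1) * (c i * r i)) sums
      (s * (m powr q - q * m powr (q - 1) * m) + q * m powr (q - 1) * X)"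
      unfolding s_def X_def by (intro sums_add sums_mult sums_mult2 summable_sums c cr)
    then show ?thesis by (simp add: algebra_simps)
  qed
  ultimately have "s * (m powr q - q * m powr (q - 1) * m) + q * m powr (q - 1) * X \<le> (\<Sum>i. c i * r i powr q)"
    using sums_le[OF _ lhs summable_sums[OF sq]] by blast
  moreover have "s * m = X" using s by (simp add: m_def)
  ultimately have le: "s * m powr q \<le> (\<Sum>i. c i * r i powr q)"
  proof -
    have "s * (P - Z * m) + Z * X = s * P + Z * (X - s * m)" for P Z by (simp add: algebra_simps)
    then show ?thesis using \<open>s * m = X\<close> \<open>_ \<le> (\<Sum>i. c i * r i powr q)\<close> by simp
  qed
  have "X powr q = s powr (q - 1) * (s * m powr q)"
  proof -
    have "X powr q = (s * m) powr q" using \<open>s * m = X\<close> by simp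
    also have "\<dots> = s powr q * m powr q" by (rule powr_mult)
    also have "s powr q = s powr (q - 1) * s" using powr_add_one[of s "q - 1"] s by (simp add: mult.commute)
    finally show ?thesis by simp
  qed
  also have "\<dots> \<le> s powr (q - 1) * (\<Sum>i. c i * r i powr q)" by (intro mult_left_mono le) auto
  finally have "ennreal (X powr q) \<le> ennreal (s powr (q - 1) * (\<Sum>i. c i * r i powr q))" by (rule ennreal_leI)
  also have "\<dots> = ennreal (s powr (q - 1)) * (\<Sum>i. ennreal (c i * r i powr q))"
    using sq c r by (subst suminf_ennreal2) (auto simp: ennreal_mult suminf_nonneg)
  finally show ?thesis by (simp add: X_def s_def)
qed

section \<open>Powers of a series compared with its cross terms\<close>

definition cross :: "real \<Rightarrow> (nat \<Rightarrow> real) \<Rightarrow> real" where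
  "cross b x = (\<Sum>j. x j * (suminf x - x j) powr b)"

locale nonneg_summable =
  fixes x :: "nat \<Rightarrow> real" and b :: real
  assumes nonneg: "\<And>i. 0 \<le> x i" and summable: "summable x" and b_pos: "b > 0"
begin

abbreviation S where "S \<equiv> suminf x"

lemma S_nonneg: "0 \<le> S" using suminf_nonneg[OF summable nonneg] .

lemma le_S: "x j \<le> S"
  using sum_le_suminf[OF summable, of "{j}"] nonneg by auto

lemma term_le: "x j powr (b + 1) \<le> x j * S powr b"
  unfolding powr_add_one[OF nonneg] using nonneg le_S b_pos by (intro mult_left_mono powr_mono2) auto

lemma summable_powr: "summable (\<lambda>j. x j powr (b + 1))"
  by (rule summable_comparison_test'[of "\<lambda>j. x j * S powr b" 0])
    (use term_le in \<open>auto intro: summable_mult2 summable\<close>)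

lemma suminf_S_powr: "(\<lambda>j. x j * S powr b) sums (S powr (b + 1))"
  unfolding powr_add_one[OF S_nonneg] by (intro sums_mult2 summable_sums summable)

lemma powr_superadditive: "(\<Sum>j. x j powr (b + 1)) \<le> S powr (b + 1)"
  by (rule sums_le[OF _ summable_sums[OF summable_powr] suminf_S_powr]) (rule term_le)

lemma summable_cross: "summable (\<lambda>j. x j * (S - x j) powr b)"
proof (rule summable_comparison_test'[of "\<lambda>j. x j * S powr b" 0])
  show "norm (x j * (S - x j) powr b) \<le> x j * S powr b" for j
    using nonneg[of j] le_S[of j] b_pos by (auto simp: abs_mult intro!: mult_left_mono powr_mono2)
qed (intro summable_mult2 summable)

lemma cross_nonneg: "0 \<le> cross b x"
  unfolding cross_def by (intro suminf_nonneg summable_cross) (simp add: nonneg)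

lemma sums_delete: "summable f \<Longrightarrow> (\<lambda>i. if i = j then 0 else f i) sums (suminf f - f j)" for f :: "nat \<Rightarrow> real"
  using sums_diff[OF summable_sums sums_single[of j f], of f]
  by (rule back_subst[of "\<lambda>g. g sums _"]) auto

text \<open>
  Either no term exceeds the sum of the others (\<open>y = 0\<close>), or exactly one does (\<open>y = x j\<close>). Every
  other term satisfies \<open>x i \<le> S - x i\<close>.
\<close>

lemma dominant_term:
  obtains y x' where "0 \<le> y" "y \<le> S" "\<And>i. 0 \<le> x' i" "\<And>i. x' i \<le> x i"
    "\<And>h::real\<Rightarrow>real. h 0 = 0 \<Longrightarrow> summable (\<lambda>i. h (x i)) \<Longrightarrow> (\<lambda>i. h (x' i)) sums ((\<Sum>i. h (x i)) - h y)"
    "\<And>i. x' i \<noteq> 0 \<Longrightarrow> x' i = x i \<and> x i \<le> S - x i"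
proof (cases "\<exists>j. x j > S - x j")
  case True
  then obtain j where j: "x j > S - x j" by blast
  have other: "x i \<le> S - x i" if "i \<noteq> j" for i
  proof -
    have "x i + x j \<le> S" using sum_le_suminf[OF summable, of "{i, j}"] nonneg that by auto
    then show ?thesis using j by linarith
  qed
  show ?thesis
  proof (rule that[of "x j" "\<lambda>i. if i = j then 0 else x i"])
    fix h :: "real \<Rightarrow> real" assume h: "h 0 = 0" "summable (\<lambda>i. h (x i))"
    have "(\<lambda>i. if i = j then 0 else h (x i)) sums ((\<Sum>i. h (x i)) - h (x j))" by (rule sums_delete[OF h(2)])
    then show "(\<lambda>i. h (if i = j then 0 else x i)) sums ((\<Sum>i. h (x i)) - h (x j))"
      by (rule back_subst[of "\<lambda>g. g sums _"]) (auto simp: h)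
  qed (use nonneg le_S other in \<open>auto split: if_splits\<close>)
next
  case False
  show ?thesis
    by (rule that[of 0 x]) (use nonneg S_nonneg False in \<open>auto simp: not_less intro: summable_sums\<close>)
qed

text \<open>\<open>x'\<close> is the sequence without its dominant term \<open>y\<close>, if there
  is one. For the remaining terms S \<le> 2 (S - x i), which costs the factor
  \<open>2 powr b\<close> when \<open>S powr b\<close> is replaced by
  \<open>(S - x i) powr b\<close>; the factor b + 1 comes from the tangent bound. The clause for
  every \<open>h\<close> with h 0 = 0 lets one splitting serve the sum itself, its powers and its
  indicators.\<close>

lemma dominant_bounds:
  obtains y x' where "0 \<le> y" "y \<le> S" "\<And>i. 0 \<le> x' i" "\<And>i. x' i \<le> x i"
    "\<And>h::real\<Rightarrow>real. h 0 = 0 \<Longrightarrow> summable (\<lambda>i. h (x i)) \<Longrightarrow> (\<lambda>i. h (x' i)) sums ((\<Sum>i. h (x i)) - h y)"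
    "S powr (b + 1) - y powr (b + 1) \<le> (b + 1) * 2 powr b * cross b x"
    "(\<Sum>i. x' i powr (b + 1)) \<le> cross b x"
proof -
  obtain y x' where y: "0 \<le> y" "y \<le> S" and x': "\<And>i. 0 \<le> x' i" "\<And>i. x' i \<le> x i"
    and h: "\<And>h::real\<Rightarrow>real. h 0 = 0 \<Longrightarrow> summable (\<lambda>i. h (x i)) \<Longrightarrow> (\<lambda>i. h (x' i)) sums ((\<Sum>i. h (x i)) - h y)"
    and dom: "\<And>i. x' i \<noteq> 0 \<Longrightarrow> x' i = x i \<and> x i \<le> S - x i"
    by (rule dominant_term) blast
  have sx': "x' sums (S - y)" using h[of "\<lambda>t. t"] summable by simp
  have t1: "x' i * S powr b \<le> 2 powr b * (x i * (S - x i) powr b)" for i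
  proof (cases "x' i = 0")
    case False
    then have d: "x' i = x i" "x i \<le> S - x i" using dom[OF False] by simp_all
    have "S powr b \<le> (2 * (S - x i)) powr b" using d S_nonneg b_pos by (intro powr_mono2) auto
    also have "\<dots> = 2 powr b * (S - x i) powr b" by (rule powr_mult)
    finally have "x i * S powr b \<le> x i * (2 powr b * (S - x i) powr b)" using nonneg by (intro mult_left_mono) auto
    then show ?thesis using d by (simp add: mult.left_commute)
  qed (use nonneg in auto)
  have "(S - y) * S powr b \<le> 2 powr b * cross b x"
    unfolding cross_def
    by (rule sums_le[OF t1 sums_mult2[OF sx'] sums_mult[OF summable_sums[OF summable_cross]]])
  then have "(b + 1) * (S powr b * (S - y)) \<le> (b + 1) * (2 powr b * cross b x)"
    using b_pos by (intro mult_left_mono) (auto simp: mult.commute)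
  from order_trans[OF powr_diff_le[OF less_imp_le[OF b_pos] y] this]
  have 1: "S powr (b + 1) - y powr (b + 1) \<le> (b + 1) * 2 powr b * cross b x"
    by (simp only: mult.assoc)
  have "x' i powr (b + 1) \<le> x i * (S - x i) powr b" for i
  proof (cases "x' i = 0")
    case False
    then have d: "x' i = x i" "x i \<le> S - x i" using dom[OF False] by simp_all
    then show ?thesis
      unfolding d(1) powr_add_one[OF nonneg] using nonneg b_pos by (intro mult_left_mono powr_mono2) auto
  qed (use nonneg in auto)
  then have 2: "(\<Sum>i. x' i powr (b + 1)) \<le> cross b x"
    unfolding cross_def
    by (intro suminf_le summable_cross sums_summable[OF h[of "\<lambda>t. t powr (b + 1)"]] summable_powr) auto
  show ?thesis by (rule that[OF y x' h 1 2])
qed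

text \<open>The power of the dominant term is part of the sum of powers, so it may be replaced by
  that whole sum.\<close>

lemma powr_suminf_le_cross:
  "S powr (b + 1) \<le> (\<Sum>j. x j powr (b + 1)) + (b + 1) * 2 powr b * cross b x"
proof -
  obtain y x' where "\<And>i. 0 \<le> x' i"
    and h: "\<And>h::real\<Rightarrow>real. h 0 = 0 \<Longrightarrow> summable (\<lambda>i. h (x i)) \<Longrightarrow> (\<lambda>i. h (x' i)) sums ((\<Sum>i. h (x i)) - h y)"
    and 1: "S powr (b + 1) - y powr (b + 1) \<le> (b + 1) * 2 powr b * cross b x"
    by (rule dominant_bounds) blast
  have "(\<lambda>i. x' i powr (b + 1)) sums ((\<Sum>i. x i powr (b + 1)) - y powr (b + 1))"
    using h[of "\<lambda>t. t powr (b + 1)"] summable_powr by simp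
  then have "0 \<le> (\<Sum>i. x i powr (b + 1)) - y powr (b + 1)"
    using sums_le[OF _ sums_zero] by (metis powr_ge_zero)
  then show ?thesis using 1 by linarith
qed

lemma summable_exceed:
  assumes "v > 0"
  shows "summable (\<lambda>i. indicator {v<..} (x i) :: real)"
proof (rule summable_comparison_test'[of "\<lambda>i. x i / v" 0])
  show "norm (indicator {v<..} (x i) :: real) \<le> x i / v" for i
    using assms nonneg[of i] by (auto simp: indicator_def field_simps)
qed (intro summable_divide summable)

end

lemma nn_integral_powr_exceed:
  assumes "b > 0" "z \<ge> 0"
  shows "(\<integral>\<^sup>+v\<in>{0<..}. ennreal ((b + 1) * v powr b * indicator {v<..} z) \<partial>lborel) = ennreal (z powr (b + 1))"
proof -
  \<comment> \<open>Written with the absolute value, the antiderivative is also defined to the left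
    of 0 and has derivative 0 there at the endpoint, so the fundamental theorem covers the closed
    interval.\<close>
  let ?F = "\<lambda>v::real. v * \<bar>v\<bar> powr b"
  have "(\<integral>\<^sup>+v. ennreal ((b + 1) * v powr b) * indicator {0..z} v \<partial>lborel) = ennreal (?F z - ?F 0)"
  proof (rule nn_integral_FTC_Icc)
    show "(?F has_real_derivative (b + 1) * v powr b) (at v)" if "v \<in> {0..z}" for v
    proof (cases "v = 0")
      case False
      then have "v > 0" using that by auto
      have "((\<lambda>v. v powr (b + 1)) has_real_derivative (b + 1) * v powr b) (at v)"
        using has_real_derivative_powr[OF \<open>v > 0\<close>, of "b + 1"] by simp
      moreover have "\<forall>\<^sub>F u in nhds v. ?F u = u powr (b + 1)"
        using eventually_nhds_in_open[of "{0<..}" v] \<open>v > 0\<close>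
        by (auto elim!: eventually_mono simp: powr_add_one)
      ultimately show ?thesis by (subst DERIV_cong_ev[OF refl _ refl]) auto
    next
      case True
      have "((\<lambda>y. \<bar>y\<bar> powr b) \<longlongrightarrow> \<bar>0\<bar> powr b) (at 0)"
        using assms by (intro tendsto_powr' tendsto_intros) auto
      then have "((\<lambda>y. \<bar>y\<bar> powr b) \<longlongrightarrow> 0) (at (0::real))" using assms by simp
      then have "(?F has_real_derivative 0) (at 0)"
        unfolding has_field_derivative_iff
        by (rule Lim_transform_eventually) (auto simp: eventually_at_filter)
      then show ?thesis using True assms by simp
    qed
  qed (use assms in auto)
  then have "(\<integral>\<^sup>+v. ennreal ((b + 1) * v powr b) * indicator {0..z} v \<partial>lborel) = ennreal (z powr (b + 1))"
    using assms by (simp add: powr_add_one)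
  moreover have "(\<integral>\<^sup>+v\<in>{0<..}. ennreal ((b + 1) * v powr b * indicator {v<..} z) \<partial>lborel) =
      (\<integral>\<^sup>+v. ennreal ((b + 1) * v powr b) * indicator {0..z} v \<partial>lborel)"
    using AE_lborel_singleton[of z] AE_lborel_singleton[of 0]
    by (intro nn_integral_cong_AE, eventually_elim) (auto simp: indicator_def)
  ultimately show ?thesis by simp
qed

context nonneg_summable
begin

text \<open>With the dominant term \<open>y\<close> split off, the absolute difference is at most
  1(S > v) - 1(y > v) plus the number of remaining terms above \<open>v\<close>. Integration against
  (b + 1) v^b turns these indicators into powers, which \<open>dominant_bounds\<close>
  controls.\<close>

lemma nn_integral_exceed_difference:
  "(\<integral>\<^sup>+v\<in>{0<..}. ennreal ((b + 1) * v powr b * \<bar>indicator {v<..} S - (\<Sum>i. indicator {v<..} (x i))\<bar>) \<partial>lborel)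
    \<le> ennreal (((b + 1) * 2 powr b + 1) * cross b x)"
proof -
  obtain y x' where y: "0 \<le> y" "y \<le> S" and x': "\<And>i. 0 \<le> x' i" "\<And>i. x' i \<le> x i"
    and h: "\<And>h::real\<Rightarrow>real. h 0 = 0 \<Longrightarrow> summable (\<lambda>i. h (x i)) \<Longrightarrow> (\<lambda>i. h (x' i)) sums ((\<Sum>i. h (x i)) - h y)"
    and 1: "S powr (b + 1) - y powr (b + 1) \<le> (b + 1) * 2 powr b * cross b x"
    and 2: "(\<Sum>i. x' i powr (b + 1)) \<le> cross b x"
    by (rule dominant_bounds) blast
  let ?k = "\<lambda>v. (b + 1) * v powr b"
  have k0: "?k v \<ge> 0" for v using b_pos by simp
  define E where "E v z = ennreal (?k v * indicator {v<..} z)" for v z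
  define D where "D v = ennreal (?k v * \<bar>indicator {v<..} S - (\<Sum>i. indicator {v<..} (x i))\<bar>)" for v
  have [measurable]: "(\<lambda>v. indicator {v<..} z :: real) \<in> borel_measurable borel" for z :: real
  proof -
    have eq: "(\<lambda>v. indicator {v<..} z :: real) = indicator {..<z}" by (auto simp: indicator_def fun_eq_iff)
    show ?thesis unfolding eq by (rule borel_measurable_indicator) simp
  qed
  have [measurable]: "(\<lambda>v. E v z) \<in> borel_measurable borel" for z unfolding E_def by measurable
  have [measurable]: "D \<in> borel_measurable borel" unfolding D_def by measurable
  have E_int: "(\<integral>\<^sup>+v\<in>{0<..}. E v z \<partial>lborel) = ennreal (z powr (b + 1))" if "z \<ge> 0" for z
    unfolding E_def by (rule nn_integral_powr_exceed[OF b_pos that])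
  \<comment> \<open>The contribution of \<open>y\<close> stands on the left so that no subtraction
    of extended reals occurs; its integral is finite and cancels at the end.\<close>
  have "D v + E v y \<le> E v S + (\<Sum>i. E v (x' i))"
    if v: "v > 0" for v
  proof -
    have s: "(\<lambda>i. indicator {v<..} (x' i) :: real) sums ((\<Sum>i. indicator {v<..} (x i)) - indicator {v<..} y)"
      by (rule h[of "indicator {v<..}"]) (use v summable_exceed in auto)
    have s0: "0 \<le> (\<Sum>i. indicator {v<..} (x' i) :: real)"
      by (intro suminf_nonneg sums_summable[OF s]) auto
    have "\<bar>indicator {v<..} S - (\<Sum>i. indicator {v<..} (x i) :: real)\<bar> + indicator {v<..} y
        \<le> indicator {v<..} S + (\<Sum>i. indicator {v<..} (x' i))"
      using sums_unique[OF s] s0 y by (auto simp: indicator_def abs_if)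
    then have "?k v * (\<bar>indicator {v<..} S - (\<Sum>i. indicator {v<..} (x i) :: real)\<bar> + indicator {v<..} y)
        \<le> ?k v * (indicator {v<..} S + (\<Sum>i. indicator {v<..} (x' i)))"
      using k0 by (rule mult_left_mono)
    then have "D v + E v y
      \<le> E v S + ennreal (?k v * (\<Sum>i. indicator {v<..} (x' i)))"
      using k0[of v] s0 by (simp add: D_def E_def distrib_left flip: ennreal_plus)
    also have "ennreal (?k v * (\<Sum>i. indicator {v<..} (x' i))) = (\<Sum>i. E v (x' i))"
      unfolding E_def using k0[of v] sums_summable[OF s]
      by (subst suminf_ennreal2) (auto simp: suminf_mult intro: summable_mult)
    finally show ?thesis .
  qed
  then have "(\<integral>\<^sup>+v\<in>{0<..}. (D v + E v y) \<partial>lborel)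
    \<le> (\<integral>\<^sup>+v\<in>{0<..}. (E v S + (\<Sum>i. E v (x' i))) \<partial>lborel)"
    by (intro nn_integral_mono) (auto simp: indicator_def)
  also have "(\<integral>\<^sup>+v\<in>{0<..}. (E v S + (\<Sum>i. E v (x' i))) \<partial>lborel) =
      (\<integral>\<^sup>+v\<in>{0<..}. E v S \<partial>lborel) + (\<Sum>i. \<integral>\<^sup>+v\<in>{0<..}. E v (x' i) \<partial>lborel)"
    unfolding distrib_right ennreal_suminf_multc[symmetric]
    by (simp add: nn_integral_add nn_integral_suminf del: ennreal_suminf_multc)
  also have "\<dots> = ennreal (S powr (b + 1)) + (\<Sum>i. ennreal (x' i powr (b + 1)))"
    using b_pos x' S_nonneg by (simp add: E_int)
  also have "\<dots> = ennreal (S powr (b + 1) + (\<Sum>i. x' i powr (b + 1)))"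
  proof -
    have "summable (\<lambda>i. x' i powr (b + 1))"
      using sums_summable[OF h[of "\<lambda>t. t powr (b + 1)"]] summable_powr by simp
    then show ?thesis by (subst suminf_ennreal2) (auto simp: suminf_nonneg)
  qed
  also have "\<dots> \<le> ennreal (((b + 1) * 2 powr b + 1) * cross b x + y powr (b + 1))"
    using 1 2 by (intro ennreal_leI) (simp add: algebra_simps)
  also have "\<dots> = ennreal (((b + 1) * 2 powr b + 1) * cross b x) + ennreal (y powr (b + 1))"
    using cross_nonneg b_pos by (intro ennreal_plus) auto
  also have "ennreal (y powr (b + 1)) = (\<integral>\<^sup>+v\<in>{0<..}. E v y \<partial>lborel)"
    using b_pos y by (simp add: E_int)
  finally have "(\<integral>\<^sup>+v\<in>{0<..}. D v \<partial>lborel) + (\<integral>\<^sup>+v\<in>{0<..}. E v y \<partial>lborel)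
    \<le> ennreal (((b + 1) * 2 powr b + 1) * cross b x) + (\<integral>\<^sup>+v\<in>{0<..}. E v y \<partial>lborel)"
    unfolding distrib_right by (simp add: nn_integral_add)
  moreover have "(\<integral>\<^sup>+v\<in>{0<..}. E v y \<partial>lborel) \<noteq> \<top>" using b_pos y by (simp add: E_int)
  ultimately show ?thesis unfolding D_def[symmetric] by (simp add: ennreal_add_left_cancel_le add.commute[of _ "\<integral>\<^sup>+v\<in>{0<..}. E v y \<partial>lborel"])
qed

end

section \<open>Weighted sums of independent copies\<close>

definition moment :: "real measure \<Rightarrow> real \<Rightarrow> ennreal" where
  "moment \<rho> q = (\<integral>\<^sup>+x. ennreal (x powr q) \<partial>\<rho>)"

locale nonneg_law = prob_space \<rho> for \<rho> :: "real measure" +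
  assumes sets_\<rho>[measurable_cong]: "sets \<rho> = sets borel"
    and nonneg: "AE x in \<rho>. 0 \<le> x"
    and integrable_id: "integrable \<rho> (\<lambda>x. x)"
begin

abbreviation P :: "(nat \<Rightarrow> real) measure" where "P \<equiv> PiM UNIV (\<lambda>_. \<rho>)"

sublocale P: product_prob_space "\<lambda>_. \<rho>" UNIV ..

lemma prob_space_P: "prob_space P" by (rule prob_space_PiM) (rule prob_space_axioms)

lemma sets_P[measurable_cong]: "sets P = sets (PiM UNIV (\<lambda>_. borel))"
  by (rule sets_PiM_cong) (auto simp: sets_\<rho>)

lemma space_\<rho>[simp]: "space \<rho> = UNIV" using sets_eq_imp_space_eq[OF sets_\<rho>] by simp
lemma space_P[simp]: "space P = UNIV" by (simp add: space_PiM)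

lemma emeasure_P_UNIV[simp]: "emeasure P UNIV = 1"
  using prob_space.emeasure_space_1[OF prob_space_P] by simp

lemma distr_component: "distr P \<rho> (\<lambda>r. r i) = \<rho>"
  by (rule distr_PiM_component) (auto intro: prob_space_axioms)

lemma nn_integral_component:
  assumes [measurable]: "f \<in> borel_measurable borel"
  shows "(\<integral>\<^sup>+r. f (r i) \<partial>P) = (\<integral>\<^sup>+x. f x \<partial>\<rho>)"
proof -
  have "(\<integral>\<^sup>+x. f x \<partial>\<rho>) = (\<integral>\<^sup>+x. f x \<partial>(distr P \<rho> (\<lambda>r. r i)))" by (simp only: distr_component)
  also have "\<dots> = (\<integral>\<^sup>+r. f (r i) \<partial>P)" by (rule nn_integral_distr) measurable
  finally show ?thesis ..
qed

lemma AE_nonneg: "AE r in P. \<forall>i. 0 \<le> r i"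
  unfolding AE_all_countable
  by (auto intro!: AE_PiM_component prob_space_axioms nonneg)

lemma moment_1: "moment \<rho> 1 = ennreal (\<integral>x. x \<partial>\<rho>)"
proof -
  have "moment \<rho> 1 = (\<integral>\<^sup>+x. ennreal x \<partial>\<rho>)"
    unfolding moment_def by (rule nn_integral_cong_AE, use nonneg in eventually_elim) simp
  then show ?thesis using nn_integral_eq_integral[OF integrable_id nonneg] by simp
qed

lemma nn_integral_scaled: "c \<ge> 0 \<Longrightarrow> (\<integral>\<^sup>+x. ennreal (c * x) \<partial>\<rho>) = ennreal c * moment \<rho> 1"
proof -
  assume c: "c \<ge> 0"
  have "(\<integral>\<^sup>+x. ennreal (c * x) \<partial>\<rho>) = (\<integral>\<^sup>+x. ennreal c * ennreal (x powr 1) \<partial>\<rho>)"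
    by (rule nn_integral_cong_AE, use nonneg in eventually_elim) (simp add: c ennreal_mult)
  then show ?thesis by (simp add: moment_def nn_integral_cmult)
qed

lemma AE_summable:
  assumes c: "\<And>i. c i \<ge> 0" "summable c"
  shows "AE r in P. summable (\<lambda>i. c i * r i)"
proof -
  have "(\<integral>\<^sup>+r. (\<Sum>i. ennreal (c i * r i)) \<partial>P) = (\<Sum>i. \<integral>\<^sup>+r. ennreal (c i * r i) \<partial>P)"
    by (rule nn_integral_suminf) measurable
  also have "\<dots> = (\<Sum>i. ennreal (c i) * moment \<rho> 1)"
    using nn_integral_component[of "\<lambda>x. ennreal (c _ * x)"] by (simp add: nn_integral_scaled c)
  also have "\<dots> = ennreal (suminf c) * moment \<rho> 1" using c by (simp add: suminf_ennreal2)
  finally have "(\<integral>\<^sup>+r. (\<Sum>i. ennreal (c i * r i)) \<partial>P) \<noteq> \<infinity>" by (simp add: moment_1 ennreal_mult_eq_top_iff)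
  then have "AE r in P. (\<Sum>i. ennreal (c i * r i)) \<noteq> \<infinity>" by (intro nn_integral_PInf_AE) measurable
  then show ?thesis
    using AE_nonneg
    by eventually_elim (rule summable_suminf_not_top, use c in auto)
qed

text \<open>The product law is the law of the pair formed by coordinate \<open>j\<close> and all the
  others, and \<open>H\<close> sees only the second component. Taking the first function to be
  constant identifies the second factor as the integral of \<open>H\<close> itself.\<close>

lemma nn_integral_independent_coordinate:
  fixes h :: "real \<Rightarrow> ennreal" and H :: "(nat \<Rightarrow> real) \<Rightarrow> ennreal"
  assumes [measurable]: "h \<in> borel_measurable borel" "H \<in> borel_measurable (PiM UNIV (\<lambda>_. borel))"
    and H: "\<And>r y. H (r(j := y)) = H r"
  shows "(\<integral>\<^sup>+r. h (r j) * H r \<partial>P) = (\<integral>\<^sup>+x. h x \<partial>\<rho>) * (\<integral>\<^sup>+r. H r \<partial>P)"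
proof -
  let ?P' = "PiM (UNIV - {j}) (\<lambda>_. \<rho>)"
  interpret P': prob_space ?P' by (rule prob_space_PiM) (rule prob_space_axioms)
  have ins: "insert j (UNIV - {j}) = UNIV" by auto
  have [measurable]: "(\<lambda>(x, X). X(j := x)) \<in> measurable (\<rho> \<Otimes>\<^sub>M ?P') P"
    using measurable_add_dim[of j "UNIV - {j}" "\<lambda>_. \<rho>"]
    by (subst measurable_cong_sets[OF sets_pair_measure_cong refl]) (auto simp: ins case_prod_beta' intro!: measurable_fun_upd[where J = "UNIV - {j}"])
  have eq: "distr (\<rho> \<Otimes>\<^sub>M ?P') P (\<lambda>(x, X). X(j := x)) = P"
    using distr_pair_PiM_eq_PiM[of "UNIV - {j}" "\<lambda>_. \<rho>" j] by (simp add: ins prob_space_axioms)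
  have [measurable]: "H \<in> borel_measurable P" by measurable
  have [measurable]: "(\<lambda>X. X(j := 0)) \<in> measurable ?P' P"
    using measurable_compose[OF measurable_Pair1'[of 0 \<rho> ?P'], of "\<lambda>(x, X). X(j := x)" P] by simp
  have *: "(\<integral>\<^sup>+r. k (r j) * H r \<partial>P) = (\<integral>\<^sup>+x. k x \<partial>\<rho>) * (\<integral>\<^sup>+X. H (X(j := 0)) \<partial>?P')"
    if [measurable]: "k \<in> borel_measurable borel" for k
  proof -
    have "(\<integral>\<^sup>+r. k (r j) * H r \<partial>P) = (\<integral>\<^sup>+r. k (r j) * H r \<partial>distr (\<rho> \<Otimes>\<^sub>M ?P') P (\<lambda>(x, X). X(j := x)))"
      by (simp only: eq)
    also have "\<dots> = (\<integral>\<^sup>+z. k (fst z) * H ((snd z)(j := 0)) \<partial>(\<rho> \<Otimes>\<^sub>M ?P'))"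
      by (subst nn_integral_distr) (auto simp: case_prod_beta' H)
    also have "\<dots> = (\<integral>\<^sup>+x. \<integral>\<^sup>+X. k x * H (X(j := 0)) \<partial>?P' \<partial>\<rho>)"
      by (subst P'.nn_integral_fst[symmetric]) auto
    also have "\<dots> = (\<integral>\<^sup>+x. k x \<partial>\<rho>) * (\<integral>\<^sup>+X. H (X(j := 0)) \<partial>?P')"
      by (simp add: nn_integral_cmult nn_integral_multc)
    finally show ?thesis .
  qed
  show ?thesis using *[of h] *[of "\<lambda>_. 1"] by (simp add: emeasure_space_1[simplified])
qed

text \<open>Jensen's inequality needs an exponent of at least 1. For b < 1 the normalized sum
  \<open>X\<close> is first raised to the exponent max b 1 by X^b \<le> 1 + X^(max b 1).\<close>

lemma moment_weighted_sum_le: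
  assumes c: "\<And>i. c i \<ge> 0" "summable c" and b: "b > 0"
  shows "(\<integral>\<^sup>+r. ennreal ((\<Sum>i. c i * r i) powr b) \<partial>P) \<le> ennreal (suminf c powr b) * (1 + moment \<rho> (max b 1))"
proof (cases "suminf c = 0")
  case True
  then have "c = (\<lambda>_. 0)" using c suminf_eq_zero_iff[of c] by auto
  then show ?thesis by simp
next
  case False
  define s where "s = suminf c"
  have s: "s > 0" using False suminf_nonneg[OF c(2,1)] by (simp add: s_def)
  let ?q = "max b 1"
  have "AE r in P. ennreal ((\<Sum>i. c i * r i) powr b) \<le>
      ennreal (s powr b) * (1 + (\<Sum>i. ennreal (c i / s) * ennreal (r i powr ?q)))"
    using AE_nonneg AE_summable[OF c]
  proof eventually_elim
    case (elim r)
    define X where "X = (\<Sum>i. c i / s * r i)"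
    have sm: "summable (\<lambda>i. c i / s * r i)" using elim(2) summable_divide[of "\<lambda>i. c i * r i" s] by simp
    have X0: "X \<ge> 0" unfolding X_def using c s elim by (intro suminf_nonneg[OF sm]) auto
    have X: "(\<Sum>i. c i * r i) = s * X" unfolding X_def using suminf_mult[OF sm, of s] s by simp
    have "X powr b \<le> 1 + X powr ?q"
    proof (cases "X \<le> 1")
      case True
      then have "X powr b \<le> 1" using X0 b by (intro powr_le1) auto
      then show ?thesis by (simp add: add_increasing2)
    next
      case False
      then have "X powr b \<le> X powr ?q" by (intro powr_mono) auto
      then show ?thesis by simp
    qed
    then have "(s * X) powr b \<le> s powr b * (1 + X powr ?q)"
      by (simp add: powr_mult mult_left_mono)
    then have "ennreal ((s * X) powr b) \<le> ennreal (s powr b * (1 + X powr ?q))" by (rule ennreal_leI)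
    also have "\<dots> = ennreal (s powr b) * (1 + ennreal (X powr ?q))" by (simp add: ennreal_mult)
    finally have le: "ennreal ((s * X) powr b) \<le> ennreal (s powr b) * (1 + ennreal (X powr ?q))" .
    have "suminf (\<lambda>i. c i / s) = 1" using suminf_divide[OF c(2), of s] s by (simp add: s_def)
    moreover have "ennreal (X powr ?q) \<le> ennreal (suminf (\<lambda>i. c i / s) powr (?q - 1)) * (\<Sum>i. ennreal (c i / s * r i powr ?q))"
      unfolding X_def using c s elim sm by (intro powr_suminf_le summable_divide) auto
    ultimately have "ennreal (X powr ?q) \<le> (\<Sum>i. ennreal (c i / s * r i powr ?q))" by simp
    also have "\<dots> = (\<Sum>i. ennreal (c i / s) * ennreal (r i powr ?q))"
      using c s by (intro suminf_cong ennreal_mult) auto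
    finally have "ennreal (s powr b) * (1 + ennreal (X powr ?q)) \<le>
        ennreal (s powr b) * (1 + (\<Sum>i. ennreal (c i / s) * ennreal (r i powr ?q)))"
      by (intro mult_left_mono add_left_mono) auto
    then show ?case unfolding X using le by (rule order_trans[rotated])
  qed
  then have "(\<integral>\<^sup>+r. ennreal ((\<Sum>i. c i * r i) powr b) \<partial>P) \<le>
    (\<integral>\<^sup>+r. ennreal (s powr b) * (1 + (\<Sum>i. ennreal (c i / s) * ennreal (r i powr ?q))) \<partial>P)"
    by (rule nn_integral_mono_AE)
  also have "\<dots> = ennreal (s powr b) * (1 + (\<Sum>i. ennreal (c i / s) * (\<integral>\<^sup>+r. ennreal (r i powr ?q) \<partial>P)))"
    by (simp add: nn_integral_cmult nn_integral_add nn_integral_suminf)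
  also have "(\<Sum>i. ennreal (c i / s) * (\<integral>\<^sup>+r. ennreal (r i powr ?q) \<partial>P)) = (\<Sum>i. ennreal (c i / s)) * moment \<rho> ?q"
    using nn_integral_component[of "\<lambda>x. ennreal (x powr ?q)"] by (simp add: moment_def)
  also have "(\<Sum>i. ennreal (c i / s)) = 1"
    using c s suminf_divide[OF c(2), of s]
    by (subst suminf_ennreal2) (auto simp: s_def intro: summable_divide)
  finally show ?thesis by (simp add: s_def)
qed

text \<open>In the j-th cross term the other summands form \<open>T j\<close>, which does not
  involve \<open>r j\<close>, so the expectation factors. Thus the law enters only through moments
  of order 1 and max b 1, while the weights enter with the exponent b + 1.\<close>

lemma nn_integral_cross_le:
  assumes c: "\<And>i. c i \<ge> 0" "summable c" and b: "b > 0"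
  shows "(\<integral>\<^sup>+r. ennreal (cross b (\<lambda>i. c i * r i)) \<partial>P)
    \<le> ennreal (suminf c powr (b + 1)) * (moment \<rho> 1 * (1 + moment \<rho> (max b 1)))"
proof -
  define T where "T j r = (\<Sum>i. (if i = j then 0 else c i) * r i)" for j and r :: "nat \<Rightarrow> real"
  have [measurable]: "T j \<in> borel_measurable (PiM UNIV (\<lambda>_. borel))" for j
    unfolding T_def by measurable
  have "AE r in P. ennreal (cross b (\<lambda>i. c i * r i)) = (\<Sum>j. ennreal (c j * r j) * ennreal (T j r powr b))"
    using AE_nonneg AE_summable[OF c]
  proof eventually_elim
    case (elim r)
    interpret nonneg_summable "\<lambda>i. c i * r i" b
      by unfold_locales (use elim c b in auto)
    have "T j r = S - c j * r j" for j
    proof -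
      have "(\<lambda>i. if i = j then 0 else c i * r i) sums (S - c j * r j)" by (rule sums_delete[OF elim(2)])
      moreover have "(\<lambda>i. if i = j then 0 else c i * r i) = (\<lambda>i. (if i = j then 0 else c i) * r i)" by auto
      ultimately show ?thesis unfolding T_def by (simp add: sums_iff)
    qed
    then have "ennreal (c j * r j) * ennreal (T j r powr b) = ennreal (c j * r j * (S - c j * r j) powr b)" for j
      using elim c by (simp add: ennreal_mult)
    then show ?case
      unfolding cross_def using summable_cross elim c by (subst suminf_ennreal2[symmetric]) auto
  qed
  then have "(\<integral>\<^sup>+r. ennreal (cross b (\<lambda>i. c i * r i)) \<partial>P) =
      (\<integral>\<^sup>+r. (\<Sum>j. ennreal (c j * r j) * ennreal (T j r powr b)) \<partial>P)"
    by (rule nn_integral_cong_AE)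
  also have "\<dots> = (\<Sum>j. \<integral>\<^sup>+r. ennreal (c j * r j) * ennreal (T j r powr b) \<partial>P)"
    by (rule nn_integral_suminf) measurable
  also have "\<dots> \<le> (\<Sum>j. ennreal (c j) * moment \<rho> 1 * (ennreal (suminf c powr b) * (1 + moment \<rho> (max b 1))))"
  proof (intro suminf_le summableI)
    fix j
    have T_upd: "T j (r(j := y)) = T j r" for r y
      unfolding T_def by (rule suminf_cong) auto
    have "(\<integral>\<^sup>+r. ennreal (c j * r j) * ennreal (T j r powr b) \<partial>P) =
        (\<integral>\<^sup>+x. ennreal (c j * x) \<partial>\<rho>) * (\<integral>\<^sup>+r. ennreal (T j r powr b) \<partial>P)"
      by (rule nn_integral_independent_coordinate) (auto simp: T_upd)
    also have "(\<integral>\<^sup>+x. ennreal (c j * x) \<partial>\<rho>) = ennreal (c j) * moment \<rho> 1" by (rule nn_integral_scaled[OF c(1)])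
    finally have 1: "(\<integral>\<^sup>+r. ennreal (c j * r j) * ennreal (T j r powr b) \<partial>P) =
        ennreal (c j) * moment \<rho> 1 * (\<integral>\<^sup>+r. ennreal (T j r powr b) \<partial>P)" .
    have 2: "(\<integral>\<^sup>+r. ennreal (T j r powr b) \<partial>P) \<le> ennreal ((suminf c) powr b) * (1 + moment \<rho> (max b 1))"
    proof -
      let ?c = "\<lambda>i. if i = j then 0 else c i"
      have sm: "summable ?c" by (rule summable_comparison_test'[OF c(2), of 0]) (use c in auto)
      have "(\<integral>\<^sup>+r. ennreal (T j r powr b) \<partial>P) \<le> ennreal ((suminf ?c) powr b) * (1 + moment \<rho> (max b 1))"
        unfolding T_def by (rule moment_weighted_sum_le[OF _ sm b]) (use c in auto)
      also have "\<dots> \<le> ennreal ((suminf c) powr b) * (1 + moment \<rho> (max b 1))"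
        using b c sm by (intro mult_right_mono ennreal_leI powr_mono2 suminf_le suminf_nonneg) auto
      finally show ?thesis .
    qed
    show "(\<integral>\<^sup>+r. ennreal (c j * r j) * ennreal (T j r powr b) \<partial>P)
      \<le> ennreal (c j) * moment \<rho> 1 * (ennreal (suminf c powr b) * (1 + moment \<rho> (max b 1)))"
      unfolding 1 by (rule mult_left_mono[OF 2]) simp
  qed
  also have "\<dots> = ennreal (suminf c) * moment \<rho> 1 * (ennreal (suminf c powr b) * (1 + moment \<rho> (max b 1)))"
    using c by (simp add: suminf_ennreal2)
  also have "\<dots> = ennreal (suminf c * suminf c powr b) * (moment \<rho> 1 * (1 + moment \<rho> (max b 1)))"
    using suminf_nonneg[OF c(2,1)] by (simp add: ennreal_mult mult_ac)
  also have "suminf c * suminf c powr b = suminf c powr (b + 1)"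
    using suminf_nonneg[OF c(2,1)] by (simp add: powr_add_one)
  finally show ?thesis .
qed

end

section \<open>The smoothing transform\<close>

text \<open>Both the inequality and its strict case come from ln z \<le> z - 1, an equality only at
  z = 1, applied to the two endpoint values divided by exp (\<theta> x); the weighted logarithms
  cancel.\<close>

lemma exp_le_chord:
  fixes x \<theta> :: real
  assumes "0 < \<theta>" "\<theta> < 1"
  shows "exp (\<theta> * x) \<le> (1 - \<theta>) + \<theta> * exp x" "x \<noteq> 0 \<Longrightarrow> exp (\<theta> * x) < (1 - \<theta>) + \<theta> * exp x"
proof -
  define y where "y = exp (\<theta> * x)"
  have y: "y > 0" by (simp add: y_def)
  have l1: "ln (1 / y) \<le> 1 / y - 1" using y by (intro ln_le_minus_one) auto
  have l2: "ln (exp x / y) \<le> exp x / y - 1" using y by (intro ln_le_minus_one) auto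
  have lns: "ln (1 / y) = - \<theta> * x" "ln (exp x / y) = x - \<theta> * x"
    by (simp_all add: y_def flip: exp_diff exp_minus add: inverse_eq_divide[symmetric])
  have sum0: "(1 - \<theta>) * ln (1 / y) + \<theta> * ln (exp x / y) = 0" unfolding lns by (simp add: algebra_simps)
  have id: "(1 - \<theta>) * (1 / y - 1) + \<theta> * (exp x / y - 1) = ((1 - \<theta>) + \<theta> * exp x) / y - 1"
    unfolding right_diff_distrib add_divide_distrib by simp
  have "(1 - \<theta>) * ln (1 / y) \<le> (1 - \<theta>) * (1 / y - 1)" using l1 assms by (intro mult_left_mono) auto
  moreover have m2: "\<theta> * ln (exp x / y) \<le> \<theta> * (exp x / y - 1)" using l2 assms by (intro mult_left_mono) auto
  ultimately have "0 \<le> ((1 - \<theta>) + \<theta> * exp x) / y - 1" using sum0 id by linarith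
  then show "exp (\<theta> * x) \<le> (1 - \<theta>) + \<theta> * exp x" using y by (simp add: y_def[symmetric] field_simps)
  assume "x \<noteq> 0"
  then have "1 / y \<noteq> 1" using assms by (auto simp: y_def)
  then have "ln (1 / y) \<noteq> 1 / y - 1" using ln_eq_minus_one[of "1 / y"] y by auto
  then have "ln (1 / y) < 1 / y - 1" using l1 by linarith
  then have "(1 - \<theta>) * ln (1 / y) < (1 - \<theta>) * (1 / y - 1)" using assms by (intro mult_strict_left_mono) auto
  then have "0 < ((1 - \<theta>) + \<theta> * exp x) / y - 1" using sum0 id m2 by linarith
  then show "exp (\<theta> * x) < (1 - \<theta>) + \<theta> * exp x" using y by (simp add: y_def[symmetric] field_simps)
qed

lemma exp_gt_add_one: "x \<noteq> 0 \<Longrightarrow> 1 + x < exp x" for x :: real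
proof -
  assume "x \<noteq> 0"
  then have "1 + x \<noteq> exp x" using ln_eq_minus_one[of "exp x"] by auto
  then show ?thesis by (rule order_le_neq_trans[OF exp_ge_add_one_self])
qed

text \<open>\<open>A i\<close> stands for the weight cut off at N: indices beyond N carry the value
  0. Nonnegativity and summability hold everywhere, which is achieved by changing the weights on a
  null set.\<close>

locale weights = prob_space M for M :: "'a measure" +
  fixes A :: "nat \<Rightarrow> 'a \<Rightarrow> real" and \<alpha> :: real
  assumes A_measurable[measurable]: "\<And>i. A i \<in> borel_measurable M"
    and A_nonneg: "\<And>i \<omega>. 0 \<le> A i \<omega>"
    and A_summable: "\<And>\<omega>. summable (\<lambda>i. A i \<omega>)"
    and \<alpha>_gt_1: "\<alpha> > 1"
    and integrable_sum_powr: "integrable M (\<lambda>\<omega>. (\<Sum>i. A i \<omega>) powr \<alpha>)"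
    and sum_1: "(\<integral>\<^sup>+\<omega>. (\<Sum>i. ennreal (A i \<omega>)) \<partial>M) = 1"
    and sum_\<alpha>: "(\<integral>\<^sup>+\<omega>. (\<Sum>i. ennreal (A i \<omega> powr \<alpha>)) \<partial>M) = 1"
    and sum_log: "(\<integral>\<^sup>+\<omega>. (\<Sum>i. ennreal (A i \<omega> powr \<alpha> * max (ln (A i \<omega>)) 0)) \<partial>M) < \<infinity>"
    and nonarith_weight: "\<exists>j. \<forall>d>0. emeasure M {\<omega> \<in> space M. A j \<omega> > 0 \<and> ln (A j \<omega>) \<notin> range (\<lambda>k::int. d * of_int k)} > 0"
begin

definition A_sum :: "'a \<Rightarrow> real" where "A_sum \<omega> = (\<Sum>i. A i \<omega>)"

lemma A_sum_measurable[measurable]: "A_sum \<in> borel_measurable M"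
  unfolding A_sum_def by measurable

lemma A_sum_nonneg: "0 \<le> A_sum \<omega>"
  unfolding A_sum_def by (rule suminf_nonneg[OF A_summable A_nonneg])

definition power_sum :: "real \<Rightarrow> ennreal" where
  "power_sum \<beta> = (\<integral>\<^sup>+\<omega>. (\<Sum>i. ennreal (A i \<omega> powr \<beta>)) \<partial>M)"

text \<open>The law of the logarithm of a weight picked from all pairs of outcome and index with
  density \<open>A i \<omega> powr \<alpha>\<close>. Vanishing weights have density 0, so the value
  given to \<open>ln 0\<close> never matters.\<close>

definition step_law :: "real measure" where
  "step_law = distr (density (M \<Otimes>\<^sub>M count_space UNIV) (\<lambda>z. ennreal (A (snd z) (fst z) powr \<alpha>)))
     borel (\<lambda>z. ln (A (snd z) (fst z)))"

lemma A_pair_measurable[measurable]: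
  "(\<lambda>z. A (snd z) (fst z)) \<in> borel_measurable (M \<Otimes>\<^sub>M count_space UNIV)"
  by (rule measurable_compose_countable[where f="\<lambda>i z. A i (fst z)" and g=snd]) measurable

lemma nn_integral_step_law:
  assumes [measurable]: "h \<in> borel_measurable borel"
  shows "(\<integral>\<^sup>+u. h u \<partial>step_law) = (\<integral>\<^sup>+\<omega>. (\<Sum>i. ennreal (A i \<omega> powr \<alpha>) * h (ln (A i \<omega>))) \<partial>M)"
proof -
  interpret N: sigma_finite_measure "count_space (UNIV::nat set)"
    by (rule sigma_finite_measure_count_space)
  have "(\<integral>\<^sup>+u. h u \<partial>step_law) =
      (\<integral>\<^sup>+z. ennreal (A (snd z) (fst z) powr \<alpha>) * h (ln (A (snd z) (fst z))) \<partial>(M \<Otimes>\<^sub>M count_space UNIV))"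
    unfolding step_law_def by (subst nn_integral_distr) (auto simp: nn_integral_density)
  also have "\<dots> = (\<integral>\<^sup>+\<omega>. \<integral>\<^sup>+i. ennreal (A i \<omega> powr \<alpha>) * h (ln (A i \<omega>)) \<partial>count_space UNIV \<partial>M)"
    by (subst N.nn_integral_fst[symmetric]) auto
  finally show ?thesis by (simp only: nn_integral_count_space_nat)
qed

lemma sets_step_law[measurable_cong, simp]: "sets step_law = sets borel"
  by (simp add: step_law_def)

lemma space_step_law[simp]: "space step_law = UNIV"
  by (simp add: step_law_def)

text \<open>All power sums become exponential moments of one law: \<epsilon> = 0 gives its total
  mass 1, and \<epsilon> = \<alpha> - 1 gives the expected sum of the weights, again 1.\<close>

lemma nn_integral_step_law_exp:
  "(\<integral>\<^sup>+u. ennreal (exp (- \<epsilon> * u)) \<partial>step_law) = power_sum (\<alpha> - \<epsilon>)"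
proof -
  have "ennreal (A i \<omega> powr \<alpha>) * ennreal (exp (- \<epsilon> * ln (A i \<omega>))) = ennreal (A i \<omega> powr (\<alpha> - \<epsilon>))" for i \<omega>
    using A_nonneg[of i \<omega>] by (cases "A i \<omega> = 0") (auto simp: powr_def algebra_simps simp flip: ennreal_mult exp_add)
  then show ?thesis by (simp add: nn_integral_step_law power_sum_def)
qed

lemma prob_space_step_law: "prob_space step_law"
  by (rule prob_spaceI) (use nn_integral_step_law_exp[of 0] sum_\<alpha> in \<open>simp add: power_sum_def\<close>)

lemma step_law_nonarith: "nonarithmetic step_law"
  unfolding nonarithmetic_def
proof (intro allI impI)
  fix d :: real assume "d > 0"
  define Z where "Z = range (\<lambda>k::int. d * of_int k)"
  have "countable Z" by (simp add: Z_def)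
  then have "Z \<in> sets borel" by (rule sets.countable[rotated]) auto
  then have Zc: "UNIV - Z \<in> sets borel" by auto
  obtain j where "emeasure M {\<omega> \<in> space M. A j \<omega> > 0 \<and> ln (A j \<omega>) \<notin> Z} > 0"
    using nonarith_weight \<open>d > 0\<close> unfolding Z_def by blast
  moreover have "{\<omega> \<in> space M. A j \<omega> > 0 \<and> ln (A j \<omega>) \<notin> Z} =
      {\<omega> \<in> space M. ennreal (A j \<omega> powr \<alpha>) * indicator (UNIV - Z) (ln (A j \<omega>)) \<noteq> 0}"
    using A_nonneg by (auto simp: indicator_def less_le)
  moreover have "(\<lambda>\<omega>. ennreal (A j \<omega> powr \<alpha>) * indicator (UNIV - Z) (ln (A j \<omega>))) \<in> borel_measurable M"
    using Zc by measurable
  ultimately have "(\<integral>\<^sup>+\<omega>. ennreal (A j \<omega> powr \<alpha>) * indicator (UNIV - Z) (ln (A j \<omega>)) \<partial>M) \<noteq> 0"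
    by (subst nn_integral_0_iff) auto
  then have "0 < (\<integral>\<^sup>+\<omega>. ennreal (A j \<omega> powr \<alpha>) * indicator (UNIV - Z) (ln (A j \<omega>)) \<partial>M)"
    by (simp only: zero_less_iff_neq_zero not_False_eq_True)
  also have "(\<integral>\<^sup>+\<omega>. ennreal (A j \<omega> powr \<alpha>) * indicator (UNIV - Z) (ln (A j \<omega>)) \<partial>M) \<le>
      (\<integral>\<^sup>+\<omega>. (\<Sum>i. ennreal (A i \<omega> powr \<alpha>) * indicator (UNIV - Z) (ln (A i \<omega>))) \<partial>M)"
  proof (intro nn_integral_mono)
    fix \<omega>
    define f where "f i = ennreal (A i \<omega> powr \<alpha>) * indicator (UNIV - Z) (ln (A i \<omega>))" for i
    have "sum f {j} \<le> suminf f" by (rule sum_le_suminf[OF summableI]) auto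
    then have "f j \<le> suminf f" by simp
    then show "ennreal (A j \<omega> powr \<alpha>) * indicator (UNIV - Z) (ln (A j \<omega>)) \<le>
        (\<Sum>i. ennreal (A i \<omega> powr \<alpha>) * indicator (UNIV - Z) (ln (A i \<omega>)))"
      unfolding f_def .
  qed
  also have "\<dots> = (\<integral>\<^sup>+u. indicator (UNIV - Z) u \<partial>step_law)"
    using Zc by (intro nn_integral_step_law[symmetric]) auto
  also have "\<dots> = emeasure step_law (UNIV - Z)" using Zc by simp
  finally show "0 < emeasure step_law (UNIV - range (\<lambda>k::int. d * of_int k))"
    by (simp add: Z_def)
qed

lemma integrable_step_law_exp: "integrable step_law (\<lambda>u. exp (- (\<alpha> - 1) * u))"
proof (rule integrableI_nonneg)
  have "(\<integral>\<^sup>+u. ennreal (exp (- (\<alpha> - 1) * u)) \<partial>step_law) = power_sum 1"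
    using nn_integral_step_law_exp[of "\<alpha> - 1"] by simp
  also have "\<dots> = 1" unfolding power_sum_def using sum_1 A_nonneg by simp
  finally show "(\<integral>\<^sup>+u. ennreal (exp (- (\<alpha> - 1) * u)) \<partial>step_law) < \<infinity>" by simp
qed auto

lemma expectation_step_law_exp: "(\<integral>u. exp (- (\<alpha> - 1) * u) \<partial>step_law) = 1"
proof -
  have "(\<integral>\<^sup>+u. ennreal (exp (- (\<alpha> - 1) * u)) \<partial>step_law) = 1"
    using nn_integral_step_law_exp[of "\<alpha> - 1"] sum_1 A_nonneg by (simp add: power_sum_def)
  then show ?thesis
    using nn_integral_eq_integral[OF integrable_step_law_exp] by (simp add: ennreal_eq_1)
qed

lemma integrable_step_law_id: "integrable step_law (\<lambda>u. u)"
proof -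
  have "(\<integral>\<^sup>+u. ennreal (max u 0) \<partial>step_law) =
      (\<integral>\<^sup>+\<omega>. (\<Sum>i. ennreal (A i \<omega> powr \<alpha>) * ennreal (max (ln (A i \<omega>)) 0)) \<partial>M)"
    by (rule nn_integral_step_law) measurable
  also have "\<dots> = (\<integral>\<^sup>+\<omega>. (\<Sum>i. ennreal (A i \<omega> powr \<alpha> * max (ln (A i \<omega>)) 0)) \<partial>M)"
    by (intro nn_integral_cong suminf_cong ennreal_mult[symmetric]) auto
  also note sum_log
  finally have "integrable step_law (\<lambda>u. max u 0)" by (intro integrableI_nonneg) auto
  then have "integrable step_law (\<lambda>u. max u 0 + 1 / (\<alpha> - 1) * exp (- (\<alpha> - 1) * u))"
    using integrable_step_law_exp by auto
  then show ?thesis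
  proof (rule Bochner_Integration.integrable_bound)
    show "AE u in step_law. norm u \<le> norm (max u 0 + 1 / (\<alpha> - 1) * exp (- (\<alpha> - 1) * u))"
    proof (intro AE_I2)
      fix u :: real
      have "- ((\<alpha> - 1) * u) \<le> exp (- (\<alpha> - 1) * u)" 
        using exp_ge_add_one_self[of "- (\<alpha> - 1) * u"] unfolding mult_minus_left by linarith
      then have 1: "- u \<le> 1 / (\<alpha> - 1) * exp (- (\<alpha> - 1) * u)" using \<alpha>_gt_1 by (simp add: field_simps)
      have 2: "0 \<le> 1 / (\<alpha> - 1) * exp (- (\<alpha> - 1) * u)" using \<alpha>_gt_1 by simp
      show "norm u \<le> norm (max u 0 + 1 / (\<alpha> - 1) * exp (- (\<alpha> - 1) * u))"
        using 1 2 unfolding real_norm_def by (simp only: max_def split: if_splits) linarith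
    qed
  qed auto
qed

lemma AE_step_law_0: "\<not> (AE u in step_law. u = 0)"
proof
  assume ae: "AE u in step_law. u = 0"
  define Z where "Z = range (\<lambda>k::int. 1 * real_of_int k)"
  have "countable Z" by (simp add: Z_def)
  then have "Z \<in> sets borel" by (rule sets.countable[rotated]) auto
  then have Zc: "UNIV - Z \<in> sets step_law" by auto
  have "0 \<in> Z" unfolding Z_def by (rule image_eqI[of _ _ 0]) auto
  then have "AE u in step_law. u \<notin> UNIV - Z" using ae by (auto elim!: eventually_mono)
  then have "emeasure step_law (UNIV - Z) = 0"
    using AE_iff_null_sets[OF Zc] by auto
  then show False using step_law_nonarith[unfolded nonarithmetic_def, rule_format, of 1] by (simp add: Z_def)
qed

text \<open>With a = \<alpha> - 1, exp (- a u) \<ge> 1 - a u with equality only at u = 0. The left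
  side has mean 1 and the step law is not the point mass at 0, so a times the mean is
  positive.\<close>

lemma step_law_mean_pos: "(\<integral>u. u \<partial>step_law) > 0"
proof -
  interpret E: prob_space step_law by (rule prob_space_step_law)
  let ?a = "\<alpha> - 1"
  let ?h = "\<lambda>u. exp (- ?a * u) - (1 - ?a * u)"
  have h0: "0 \<le> ?h u" for u
    using exp_ge_add_one_self[of "- ?a * u"] unfolding mult_minus_left by linarith
  have int: "integrable step_law ?h" using integrable_step_law_exp integrable_step_law_id by auto
  have "(\<integral>u. ?h u \<partial>step_law) = 1 - (1 - ?a * (\<integral>u. u \<partial>step_law))"
    using integrable_step_law_exp integrable_step_law_id E.prob_space
    by (simp add: expectation_step_law_exp[simplified])
  moreover have "(\<integral>u. ?h u \<partial>step_law) \<noteq> 0"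
  proof
    assume "(\<integral>u. ?h u \<partial>step_law) = 0"
    then have "AE u in step_law. ?h u = 0"
      using integral_nonneg_eq_0_iff_AE[OF int] h0 by simp
    then have "AE u in step_law. u = 0"
    proof eventually_elim
      case (elim u)
      have "- ?a * u = 0"
      proof (rule ccontr)
        assume "- ?a * u \<noteq> 0"
        then show False using exp_gt_add_one[of "- ?a * u"] elim unfolding mult_minus_left by linarith
      qed
      then show ?case using \<alpha>_gt_1 by simp
    qed
    then show False using AE_step_law_0 by blast
  qed
  moreover have "(\<integral>u. ?h u \<partial>step_law) \<ge> 0" by (rule Bochner_Integration.integral_nonneg) (rule h0)
  ultimately have "?a * (\<integral>u. u \<partial>step_law) > 0" by linarith
  then show ?thesis using \<alpha>_gt_1 by (simp add: zero_less_mult_iff)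
qed

lemma renewal_step_law: "renewal_step step_law (\<alpha> - 1)"
  using prob_space_step_law \<alpha>_gt_1 integrable_step_law_exp integrable_step_law_id step_law_mean_pos step_law_nonarith
  by (auto simp: renewal_step_def renewal_step_axioms_def)

sublocale step: renewal_step step_law "\<alpha> - 1" by (rule renewal_step_law)

text \<open>Exponential moments of a law other than the point mass at 0 are strictly convex in the
  exponent, and here they equal 1 at both ends. \<theta> is the position of \<beta> on the way from
  \<alpha> to 1.\<close>

lemma power_sum_less_1:
  assumes "1 < \<beta>" "\<beta> < \<alpha>"
  shows "power_sum \<beta> < 1"
proof -
  define \<theta> where "\<theta> = (\<alpha> - \<beta>) / (\<alpha> - 1)"
  have \<theta>: "0 < \<theta>" "\<theta> < 1" using assms by (auto simp: \<theta>_def field_simps)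
  have ex: "exp (- (\<alpha> - \<beta>) * u) = exp (\<theta> * (- (\<alpha> - 1) * u))" for u
    using \<alpha>_gt_1 by (simp add: \<theta>_def field_simps)
  let ?h = "\<lambda>u. (1 - \<theta>) + \<theta> * exp (- (\<alpha> - 1) * u) - exp (- (\<alpha> - \<beta>) * u)"
  have h0: "0 \<le> ?h u" for u unfolding ex using exp_le_chord(1)[OF \<theta>, of "- (\<alpha> - 1) * u"] by linarith
  have int1: "integrable step_law (\<lambda>u. (1 - \<theta>) + \<theta> * exp (- (\<alpha> - 1) * u))"
    using integrable_step_law_exp by auto
  have int2: "integrable step_law (\<lambda>u. exp (- (\<alpha> - \<beta>) * u))"
  proof (rule Bochner_Integration.integrable_bound[OF int1])
    show "AE u in step_law. norm (exp (- (\<alpha> - \<beta>) * u)) \<le> norm ((1 - \<theta>) + \<theta> * exp (- (\<alpha> - 1) * u))"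
      using h0 \<theta> by (intro AE_I2) (simp add: abs_of_nonneg add_nonneg_nonneg)
  qed auto
  have int: "integrable step_law ?h" using int1 int2 by (rule Bochner_Integration.integrable_diff)
  have "(\<integral>u. ?h u \<partial>step_law) = 1 - (\<integral>u. exp (- (\<alpha> - \<beta>) * u) \<partial>step_law)"
    using int1 int2 integrable_step_law_exp step.prob_space
    by (simp add: expectation_step_law_exp[simplified])
  moreover have "(\<integral>u. ?h u \<partial>step_law) \<noteq> 0"
  proof
    assume "(\<integral>u. ?h u \<partial>step_law) = 0"
    then have "AE u in step_law. ?h u = 0"
      using integral_nonneg_eq_0_iff_AE[OF int] h0 by simp
    then have "AE u in step_law. u = 0"
    proof eventually_elim
      case (elim u)
      then show ?case using exp_le_chord(2)[OF \<theta>, of "- (\<alpha> - 1) * u"] \<alpha>_gt_1 unfolding ex by fastforce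
    qed
    then show False using AE_step_law_0 by blast
  qed
  moreover have "(\<integral>u. ?h u \<partial>step_law) \<ge> 0" by (rule Bochner_Integration.integral_nonneg) (rule h0)
  ultimately have "(\<integral>u. exp (- (\<alpha> - \<beta>) * u) \<partial>step_law) < 1" by linarith
  moreover have "power_sum \<beta> = ennreal (\<integral>u. exp (- (\<alpha> - \<beta>) * u) \<partial>step_law)"
    using nn_integral_step_law_exp[of "\<alpha> - \<beta>"] nn_integral_eq_integral[OF int2] by simp
  ultimately show ?thesis by (simp add: ennreal_less_one_iff)
qed

definition smoothing :: "real measure \<Rightarrow> real measure" where
  "smoothing \<rho> = distr (M \<Otimes>\<^sub>M PiM UNIV (\<lambda>_. \<rho>)) borel (\<lambda>z. \<Sum>i. A i (fst z) * snd z i)"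

end

locale weights_law = weights M A \<alpha> + law: nonneg_law \<rho> for M :: "'a measure" and A \<alpha> \<rho>
begin

abbreviation \<Omega> where "\<Omega> \<equiv> M \<Otimes>\<^sub>M law.P"

lemma sigma_finite_P: "sigma_finite_measure law.P"
  by (rule prob_space_imp_sigma_finite[OF law.prob_space_P])

sublocale \<Omega>: pair_prob_space M law.P ..

definition X :: "'a \<times> (nat \<Rightarrow> real) \<Rightarrow> real" where "X z = (\<Sum>i. A i (fst z) * snd z i)"

lemma coordinate_measurable[measurable]: "(\<lambda>z. snd z i) \<in> borel_measurable \<Omega>"
proof -
  have "(\<lambda>z. snd z i) \<in> measurable \<Omega> \<rho>" by measurable
  then show ?thesis by (simp cong: measurable_cong_sets add: law.sets_\<rho>)
qed

lemma X_measurable[measurable]: "X \<in> borel_measurable \<Omega>"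
  unfolding X_def by measurable

lemma AE_regular: "AE z in \<Omega>. (\<forall>i. 0 \<le> snd z i) \<and> summable (\<lambda>i. A i (fst z) * snd z i)"
proof -
  \<comment> \<open>Summability is expressed as finiteness of an extended series, a measurable
    condition on the product space.\<close>
  have 1: "AE z in \<Omega>. (\<Sum>i. ennreal (A i (fst z) * snd z i)) < \<top> \<and> (\<forall>i. 0 \<le> snd z i)"
  proof (rule \<Omega>.AE_pair_measure)
    have "AE r in law.P. (\<Sum>i. ennreal (A i \<omega> * r i)) < \<top> \<and> (\<forall>i. 0 \<le> r i)" for \<omega>
      using law.AE_nonneg law.AE_summable[OF A_nonneg A_summable, of \<omega>]
    proof eventually_elim
      case (elim r)
      then show ?case using A_nonneg by (subst suminf_ennreal2) auto
    qed
    then show "AE \<omega> in M. AE r in law.P.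
        (\<Sum>i. ennreal (A i (fst (\<omega>, r)) * snd (\<omega>, r) i)) < \<top> \<and> (\<forall>i. 0 \<le> snd (\<omega>, r) i)" by simp
  qed measurable
  then show ?thesis
  proof eventually_elim
    case (elim z)
    then show ?case using A_nonneg by (auto intro!: summable_suminf_not_top)
  qed
qed

lemma AE_X_nonneg: "AE z in \<Omega>. 0 \<le> X z"
  using AE_regular by eventually_elim (auto simp: X_def A_nonneg intro!: suminf_nonneg)

lemma AE_nonneg_summable: "b > 0 \<Longrightarrow> AE z in \<Omega>. nonneg_summable (\<lambda>i. A i (fst z) * snd z i) b"
  using AE_regular by eventually_elim (auto simp: nonneg_summable_def A_nonneg)

lemma nn_integral_termwise:
  fixes h :: "real \<Rightarrow> ennreal"
  assumes [measurable]: "h \<in> borel_measurable borel"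
  shows "(\<integral>\<^sup>+z. (\<Sum>i. h (A i (fst z) * snd z i)) \<partial>\<Omega>) = (\<integral>\<^sup>+\<omega>. (\<Sum>i. \<integral>\<^sup>+x. h (A i \<omega> * x) \<partial>\<rho>) \<partial>M)"
proof -
  have "(\<integral>\<^sup>+z. (\<Sum>i. h (A i (fst z) * snd z i)) \<partial>\<Omega>) = (\<integral>\<^sup>+\<omega>. \<integral>\<^sup>+r. (\<Sum>i. h (A i \<omega> * r i)) \<partial>law.P \<partial>M)"
    by (subst sigma_finite_measure.nn_integral_fst[OF sigma_finite_P, symmetric]) auto
  also have "\<dots> = (\<integral>\<^sup>+\<omega>. (\<Sum>i. \<integral>\<^sup>+r. h (A i \<omega> * r i) \<partial>law.P) \<partial>M)"
    by (intro nn_integral_cong nn_integral_suminf) measurable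
  also have "\<dots> = (\<integral>\<^sup>+\<omega>. (\<Sum>i. \<integral>\<^sup>+x. h (A i \<omega> * x) \<partial>\<rho>) \<partial>M)"
    using law.nn_integral_component[of "\<lambda>x. h (A _ _ * x)"] by simp
  finally show ?thesis .
qed

lemma nn_integral_X: "(\<integral>\<^sup>+z. ennreal (X z) \<partial>\<Omega>) = moment \<rho> 1"
proof -
  have "(\<integral>\<^sup>+z. ennreal (X z) \<partial>\<Omega>) = (\<integral>\<^sup>+z. (\<Sum>i. ennreal (A i (fst z) * snd z i)) \<partial>\<Omega>)"
    by (rule nn_integral_cong_AE, use AE_regular in eventually_elim)
      (simp add: X_def suminf_ennreal2 A_nonneg)
  also have "\<dots> = (\<integral>\<^sup>+\<omega>. (\<Sum>i. ennreal (A i \<omega>)) * moment \<rho> 1 \<partial>M)"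
    by (subst nn_integral_termwise) (auto simp: law.nn_integral_scaled A_nonneg)
  also have "\<dots> = moment \<rho> 1" by (simp add: nn_integral_multc sum_1)
  finally show ?thesis .
qed

lemma smoothing_eq: "smoothing \<rho> = distr \<Omega> borel X"
  unfolding smoothing_def X_def ..

lemma nonneg_law_smoothing: "nonneg_law (smoothing \<rho>)"
  unfolding smoothing_eq nonneg_law_def nonneg_law_axioms_def
proof (intro conjI)
  show "prob_space (distr \<Omega> borel X)" by (rule \<Omega>.prob_space_distr) measurable
  show "AE x in distr \<Omega> borel X. 0 \<le> x" by (subst AE_distr_iff) (auto simp: AE_X_nonneg)
  have "integrable \<Omega> X"
    by (rule integrableI_nonneg) (auto simp: AE_X_nonneg nn_integral_X law.moment_1)
  then show "integrable (distr \<Omega> borel X) (\<lambda>x. x)" by (subst integrable_distr_eq) auto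
qed simp

lemma moment_smoothing: "moment (smoothing \<rho>) \<beta> = (\<integral>\<^sup>+z. ennreal (X z powr \<beta>) \<partial>\<Omega>)"
  unfolding smoothing_eq moment_def by (subst nn_integral_distr) auto

lemma moment_smoothing_1: "moment (smoothing \<rho>) 1 = moment \<rho> 1"
  unfolding moment_smoothing nn_integral_X[symmetric]
  by (rule nn_integral_cong_AE, use AE_X_nonneg in eventually_elim) simp

lemma nn_integral_cross:
  assumes b: "b > 0"
  shows "(\<integral>\<^sup>+z. ennreal (cross b (\<lambda>i. A i (fst z) * snd z i)) \<partial>\<Omega>) \<le>
    (\<integral>\<^sup>+\<omega>. ennreal (A_sum \<omega> powr (b + 1)) \<partial>M) * (moment \<rho> 1 * (1 + moment \<rho> (max b 1)))"
proof -
  have [measurable]: "(\<lambda>z. ennreal (cross b (\<lambda>i. A i (fst z) * snd z i))) \<in> borel_measurable \<Omega>"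
    unfolding cross_def by measurable
  have "(\<integral>\<^sup>+z. ennreal (cross b (\<lambda>i. A i (fst z) * snd z i)) \<partial>\<Omega>) =
      (\<integral>\<^sup>+\<omega>. \<integral>\<^sup>+r. ennreal (cross b (\<lambda>i. A i \<omega> * r i)) \<partial>law.P \<partial>M)"
    by (subst sigma_finite_measure.nn_integral_fst[OF sigma_finite_P, symmetric]) auto
  also have "\<dots> \<le> (\<integral>\<^sup>+\<omega>. ennreal (A_sum \<omega> powr (b + 1)) * (moment \<rho> 1 * (1 + moment \<rho> (max b 1))) \<partial>M)"
    unfolding A_sum_def by (intro nn_integral_mono law.nn_integral_cross_le A_nonneg A_summable b)
  finally show ?thesis by (simp add: nn_integral_multc)
qed

lemma nn_integral_sum_powr:
  "(\<integral>\<^sup>+z. (\<Sum>i. ennreal ((A i (fst z) * snd z i) powr \<beta>)) \<partial>\<Omega>) = power_sum \<beta> * moment \<rho> \<beta>"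
proof -
  have "(\<integral>\<^sup>+z. (\<Sum>i. ennreal ((A i (fst z) * snd z i) powr \<beta>)) \<partial>\<Omega>) =
      (\<integral>\<^sup>+\<omega>. (\<Sum>i. ennreal (A i \<omega> powr \<beta>)) * moment \<rho> \<beta> \<partial>M)"
    by (subst nn_integral_termwise) (auto simp: powr_mult ennreal_mult nn_integral_cmult moment_def)
  then show ?thesis by (simp add: nn_integral_multc power_sum_def)
qed

text \<open>One step multiplies the moment of order b + 1 by \<open>power_sum (b + 1)\<close>, which
  is below 1 for 1 < b + 1 < \<alpha>, and adds a term that involves only moments of order 1 and max
  b 1.\<close>

lemma moment_smoothing_le:
  assumes b: "b > 0"
  shows "moment (smoothing \<rho>) (b + 1) \<le> power_sum (b + 1) * moment \<rho> (b + 1) +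
    ennreal ((b + 1) * 2 powr b) * ((\<integral>\<^sup>+\<omega>. ennreal (A_sum \<omega> powr (b + 1)) \<partial>M) * (moment \<rho> 1 * (1 + moment \<rho> (max b 1))))"
proof -
  have [measurable]: "(\<lambda>z. ennreal (cross b (\<lambda>i. A i (fst z) * snd z i))) \<in> borel_measurable \<Omega>"
    unfolding cross_def by measurable
  have "moment (smoothing \<rho>) (b + 1) \<le> (\<integral>\<^sup>+z. (\<Sum>i. ennreal ((A i (fst z) * snd z i) powr (b + 1))) +
      ennreal ((b + 1) * 2 powr b) * ennreal (cross b (\<lambda>i. A i (fst z) * snd z i)) \<partial>\<Omega>)"
    unfolding moment_smoothing
  proof (rule nn_integral_mono_AE, use AE_nonneg_summable[OF b] in eventually_elim)
    case (elim z)
    then interpret nonneg_summable "\<lambda>i. A i (fst z) * snd z i" b .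
    have "ennreal (X z powr (b + 1)) \<le> ennreal ((\<Sum>j. (A j (fst z) * snd z j) powr (b + 1)) + (b + 1) * 2 powr b * cross b (\<lambda>i. A i (fst z) * snd z i))"
      unfolding X_def by (rule ennreal_leI[OF powr_suminf_le_cross])
    also have "\<dots> = (\<Sum>i. ennreal ((A i (fst z) * snd z i) powr (b + 1))) +
        ennreal ((b + 1) * 2 powr b) * ennreal (cross b (\<lambda>i. A i (fst z) * snd z i))"
      using summable_powr b cross_nonneg
      by (subst suminf_ennreal2) (auto simp: ennreal_mult suminf_nonneg)
    finally show ?case .
  qed
  also have "\<dots> = power_sum (b + 1) * moment \<rho> (b + 1) +
      ennreal ((b + 1) * 2 powr b) * (\<integral>\<^sup>+z. ennreal (cross b (\<lambda>i. A i (fst z) * snd z i)) \<partial>\<Omega>)"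
    by (simp add: nn_integral_add nn_integral_cmult nn_integral_sum_powr)
  also have "\<dots> \<le> power_sum (b + 1) * moment \<rho> (b + 1) +
    ennreal ((b + 1) * 2 powr b) * ((\<integral>\<^sup>+\<omega>. ennreal (A_sum \<omega> powr (b + 1)) \<partial>M) * (moment \<rho> 1 * (1 + moment \<rho> (max b 1))))"
    by (intro add_left_mono mult_left_mono nn_integral_cross b) auto
  finally show ?thesis .
qed

end

context weights
begin

lemma nn_integral_A_sum_powr_finite:
  assumes "1 \<le> \<beta>" "\<beta> \<le> \<alpha>"
  shows "(\<integral>\<^sup>+\<omega>. ennreal (A_sum \<omega> powr \<beta>) \<partial>M) < \<top>"
proof -
  have "(\<integral>\<^sup>+\<omega>. ennreal (A_sum \<omega> powr \<beta>) \<partial>M) \<le> (\<integral>\<^sup>+\<omega>. 1 + ennreal (A_sum \<omega> powr \<alpha>) \<partial>M)"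
  proof (intro nn_integral_mono)
    fix \<omega>
    have "A_sum \<omega> powr \<beta> \<le> 1 + A_sum \<omega> powr \<alpha>"
    proof (cases "A_sum \<omega> \<le> 1")
      case True
      then have "A_sum \<omega> powr \<beta> \<le> 1" using A_sum_nonneg assms by (intro powr_le1) auto
      then show ?thesis by (simp add: add_increasing2)
    next
      case False
      then have "A_sum \<omega> powr \<beta> \<le> A_sum \<omega> powr \<alpha>" using assms by (intro powr_mono) auto
      then show ?thesis by simp
    qed
    then show "ennreal (A_sum \<omega> powr \<beta>) \<le> 1 + ennreal (A_sum \<omega> powr \<alpha>)"
      using ennreal_leI[of "A_sum \<omega> powr \<beta>" "1 + A_sum \<omega> powr \<alpha>"] by simp
  qed
  also have "\<dots> = 1 + (\<integral>\<^sup>+\<omega>. ennreal (A_sum \<omega> powr \<alpha>) \<partial>M)"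
    by (simp add: nn_integral_add emeasure_space_1)
  also have "\<dots> < \<top>"
    using nn_integral_eq_integral[OF integrable_sum_powr] by (simp add: A_sum_def ennreal_add_less_top)
  finally show ?thesis .
qed

end

section \<open>Existence of a fixed law\<close>

text \<open>The quadratic Taylor remainder is used for |y| \<le> 1 and the linear one beyond; either
  is dominated by |y|^p in its own range.\<close>

lemma cmod_iexp_linear_le:
  fixes y p :: real
  assumes "1 \<le> p" "p \<le> 2"
  shows "cmod (iexp y - (1 + \<i> * y)) \<le> 2 * \<bar>y\<bar> powr p"
proof (cases "\<bar>y\<bar> \<le> 1")
  case True
  have "cmod (iexp y - (1 + \<i> * y)) \<le> \<bar>y\<bar>^2 / 2"
    using iexp_approx1[of y 1] by (simp add: numeral_2_eq_2)
  also have "\<bar>y\<bar>^2 / 2 \<le> 2 * \<bar>y\<bar> powr 2" by simp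
  also have "\<bar>y\<bar> powr 2 \<le> \<bar>y\<bar> powr p" using True assms by (intro powr_mono') auto
  finally show ?thesis by simp
next
  case False
  have "cmod (iexp y - (1 + \<i> * y)) \<le> 2 * \<bar>y\<bar>"
    using iexp_approx2[of y 1] by (simp add: numeral_2_eq_2)
  also have "\<bar>y\<bar> = \<bar>y\<bar> powr 1" using False by simp
  also have "\<bar>y\<bar> powr 1 \<le> \<bar>y\<bar> powr p" using False assms by (intro powr_mono) auto
  finally show ?thesis by simp
qed

section \<open>Characteristic functions of weighted sums\<close>

context nonneg_law
begin

lemma real_distribution: "real_distribution \<rho>"
  by unfold_locales (rule sets_\<rho>)

lemma indep_vars_coordinates: "prob_space.indep_vars P (\<lambda>_. \<rho>) (\<lambda>i r. r i) UNIV"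
proof -
  have "(\<lambda>r::nat \<Rightarrow> real. restrict r UNIV) = (\<lambda>r. r)" by (auto simp: fun_eq_iff restrict_def)
  then show ?thesis
    by (subst P.P.indep_vars_iff_distr_eq_PiM') (simp_all add: distr_component)
qed

lemma iexp_sum_integral:
  "(CLINT r|P. iexp (t * (\<Sum>i<n. c i * r i))) = (\<Prod>i<n. char \<rho> (t * c i))"
proof -
  have [measurable]: "(\<lambda>x. iexp (t * (c i * x))) \<in> borel_measurable \<rho>" for i by measurable
  have "P.P.indep_vars (\<lambda>_. borel) (\<lambda>i r. iexp (t * (c i * r i))) UNIV"
    by (rule P.P.indep_vars_compose2[OF indep_vars_coordinates]) measurable
  then have ind: "P.P.indep_vars (\<lambda>_. borel) (\<lambda>i r. iexp (t * (c i * r i))) {..<n}"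
    by (rule P.P.indep_vars_subset) auto
  have "(CLINT r|P. iexp (t * (\<Sum>i<n. c i * r i))) = (CLINT r|P. (\<Prod>i<n. iexp (t * (c i * r i))))"
    by (intro Bochner_Integration.integral_cong) (auto simp: exp_sum sum_distrib_left)
  also have "\<dots> = (\<Prod>i<n. CLINT r|P. iexp (t * (c i * r i)))"
    by (rule P.P.indep_vars_lebesgue_integral[OF _ ind]) (auto intro!: P.P.integrable_const_bound[of _ 1])
  also have "\<dots> = (\<Prod>i<n. char \<rho> (t * c i))"
  proof (rule prod.cong[OF refl])
    fix i
    have "(CLINT x|distr P \<rho> (\<lambda>r. r i). iexp (t * (c i * x))) = (CLINT r|P. iexp (t * (c i * r i)))"
      by (rule integral_distr) measurable
    then show "(CLINT r|P. iexp (t * (c i * r i))) = char \<rho> (t * c i)"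
      by (simp add: distr_component char_def mult.assoc)
  qed
  finally show ?thesis .
qed

lemma iexp_sum_tendsto:
  assumes c: "\<And>i. c i \<ge> 0" "summable c"
  shows "(\<lambda>n. \<Prod>i<n. char \<rho> (t * c i)) \<longlonglongrightarrow> (CLINT r|P. iexp (t * (\<Sum>i. c i * r i)))"
  unfolding iexp_sum_integral[symmetric]
proof (rule integral_dominated_convergence[where w = "\<lambda>_. 1"])
  show "integrable P (\<lambda>_. 1 :: real)" by simp
  show "AE r in P. (\<lambda>n. iexp (t * (\<Sum>i<n. c i * r i))) \<longlonglongrightarrow> iexp (t * (\<Sum>i. c i * r i))"
    using AE_summable[OF c]
  proof eventually_elim
    case (elim r)
    from summable_LIMSEQ[OF this] show ?case
      by (intro isCont_tendsto_compose[OF isCont_iexp] tendsto_mult tendsto_const)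
  qed
qed auto

text \<open>Mean 1 fixes the linear term, so any two such laws with finite p-th moments have finite
  distance in the metric of order p.\<close>

lemma char_linear_le:
  assumes m1: "moment \<rho> 1 = 1" and p: "1 \<le> p" "p \<le> 2" and B: "moment \<rho> p \<le> ennreal B" "B \<ge> 0"
  shows "cmod (char \<rho> t - (1 + \<i> * t)) \<le> 2 * B * \<bar>t\<bar> powr p"
proof -
  have int_p: "integrable \<rho> (\<lambda>x. x powr p)"
    by (rule integrableI_nonneg) (use B in \<open>auto simp: moment_def less_top[symmetric] top_unique\<close>)
  have le_B: "(\<integral>x. x powr p \<partial>\<rho>) \<le> B"
    using B nn_integral_eq_integral[OF int_p] by (simp add: moment_def)
  have mean: "(\<integral>x. x \<partial>\<rho>) = 1" using m1 moment_1 by (simp add: ennreal_eq_1)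
  have int_e: "integrable \<rho> (\<lambda>x. iexp (t * x))" by (rule integrable_iexp) auto
  have int_l: "complex_integrable \<rho> (\<lambda>x. 1 + \<i> * complex_of_real (t * x))"
    using integrable_id by (intro Bochner_Integration.integrable_add integrable_mult_right integrable_of_real) auto
  have "(CLINT x|\<rho>. 1 + \<i> * complex_of_real (t * x)) = 1 + \<i> * t"
    using integrable_id mean by (subst Bochner_Integration.integral_add) (auto simp: prob_space[simplified])
  then have "char \<rho> t - (1 + \<i> * t) = (CLINT x|\<rho>. iexp (t * x) - (1 + \<i> * complex_of_real (t * x)))"
    unfolding char_def using int_e int_l by (subst Bochner_Integration.integral_diff) auto
  also have "cmod \<dots> \<le> (\<integral>x. cmod (iexp (t * x) - (1 + \<i> * complex_of_real (t * x))) \<partial>\<rho>)"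
    by (rule integral_norm_bound)
  also have "\<dots> \<le> (\<integral>x. 2 * \<bar>t\<bar> powr p * (x powr p) \<partial>\<rho>)"
  proof (rule integral_mono_AE)
    show "integrable \<rho> (\<lambda>x. cmod (iexp (t * x) - (1 + \<i> * complex_of_real (t * x))))"
      using int_e int_l by auto
    show "integrable \<rho> (\<lambda>x. 2 * \<bar>t\<bar> powr p * x powr p)" using int_p by auto
    show "AE x in \<rho>. cmod (iexp (t * x) - (1 + \<i> * complex_of_real (t * x))) \<le> 2 * \<bar>t\<bar> powr p * x powr p"
      using nonneg
    proof eventually_elim
      case (elim x)
      then show ?case using cmod_iexp_linear_le[OF p, of "t * x"] by (simp add: abs_mult powr_mult)
    qed
  qed
  also have "\<dots> = 2 * \<bar>t\<bar> powr p * (\<integral>x. x powr p \<partial>\<rho>)" by simp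
  also have "\<dots> \<le> 2 * \<bar>t\<bar> powr p * B" by (rule mult_left_mono[OF le_B]) simp
  finally show ?thesis by (simp only: mult_ac)
qed

end

text \<open>Factors in the unit disc: a difference of products is at most the sum of the differences
  of the factors. The bound is uniform in the number of factors and passes to the limit.\<close>

lemma cmod_iexp_sum_diff_le:
  assumes "nonneg_law \<rho>" "nonneg_law \<rho>'" and c: "\<And>i. c i \<ge> 0" "summable c" "summable (\<lambda>i. c i powr p)"
    and \<kappa>: "\<And>s. cmod (char \<rho> s - char \<rho>' s) \<le> \<kappa> * \<bar>s\<bar> powr p"
  shows "cmod ((CLINT r|PiM UNIV (\<lambda>_. \<rho>). iexp (t * (\<Sum>i. c i * r i))) - (CLINT r|PiM UNIV (\<lambda>_. \<rho>'). iexp (t * (\<Sum>i. c i * r i))))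
    \<le> \<kappa> * \<bar>t\<bar> powr p * (\<Sum>i. c i powr p)"
proof -
  interpret l1: nonneg_law \<rho> by fact
  interpret l2: nonneg_law \<rho>' by fact
  interpret r1: real_distribution \<rho> by (rule l1.real_distribution)
  interpret r2: real_distribution \<rho>' by (rule l2.real_distribution)
  have \<kappa>0: "\<kappa> \<ge> 0" using \<kappa>[of 1] order_trans[OF norm_ge_zero] by fastforce
  have "cmod ((\<Prod>i<n. char \<rho> (t * c i)) - (\<Prod>i<n. char \<rho>' (t * c i))) \<le> \<kappa> * \<bar>t\<bar> powr p * (\<Sum>i. c i powr p)" for n
  proof -
    have "cmod ((\<Prod>i<n. char \<rho> (t * c i)) - (\<Prod>i<n. char \<rho>' (t * c i))) \<le> (\<Sum>i<n. cmod (char \<rho> (t * c i) - char \<rho>' (t * c i)))"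
      by (rule norm_prod_diff) (rule r1.cmod_char_le_1 r2.cmod_char_le_1)+
    also have "\<dots> \<le> (\<Sum>i<n. \<kappa> * \<bar>t\<bar> powr p * c i powr p)"
    proof (rule sum_mono)
      fix i show "cmod (char \<rho> (t * c i) - char \<rho>' (t * c i)) \<le> \<kappa> * \<bar>t\<bar> powr p * c i powr p"
        using \<kappa>[of "t * c i"] c(1)[of i] by (simp add: abs_mult powr_mult mult.assoc)
    qed
    also have "\<dots> = \<kappa> * \<bar>t\<bar> powr p * (\<Sum>i<n. c i powr p)" by (simp add: sum_distrib_left)
    also have "\<dots> \<le> \<kappa> * \<bar>t\<bar> powr p * (\<Sum>i. c i powr p)"
      using \<kappa>0 c(3) by (intro mult_left_mono sum_le_suminf) auto
    finally show ?thesis .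
  qed
  moreover have "(\<lambda>n. cmod ((\<Prod>i<n. char \<rho> (t * c i)) - (\<Prod>i<n. char \<rho>' (t * c i)))) \<longlonglongrightarrow>
    cmod ((CLINT r|PiM UNIV (\<lambda>_. \<rho>). iexp (t * (\<Sum>i. c i * r i))) - (CLINT r|PiM UNIV (\<lambda>_. \<rho>'). iexp (t * (\<Sum>i. c i * r i))))"
    by (intro tendsto_norm tendsto_diff l1.iexp_sum_tendsto l2.iexp_sum_tendsto c)
  ultimately show ?thesis by (intro LIMSEQ_le_const2) auto
qed

context weights_law
begin

lemma char_smoothing: "char (smoothing \<rho>) t = (CLINT \<omega>|M. CLINT r|law.P. iexp (t * (\<Sum>i. A i \<omega> * r i)))"
    and integrable_char_smoothing: "complex_integrable M (\<lambda>\<omega>. CLINT r|law.P. iexp (t * (\<Sum>i. A i \<omega> * r i)))"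
proof -
  have int: "complex_integrable \<Omega> (\<lambda>z. iexp (t * X z))"
    by (rule \<Omega>.integrable_const_bound[of _ 1]) auto
  have "char (smoothing \<rho>) t = (CLINT z|\<Omega>. iexp (t * X z))"
    unfolding char_def smoothing_eq by (rule integral_distr) measurable
  also have "\<dots> = (CLINT \<omega>|M. CLINT r|law.P. iexp (t * X (\<omega>, r)))"
    using \<Omega>.integral_fst'[OF int] by simp
  finally show "char (smoothing \<rho>) t = (CLINT \<omega>|M. CLINT r|law.P. iexp (t * (\<Sum>i. A i \<omega> * r i)))"
    by (simp add: X_def)
  show "complex_integrable M (\<lambda>\<omega>. CLINT r|law.P. iexp (t * (\<Sum>i. A i \<omega> * r i)))"
    using \<Omega>.integrable_fst'[OF int] by (simp add: X_def)
qed

end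

context weights
begin

lemma weights_lawI: "nonneg_law \<rho> \<Longrightarrow> weights_law M A \<alpha> \<rho>"
  by (intro weights_law.intro weights_axioms)

lemma summable_A_powr: "1 < p \<Longrightarrow> summable (\<lambda>i. A i \<omega> powr p)"
  using nonneg_summable.summable_powr[of "\<lambda>i. A i \<omega>" "p - 1"] A_nonneg A_summable
  by (simp add: nonneg_summable_def)

lemma smoothing_char_diff:
  assumes laws: "nonneg_law \<rho>" "nonneg_law \<rho>'" and p: "1 < p" "p < \<alpha>"
    and \<kappa>: "\<And>s. cmod (char \<rho> s - char \<rho>' s) \<le> \<kappa> * \<bar>s\<bar> powr p"
  shows "cmod (char (smoothing \<rho>) t - char (smoothing \<rho>') t) \<le> \<kappa> * enn2real (power_sum p) * \<bar>t\<bar> powr p"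
proof -
  interpret l1: weights_law M A \<alpha> \<rho> by (rule weights_lawI[OF laws(1)])
  interpret l2: weights_law M A \<alpha> \<rho>' by (rule weights_lawI[OF laws(2)])
  have ps: "(\<integral>\<^sup>+\<omega>. ennreal (\<Sum>i. A i \<omega> powr p) \<partial>M) = power_sum p"
    unfolding power_sum_def using summable_A_powr[OF p(1)] by (intro nn_integral_cong) (simp add: suminf_ennreal2)
  have fin: "power_sum p < \<infinity>" using power_sum_less_1[OF p] by (simp add: less_trans[OF _ ennreal_one_less_top])
  have int: "integrable M (\<lambda>\<omega>. \<Sum>i. A i \<omega> powr p)"
    by (rule integrableI_nonneg) (use fin ps summable_A_powr[OF p(1)] in \<open>auto intro!: suminf_nonneg\<close>)
  have eq: "(\<integral>\<omega>. (\<Sum>i. A i \<omega> powr p) \<partial>M) = enn2real (power_sum p)"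
    using summable_A_powr[OF p(1)] by (subst integral_eq_nn_integral) (auto simp: ps intro!: suminf_nonneg)
  have "cmod (char (smoothing \<rho>) t - char (smoothing \<rho>') t) = cmod (CLINT \<omega>|M.
     ((CLINT r|l1.law.P. iexp (t * (\<Sum>i. A i \<omega> * r i))) - (CLINT r|l2.law.P. iexp (t * (\<Sum>i. A i \<omega> * r i)))))"
    unfolding l1.char_smoothing l2.char_smoothing
    by (subst Bochner_Integration.integral_diff[OF l1.integrable_char_smoothing l2.integrable_char_smoothing]) simp
  also have "\<dots> \<le> (\<integral>\<omega>. cmod ((CLINT r|l1.law.P. iexp (t * (\<Sum>i. A i \<omega> * r i))) -
      (CLINT r|l2.law.P. iexp (t * (\<Sum>i. A i \<omega> * r i)))) \<partial>M)"
    by (rule integral_norm_bound)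
  also have "\<dots> \<le> (\<integral>\<omega>. \<kappa> * \<bar>t\<bar> powr p * (\<Sum>i. A i \<omega> powr p) \<partial>M)"
  proof (rule integral_mono)
    show "integrable M (\<lambda>\<omega>. \<kappa> * \<bar>t\<bar> powr p * (\<Sum>i. A i \<omega> powr p))" using int by auto
    show "integrable M (\<lambda>\<omega>. cmod ((CLINT r|l1.law.P. iexp (t * (\<Sum>i. A i \<omega> * r i))) -
        (CLINT r|l2.law.P. iexp (t * (\<Sum>i. A i \<omega> * r i)))))"
      by (intro integrable_norm Bochner_Integration.integrable_diff l1.integrable_char_smoothing l2.integrable_char_smoothing)
  qed (intro cmod_iexp_sum_diff_le laws A_nonneg A_summable summable_A_powr p \<kappa>)
  also have "\<dots> = \<kappa> * enn2real (power_sum p) * \<bar>t\<bar> powr p" by (simp add: eq)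
  finally show ?thesis .
qed

lemma power_sum_real:
  assumes "1 < \<beta>" "\<beta> < \<alpha>"
  shows "power_sum \<beta> = ennreal (enn2real (power_sum \<beta>))" "enn2real (power_sum \<beta>) < 1"
  using power_sum_less_1[OF assms] by (cases "power_sum \<beta>"; simp add: ennreal_less_one_iff)+

section \<open>Iterates of the smoothing transform\<close>

primrec iterate_law :: "nat \<Rightarrow> real measure" where
  "iterate_law 0 = return borel 1"
| "iterate_law (Suc n) = smoothing (iterate_law n)"

lemma nonneg_law_return: "nonneg_law (return borel 1)"
  unfolding nonneg_law_def nonneg_law_axioms_def
  by (auto simp: prob_space_return AE_return intro!: integrableI_bounded simp: nn_integral_return)

lemma nonneg_law_iterate: "nonneg_law (iterate_law n)"
  by (induction n) (auto simp: nonneg_law_return intro: weights_law.nonneg_law_smoothing weights_lawI)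

lemma moment_iterate_1: "moment (iterate_law n) 1 = 1"
  by (induction n)
    (auto simp: moment_def[of "return borel 1"] nn_integral_return
      weights_law.moment_smoothing_1[OF weights_lawI[OF nonneg_law_iterate]])

text \<open>Induction on the exponent: the recursion for order \<beta> adds a term of order max
  (\<beta> - 1) 1, already bounded uniformly in \<open>n\<close>. The number \<open>k\<close> counts
  the unit steps down to order 1.\<close>

lemma moment_iterate_bounded:
  "1 \<le> \<beta> \<Longrightarrow> \<beta> < \<alpha> \<Longrightarrow> \<beta> \<le> real k + 1 \<Longrightarrow> \<exists>B\<ge>0. \<forall>n. moment (iterate_law n) \<beta> \<le> ennreal B"
proof (induction k arbitrary: \<beta>)
  case 0
  then have "\<beta> = 1" by simp
  then show ?case by (intro exI[of _ 1]) (simp add: moment_iterate_1)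
next
  case (Suc k)
  show ?case
  proof (cases "\<beta> = 1")
    case True
    then show ?thesis by (intro exI[of _ 1]) (simp add: moment_iterate_1)
  next
    case False
    define b where "b = \<beta> - 1"
    have b: "b > 0" "\<beta> = b + 1" using False Suc.prems by (auto simp: b_def)
    have "1 \<le> max b 1" "max b 1 < \<alpha>" "max b 1 \<le> real k + 1" using Suc.prems b \<alpha>_gt_1 by auto
    from Suc.IH[OF this] obtain B' where B': "B' \<ge> 0" "\<And>n. moment (iterate_law n) (max b 1) \<le> ennreal B'"
      by blast
    define q where "q = enn2real (power_sum \<beta>)"
    have q: "power_sum \<beta> = ennreal q" "q < 1" "q \<ge> 0"
      using power_sum_real[of \<beta>] Suc.prems False by (auto simp: q_def)
    define s where "s = enn2real (\<integral>\<^sup>+\<omega>. ennreal (A_sum \<omega> powr \<beta>) \<partial>M)"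
    have s: "(\<integral>\<^sup>+\<omega>. ennreal (A_sum \<omega> powr \<beta>) \<partial>M) = ennreal s" "s \<ge> 0"
      using nn_integral_A_sum_powr_finite[of \<beta>] Suc.prems by (auto simp: s_def)
    define Kc where "Kc = (b + 1) * 2 powr b * (s * (1 + B'))"
    have Kc: "Kc \<ge> 0" unfolding Kc_def using b s B' by auto
    \<comment> \<open>A level that is not exceeded under multiplication by \<open>q\<close> and
      addition of \<open>Kc\<close>; the summand 1 makes it at least 1, the moment of the initial
      point mass.\<close>
    define B where "B = (1 + Kc) / (1 - q)"
    have B1: "B \<ge> 1" using q Kc by (simp add: B_def field_simps)
    have B2: "q * B + Kc \<le> B"
    proof -
      have "(1 - q) * B = 1 + Kc" using q by (simp add: B_def)
      then show ?thesis by (simp add: algebra_simps)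
    qed
    have "moment (iterate_law n) \<beta> \<le> ennreal B" for n
    proof (induction n)
      case 0
      then show ?case using B1 by (simp add: moment_def nn_integral_return)
    next
      case (Suc n)
      interpret weights_law M A \<alpha> "iterate_law n" by (rule weights_lawI[OF nonneg_law_iterate])
      have "moment (iterate_law (Suc n)) \<beta> \<le> power_sum \<beta> * moment (iterate_law n) \<beta> +
          ennreal ((b + 1) * 2 powr b) * ((\<integral>\<^sup>+\<omega>. ennreal (A_sum \<omega> powr \<beta>) \<partial>M) * (moment (iterate_law n) 1 * (1 + moment (iterate_law n) (max b 1))))"
        using moment_smoothing_le[OF b(1)] by (simp add: b(2))
      also have "\<dots> \<le> ennreal q * ennreal B + ennreal ((b + 1) * 2 powr b) * (ennreal s * (1 * (1 + ennreal B')))"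
        unfolding q(1) s(1) moment_iterate_1 using Suc B'(2)
        by (intro add_mono mult_left_mono) auto
      also have "\<dots> = ennreal (q * B + Kc)"
        unfolding Kc_def using b s B' q B1 by (simp add: ennreal_mult)
      also have "\<dots> \<le> ennreal B" by (rule ennreal_leI[OF B2])
      finally show ?case .
    qed
    then show ?thesis using B1 by (intro exI[of _ B]) auto
  qed
qed

lemma moment_iterate_bounded':
  assumes "1 \<le> \<beta>" "\<beta> < \<alpha>"
  obtains B where "B \<ge> 0" "\<And>n. moment (iterate_law n) \<beta> \<le> ennreal B"
proof -
  obtain k :: nat where "\<beta> \<le> real k" using real_arch_simple by blast
  then show ?thesis using moment_iterate_bounded[of \<beta> k] assms that by force
qed

lemma tight_iterate: "tight iterate_law"
  unfolding tight_def
proof (intro conjI allI impI)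
  show "real_distribution (iterate_law n)" for n
    by (rule nonneg_law.real_distribution[OF nonneg_law_iterate])
  fix \<epsilon> :: real assume "\<epsilon> > 0"
  define B where "B = 2 / \<epsilon>"
  have B: "B > 0" using \<open>\<epsilon> > 0\<close> by (simp add: B_def)
  have "measure (iterate_law n) {-1<..B} > 1 - \<epsilon>" for n
  proof -
    interpret L: nonneg_law "iterate_law n" by (rule nonneg_law_iterate)
    have mean: "(\<integral>x. x \<partial>iterate_law n) = 1" using moment_iterate_1[of n] L.moment_1 by (simp add: ennreal_eq_1)
    have "L.prob {x \<in> space (iterate_law n). B \<le> x} \<le> (\<integral>x. x \<partial>iterate_law n) / B"
      by (rule integral_Markov_inequality_measure[OF L.integrable_id _ L.nonneg B]) (rule sets.top)
    then have "L.prob {B..} \<le> \<epsilon> / 2" by (simp add: mean B_def atLeast_def)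
    moreover have "L.prob (space (iterate_law n) - {-1<..B}) \<le> L.prob {B..}"
      using L.nonneg by (intro L.finite_measure_mono_AE) (auto simp: L.sets_\<rho> elim!: eventually_mono)
    moreover have "L.prob (space (iterate_law n) - {-1<..B}) = 1 - L.prob {-1<..B}"
      by (rule L.prob_compl) (simp add: L.sets_\<rho>)
    ultimately show ?thesis using \<open>\<epsilon> > 0\<close> by linarith
  qed
  then show "\<exists>a b. a < b \<and> (\<forall>n. measure (iterate_law n) {a<..b} > 1 - \<epsilon>)"
    using B by (intro exI[of _ "-1"] exI[of _ B]) auto
qed

text \<open>Skorohod's representation turns weak convergence into pointwise convergence, and Fatou's
  lemma bounds the moments of the limit. This yields upper bounds only, so positivity of the mean is
  argued separately.\<close>

lemma moment_weak_limit_le: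
  assumes "real_distribution \<rho>" "weak_conv_m (\<lambda>n. iterate_law (r n)) \<rho>"
  shows "AE x in \<rho>. 0 \<le> x"
    and "\<beta> > 0 \<Longrightarrow> (\<And>n. moment (iterate_law n) \<beta> \<le> B) \<Longrightarrow> moment \<rho> \<beta> \<le> B"
proof -
  have "\<exists>(W :: real measure) (Y :: nat \<Rightarrow> real \<Rightarrow> real) (Z :: real \<Rightarrow> real).
    prob_space W \<and> (\<forall>n. Y n \<in> measurable W borel) \<and> (\<forall>n. distr W borel (Y n) = iterate_law (r n)) \<and>
    Z \<in> measurable W lborel \<and> distr W borel Z = \<rho> \<and> (\<forall>x \<in> space W. (\<lambda>n. Y n x) \<longlonglongrightarrow> Z x)"
    by (rule Skorohod[OF nonneg_law.real_distribution[OF nonneg_law_iterate] assms])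
  then obtain W :: "real measure" and Y :: "nat \<Rightarrow> real \<Rightarrow> real" and Z :: "real \<Rightarrow> real"
    where meas: "\<forall>n. Y n \<in> borel_measurable W" "Z \<in> measurable W lborel"
    and Yd': "\<forall>n. distr W borel (Y n) = iterate_law (r n)" and Zd: "distr W borel Z = \<rho>"
    and lim': "\<forall>x\<in>space W. (\<lambda>n. Y n x) \<longlonglongrightarrow> Z x" by blast
  note Yd = Yd'[rule_format] and lim = lim'[rule_format]
  have [measurable]: "Y n \<in> borel_measurable W" "Z \<in> borel_measurable W" for n using meas by auto
  have "AE x in W. 0 \<le> Y n x" for n
  proof -
    have "AE x in distr W borel (Y n). 0 \<le> x" unfolding Yd by (rule nonneg_law.nonneg[OF nonneg_law_iterate])
    then show ?thesis by (subst (asm) AE_distr_iff) auto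
  qed
  then have Y0: "AE x in W. \<forall>n. 0 \<le> Y n x" by (simp add: AE_all_countable)
  have "AE x in W. 0 \<le> Z x"
    using Y0 AE_space by eventually_elim (use lim LIMSEQ_le_const in blast)
  then show "AE x in \<rho>. 0 \<le> x" unfolding Zd[symmetric] by (subst AE_distr_iff) auto
  assume \<beta>: "\<beta> > 0" and B: "\<And>n. moment (iterate_law n) \<beta> \<le> B"
  have "moment \<rho> \<beta> = (\<integral>\<^sup>+x. ennreal (Z x powr \<beta>) \<partial>W)"
    unfolding Zd[symmetric] moment_def by (subst nn_integral_distr) auto
  also have "\<dots> = (\<integral>\<^sup>+x. liminf (\<lambda>n. ennreal (Y n x powr \<beta>)) \<partial>W)"
  proof (rule nn_integral_cong_AE, use Y0 AE_space in eventually_elim)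
    case (elim x)
    have "(\<lambda>n. Y n x powr \<beta>) \<longlonglongrightarrow> Z x powr \<beta>"
      using elim \<beta> by (intro tendsto_powr' lim tendsto_const) auto
    then have "(\<lambda>n. ennreal (Y n x powr \<beta>)) \<longlonglongrightarrow> ennreal (Z x powr \<beta>)" by (rule tendsto_ennrealI)
    then show ?case by (intro lim_imp_Liminf[symmetric]) auto
  qed
  also have "\<dots> \<le> liminf (\<lambda>n. \<integral>\<^sup>+x. ennreal (Y n x powr \<beta>) \<partial>W)"
    by (rule nn_integral_liminf) measurable
  also have "(\<lambda>n. \<integral>\<^sup>+x. ennreal (Y n x powr \<beta>) \<partial>W) = (\<lambda>n. moment (iterate_law (r n)) \<beta>)"
    unfolding Yd[symmetric] moment_def by (subst nn_integral_distr) auto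
  also have "liminf (\<lambda>n. moment (iterate_law (r n)) \<beta>) \<le> liminf (\<lambda>n. B)"
    by (rule Liminf_mono) (simp add: B)
  also have "\<dots> = B" by (rule Liminf_const) simp
  finally show "moment \<rho> \<beta> \<le> B" .
qed

theorem exists_fixed_law:
  obtains \<rho> where "nonneg_law \<rho>" "smoothing \<rho> = \<rho>" "(\<integral>x. x \<partial>\<rho>) > 0"
    "\<And>\<beta>. 1 \<le> \<beta> \<Longrightarrow> \<beta> < \<alpha> \<Longrightarrow> moment \<rho> \<beta> < \<top>"
proof -
  \<comment> \<open>The midpoint of 1 and min \<alpha> 2: 1 < p < \<alpha> makes the contraction
    factor less than 1, and p \<le> 2 allows the remainder bound for characteristic
    functions.\<close>
  define p where "p = (1 + min \<alpha> 2) / 2"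
  have p: "1 < p" "p < \<alpha>" "p \<le> 2" using \<alpha>_gt_1 by (auto simp: p_def)
  obtain B where B: "B \<ge> 0" "\<And>n. moment (iterate_law n) p \<le> ennreal B"
    using moment_iterate_bounded'[of p] p by auto
  define q where "q = enn2real (power_sum p)"
  have q: "0 \<le> q" "q < 1" using power_sum_real[OF p(1,2)] by (auto simp: q_def)
  \<comment> \<open>Twice the constant 2 B, since two laws are each compared with 1 + i s.\<close>
  define c where "c = 4 * B"
  have lin: "cmod (char (iterate_law n) t - (1 + \<i> * t)) \<le> 2 * B * \<bar>t\<bar> powr p" for n t
    using nonneg_law.char_linear_le[OF nonneg_law_iterate moment_iterate_1 _ p(3) B(2,1)] p(1) by simp
  have step: "cmod (char (iterate_law n) s - char (iterate_law (Suc n)) s) \<le> c * q ^ n * \<bar>s\<bar> powr p" for n s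
  proof (induction n arbitrary: s)
    case 0
    have "cmod (char (iterate_law 0) s - char (iterate_law 1) s)
      \<le> cmod (char (iterate_law 0) s - (1 + \<i> * s)) + cmod (char (iterate_law 1) s - (1 + \<i> * s))"
      by (metis norm_triangle_ineq4 diff_diff_eq2 diff_add_cancel add_diff_eq)
    also have "\<dots> \<le> 2 * B * \<bar>s\<bar> powr p + 2 * B * \<bar>s\<bar> powr p" by (intro add_mono lin)
    finally show ?case by (simp add: c_def)
  next
    case (Suc n)
    show ?case
      using smoothing_char_diff[OF nonneg_law_iterate nonneg_law_iterate p(1,2) Suc.IH, of s]
      by (simp add: q_def mult.assoc mult.left_commute)
  qed
  \<comment> \<open>The factor \<open>1 - q ^ k\<close> comes from the closed form of the geometric
    sum of \<open>k\<close> steps, so that the induction closes exactly.\<close>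
  have tele: "cmod (char (iterate_law m) s - char (iterate_law (m + k)) s) \<le> c * q ^ m / (1 - q) * (1 - q ^ k) * \<bar>s\<bar> powr p" for m k s
  proof (induction k)
    case (Suc k)
    have "cmod (char (iterate_law m) s - char (iterate_law (m + Suc k)) s) \<le>
        cmod (char (iterate_law m) s - char (iterate_law (m + k)) s) + cmod (char (iterate_law (m + k)) s - char (iterate_law (Suc (m + k))) s)"
      using norm_triangle_ineq[of "char (iterate_law m) s - char (iterate_law (m + k)) s" "char (iterate_law (m + k)) s - char (iterate_law (Suc (m + k))) s"]
      by simp
    also have "\<dots> \<le> c * q ^ m / (1 - q) * (1 - q ^ k) * \<bar>s\<bar> powr p + c * q ^ (m + k) * \<bar>s\<bar> powr p"
      by (intro add_mono Suc step)
    also have "\<dots> = c * q ^ m / (1 - q) * (1 - q ^ Suc k) * \<bar>s\<bar> powr p"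
      using q by (simp add: field_simps power_add)
    finally show ?case .
  qed simp
  have tail: "cmod (char (iterate_law m) s - char (iterate_law n) s) \<le> c * q ^ m / (1 - q) * \<bar>s\<bar> powr p" if "n \<ge> m" for m n s
  proof -
    have "c * q ^ m / (1 - q) * (1 - q ^ (n - m)) * \<bar>s\<bar> powr p \<le> c * q ^ m / (1 - q) * 1 * \<bar>s\<bar> powr p"
      using q B by (intro mult_right_mono mult_left_mono) (auto simp: c_def)
    then show ?thesis using tele[of m s "n - m"] that by simp
  qed
  \<comment> \<open>Tightness yields a limit along a subsequence only; the geometric bound
    \<open>tail\<close> then makes the whole sequence of characteristic functions converge to the
    same limit.\<close>
  obtain r \<rho> where r: "strict_mono (r::nat\<Rightarrow>nat)" and \<rho>: "real_distribution \<rho>" and weak: "weak_conv_m (\<lambda>n. iterate_law (r n)) \<rho>"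
    using tight_imp_convergent_subsubsequence[OF tight_iterate strict_mono_id] by (auto simp: o_def)
  have char_lim: "(\<lambda>n. char (iterate_law (r n)) t) \<longlonglongrightarrow> char \<rho> t" for t
    by (rule levy_continuity1[OF nonneg_law.real_distribution[OF nonneg_law_iterate] \<rho> weak])
  have close: "cmod (char (iterate_law m) s - char \<rho> s) \<le> c * q ^ m / (1 - q) * \<bar>s\<bar> powr p" for m s
  proof (rule LIMSEQ_le_const2)
    show "(\<lambda>n. cmod (char (iterate_law m) s - char (iterate_law (r n)) s)) \<longlonglongrightarrow> cmod (char (iterate_law m) s - char \<rho> s)"
      by (intro tendsto_norm tendsto_diff tendsto_const char_lim)
    show "\<exists>N. \<forall>n\<ge>N. cmod (char (iterate_law m) s - char (iterate_law (r n)) s) \<le> c * q ^ m / (1 - q) * \<bar>s\<bar> powr p"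
      by (intro exI[of _ m] allI impI tail) (use seq_suble[OF r] order_trans in blast)
  qed
  have char_all: "(\<lambda>m. char (iterate_law m) t) \<longlonglongrightarrow> char \<rho> t" for t
  proof -
    have "(\<lambda>m. c / (1 - q) * \<bar>t\<bar> powr p * q ^ m) \<longlonglongrightarrow> 0"
      using q by (intro tendsto_mult_right_zero LIMSEQ_realpow_zero) auto
    then have "(\<lambda>m. char (iterate_law m) t - char \<rho> t) \<longlonglongrightarrow> 0"
      by (rule Lim_null_comparison[rotated]) (use close[of _ t] in \<open>simp add: mult_ac\<close>)
    then show ?thesis by (simp add: LIM_zero_iff)
  qed
  have mom: "moment \<rho> \<beta> < \<top>" if \<beta>: "1 \<le> \<beta>" "\<beta> < \<alpha>" for \<beta>
  proof -
    obtain B' where "\<And>n. moment (iterate_law n) \<beta> \<le> ennreal B'" using moment_iterate_bounded'[OF \<beta>] by blast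
    then have "moment \<rho> \<beta> \<le> ennreal B'" using moment_weak_limit_le(2)[OF \<rho> weak] \<beta> by simp
    then show ?thesis by (simp add: le_less_trans[OF _ ennreal_less_top])
  qed
  interpret R: real_distribution \<rho> by (rule \<rho>)
  have nn: "AE x in \<rho>. 0 \<le> x" by (rule moment_weak_limit_le(1)[OF \<rho> weak])
  have int: "integrable \<rho> (\<lambda>x. x)"
  proof (rule integrableI_nonneg)
    have "(\<integral>\<^sup>+x. ennreal x \<partial>\<rho>) = moment \<rho> 1"
      unfolding moment_def by (rule nn_integral_cong_AE, use nn in eventually_elim) simp
    then show "(\<integral>\<^sup>+x. ennreal x \<partial>\<rho>) < \<infinity>" using mom[of 1] \<alpha>_gt_1 by simp
  qed (use nn in auto)
  have law: "nonneg_law \<rho>"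
    unfolding nonneg_law_def nonneg_law_axioms_def using nn int R.prob_space_axioms by simp
  have "char (smoothing \<rho>) t = char \<rho> t" for t
  proof -
    have bd: "cmod (char (iterate_law (Suc m)) t - char (smoothing \<rho>) t) \<le> c / (1 - q) * q * \<bar>t\<bar> powr p * q ^ m" for m
      using smoothing_char_diff[OF nonneg_law_iterate law p(1,2) close, of m t]
      by (simp add: q_def mult_ac)
    have "(\<lambda>m. c / (1 - q) * q * \<bar>t\<bar> powr p * q ^ m) \<longlonglongrightarrow> 0"
      using q by (intro tendsto_mult_right_zero LIMSEQ_realpow_zero) auto
    then have "(\<lambda>m. char (iterate_law (Suc m)) t - char (smoothing \<rho>) t) \<longlonglongrightarrow> 0"
      by (rule Lim_null_comparison[rotated]) (simp only: bd eventually_True)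
    then have "(\<lambda>m. char (iterate_law (Suc m)) t) \<longlonglongrightarrow> char (smoothing \<rho>) t" by (simp add: LIM_zero_iff)
    moreover have "(\<lambda>m. char (iterate_law (Suc m)) t) \<longlonglongrightarrow> char \<rho> t" using char_all by (rule LIMSEQ_Suc)
    ultimately show ?thesis by (rule LIMSEQ_unique)
  qed
  then have "smoothing \<rho> = \<rho>"
    using weights_law.nonneg_law_smoothing[OF weights_lawI[OF law]]
    by (intro Levy_uniqueness \<rho>) (auto intro: nonneg_law.real_distribution)
  \<comment> \<open>With mean 0 the law would be the point mass at 0, whose characteristic function
    is 1. The distance bound to 1 + i t survives the limit and would give |t| \<le> 2 B |t|^p, which
    fails for small t.\<close>
  moreover have "(\<integral>x. x \<partial>\<rho>) > 0"
  proof (rule ccontr)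
    assume "\<not> (\<integral>x. x \<partial>\<rho>) > 0"
    then have "(\<integral>x. x \<partial>\<rho>) = 0" using integral_nonneg_AE[OF nn] by linarith
    then have ae: "AE x in \<rho>. x = 0" using integral_nonneg_eq_0_iff_AE[OF int nn] by simp
    have c1: "char \<rho> t = 1" for t
    proof -
      have "char \<rho> t = (CLINT x|\<rho>. 1)"
        unfolding char_def by (rule integral_cong_AE) (use ae in \<open>auto elim!: eventually_mono\<close>)
      then show ?thesis using R.prob_space by simp
    qed
    have linlim: "cmod (char \<rho> t - (1 + \<i> * t)) \<le> 2 * B * \<bar>t\<bar> powr p" for t
      by (rule LIMSEQ_le_const2[OF tendsto_norm[OF tendsto_diff[OF char_all tendsto_const]]]) (use lin in auto)
    \<comment> \<open>Chosen so that 2 B t^(p - 1) = 2 B / (2 B + 2) < 1; the summand 2 avoids a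
      zero denominator when B = 0.\<close>
    define t where "t = (1 / (2 * B + 2)) powr (1 / (p - 1))"
    have t: "t > 0" using B(1) by (simp add: t_def)
    have "t powr (p - 1) = 1 / (2 * B + 2)" using p B(1) by (simp add: t_def powr_powr)
    moreover have "t powr p = t * t powr (p - 1)" using powr_add_one[of t "p - 1"] t by simp
    moreover have "t \<le> 2 * B * t powr p" using linlim[of t] t by (simp add: c1 norm_mult)
    ultimately have "t \<le> t * (2 * B / (2 * B + 2))" by (simp add: mult_ac)
    also have "\<dots> < t * 1" using t B(1) by (intro mult_strict_left_mono) (auto simp: field_simps)
    finally show False by simp
  qed
  ultimately show ?thesis using that law mom by blast
qed

end

section \<open>Tail asymptotics of the fixed law\<close>

text \<open>
  For \<open>h y = y * w y\<close> with \<open>w\<close> nondecreasing, every term satisfies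
  \<open>h (x i) \<le> x i * w S\<close>, which sums to \<open>h S\<close>.
\<close>

lemma (in nonneg_summable) star_shaped_superadditive:
  assumes h0: "h 0 = 0" and h_nonneg: "\<And>y. 0 \<le> y \<Longrightarrow> 0 \<le> h y"
    and star: "\<And>y. 0 < y \<Longrightarrow> y \<le> S \<Longrightarrow> h y / y \<le> h S / S"
  shows "summable (\<lambda>i. h (x i))" "(\<Sum>i. h (x i)) \<le> h S"
proof -
  have le: "h (x i) \<le> x i * (h S / S)" for i
  proof (cases "x i = 0")
    case False
    then have "x i > 0" using nonneg[of i] by simp
    then show ?thesis using star[of "x i"] le_S[of i] by (simp add: divide_le_eq mult.commute)
  qed (simp add: h0)
  show s: "summable (\<lambda>i. h (x i))"
    by (rule summable_comparison_test'[of "\<lambda>i. x i * (h S / S)" 0])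
      (use le h_nonneg nonneg in \<open>auto intro!: summable_mult2 summable\<close>)
  have "(\<Sum>i. h (x i)) \<le> (\<Sum>i. x i * (h S / S))"
    by (rule suminf_le[OF le s]) (intro summable_mult2 summable)
  also have "\<dots> = S * (h S / S)" by (rule suminf_mult2[symmetric, OF summable])
  also have "\<dots> = h S" using h0 by (cases "S = 0") auto
  finally show "(\<Sum>i. h (x i)) \<le> h S" .
qed

section \<open>Excess over a level and its superadditivity\<close>

definition excess :: "real \<Rightarrow> real \<Rightarrow> real" where "excess v y = max (y - v) 0"

lemma excess_measurable[measurable]:
  "f \<in> borel_measurable M \<Longrightarrow> g \<in> borel_measurable M \<Longrightarrow> (\<lambda>z. excess (f z) (g z)) \<in> borel_measurable M"
  unfolding excess_def by measurable

lemma excess_nonneg: "0 \<le> excess v y" by (simp add: excess_def)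

lemma excess_le: "0 \<le> v \<Longrightarrow> 0 \<le> y \<Longrightarrow> excess v y \<le> y" by (simp add: excess_def)

lemma excess_antimono: "v \<le> v' \<Longrightarrow> excess v' y \<le> excess v y" by (simp add: excess_def)

lemma excess_scale: "c > 0 \<Longrightarrow> excess (c * v) (c * y) = c * excess v y"
  by (auto simp: excess_def max_def mult_le_0_iff simp flip: right_diff_distrib)

context nonneg_summable
begin

definition gap :: "real \<Rightarrow> real" where "gap v = excess v S - (\<Sum>i. excess v (x i))"

text \<open>The slope \<open>excess v y / y\<close> is max (1 - v / y) 0, which is nondecreasing in
  \<open>y\<close>.\<close>

lemma summable_excess: "v > 0 \<Longrightarrow> summable (\<lambda>i. excess v (x i))"
  and gap_nonneg: "v > 0 \<Longrightarrow> 0 \<le> gap v"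
proof -
  assume v: "v > 0"
  have star: "excess v y / y \<le> excess v S / S" if y: "0 < y" "y \<le> S" for y
  proof -
    have "excess v y / y = max (1 - v / y) 0" if "y > 0" for y
      using that by (simp add: excess_def max_def field_simps)
    moreover have "v / S \<le> v / y" using y v by (intro divide_left_mono) auto
    ultimately show ?thesis using y by simp
  qed
  show "summable (\<lambda>i. excess v (x i))" "0 \<le> gap v"
    using star_shaped_superadditive[of "excess v"] star v by (auto simp: gap_def excess_nonneg) (simp_all add: excess_def)
qed

text \<open>Superadditivity is applied to \<open>excess v y / v - excess v' y / v'\<close>. Its
  slope at \<open>y\<close> is the length of the part of [1 / v', 1 / v] to the right of 1 / y,
  hence nondecreasing in \<open>y\<close>.\<close>

lemma gap_scaled_antimono:
  assumes v: "0 < v" "v \<le> v'"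
  shows "gap v' / v' \<le> gap v / v"
proof -
  let ?h = "\<lambda>y. excess v y / v - excess v' y / v'"
  have eq: "excess u y / u = y * max (1 / u - 1 / y) 0" if "u > 0" "y > 0" for u y
    using that by (simp add: excess_def max_def field_simps)
  have star: "?h y / y \<le> ?h S / S" if y: "0 < y" "y \<le> S" for y
  proof -
    have i: "1 / v' \<le> 1 / v" "1 / S \<le> 1 / y" using v y by (auto simp: frac_le)
    have "?h y / y = max (1 / v - 1 / y) 0 - max (1 / v' - 1 / y) 0" if "y > 0" for y
      using v that by (simp add: eq diff_divide_distrib)
    then show ?thesis using y i by simp
  qed
  have h_nonneg: "0 \<le> ?h y" if "0 \<le> y" for y
  proof (cases "y = 0")
    case False
    have "1 / v' \<le> 1 / v" using v by (simp add: frac_le)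
    then have "max (1 / v' - 1 / y) 0 \<le> max (1 / v - 1 / y) 0" by linarith
    then show ?thesis using v that False by (simp add: eq mult_left_mono)
  qed (use v in \<open>simp add: excess_def\<close>)
  have "(\<Sum>i. ?h (x i)) \<le> ?h S"
    using star_shaped_superadditive(2)[of ?h, OF _ h_nonneg star] v by (simp add: excess_def)
  also have "(\<Sum>i. ?h (x i)) = (\<Sum>i. excess v (x i)) / v - (\<Sum>i. excess v' (x i)) / v'"
    using summable_excess v by (subst suminf_diff[symmetric]) (auto simp: suminf_divide intro: summable_divide)
  finally show ?thesis by (simp add: gap_def diff_divide_distrib)
qed

end

lemma nn_integral_excess:
  fixes a y :: real
  assumes a: "a > 0" and y: "y \<ge> 0"
  shows "(\<integral>\<^sup>+t. ennreal (exp (a * t) * excess (exp t) y) \<partial>lborel) = ennreal (y powr (a + 1) / (a * (a + 1)))"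
proof (cases "y = 0")
  case True
  then show ?thesis by (simp add: excess_def max_def)
next
  case False
  then have y0: "y > 0" using y by simp
  \<comment> \<open>The substitution t = ln y - s moves the support to s \<ge> 0 and leaves a
    difference of two pure exponentials.\<close>
  have pw: "exp (a * (ln y - s)) * excess (exp (ln y - s)) y = y powr (a + 1) * (exp (- a * s) - exp (- (a + 1) * s)) * indicator {0..} s"
    for s
  proof -
    have e: "exp (ln y - s) = y * exp (- s)" using y0 by (simp add: exp_diff exp_minus field_simps)
    have ea: "exp (a * (ln y - s)) = y powr a * exp (- a * s)"
      using y0 by (simp add: powr_def right_diff_distrib exp_diff exp_minus field_simps)
    have p: "y powr (a + 1) = y powr a * y" using y0 by (simp add: powr_add)
    show ?thesis
    proof (cases "s \<ge> 0")
      case True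
      then have "y * exp (- s) \<le> y * 1" using y0 by (intro mult_left_mono) auto
      then have ex: "excess (exp (ln y - s)) y = y * (1 - exp (- s))" by (simp add: e excess_def algebra_simps)
      have "exp (- (a + 1) * s) = exp (- a * s) * exp (- s)" by (simp add: algebra_simps flip: exp_add)
      then show ?thesis using True by (simp only: ex ea p) (simp add: algebra_simps)
    next
      case F: False
      then have "y * 1 \<le> y * exp (- s)" using y0 by (intro mult_left_mono) auto
      then have "excess (exp (ln y - s)) y = 0" by (simp add: e excess_def)
      then show ?thesis using F by simp
    qed
  qed
  have "(\<integral>\<^sup>+t. ennreal (exp (a * t) * excess (exp t) y) \<partial>lborel) =
      (\<integral>\<^sup>+s. ennreal (exp (a * (ln y + (-1) * s)) * excess (exp (ln y + (-1) * s)) y) \<partial>lborel)"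
    using nn_integral_real_affine[of "\<lambda>t. ennreal (exp (a * t) * excess (exp t) y)" "-1" "ln y"] by simp
  also have "\<dots> = (\<integral>\<^sup>+s. ennreal (y powr (a + 1) * (exp (- a * s) - exp (- (a + 1) * s))) * indicator {0..} s \<partial>lborel)"
    using pw by (intro nn_integral_cong) (auto simp: indicator_def)
  also have "\<dots> = ennreal (0 - y powr (a + 1) * (- exp (- a * 0) / a + exp (- (a + 1) * 0) / (a + 1)))"
  proof (rule nn_integral_FTC_atLeast)
    show "((\<lambda>s. y powr (a + 1) * (- exp (- a * s) / a + exp (- (a + 1) * s) / (a + 1))) \<longlongrightarrow> 0) at_top"
    proof (rule tendsto_mult_right_zero)
      show "((\<lambda>s. - exp (- a * s) / a + exp (- (a + 1) * s) / (a + 1)) \<longlongrightarrow> 0) at_top"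
      proof -
        have E: "((\<lambda>s. exp (- c * s)) \<longlongrightarrow> 0) at_top" if "c > 0" for c :: real
          using that by real_asymp
        have "((\<lambda>s. - exp (- a * s) / a + exp (- (a + 1) * s) / (a + 1)) \<longlongrightarrow> - 0 / a + 0 / (a + 1)) at_top"
          using a by (intro tendsto_add tendsto_divide tendsto_minus tendsto_const E) auto
        then show ?thesis by simp
      qed
    qed
    show "((\<lambda>s. y powr (a + 1) * (- exp (- a * s) / a + exp (- (a + 1) * s) / (a + 1))) has_real_derivative
        y powr (a + 1) * (exp (- a * s) - exp (- (a + 1) * s))) (at s)" for s
    proof -
      have "((\<lambda>s. - exp (- a * s) / a + exp (- c * s) / c) has_real_derivative exp (- a * s) - exp (- c * s)) (at s)"
        if "c > 0" for c using a that by (auto intro!: derivative_eq_intros)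
      from this[of "a + 1"] show ?thesis using a by (intro DERIV_cmult) simp
    qed
    show "0 \<le> y powr (a + 1) * (exp (- a * s) - exp (- (a + 1) * s))" if "0 \<le> s" for s
    proof -
      have "- (a + 1) * s \<le> - a * s" using that by (simp add: algebra_simps)
      then have "exp (- (a + 1) * s) \<le> exp (- a * s)" by (simp only: exp_le_cancel_iff)
      then show ?thesis by (intro mult_nonneg_nonneg) auto
    qed
  qed auto
  also have "0 - y powr (a + 1) * (- exp (- a * 0) / a + exp (- (a + 1) * 0) / (a + 1)) = y powr (a + 1) / (a * (a + 1))"
    using a by (simp add: field_simps)
  finally show ?thesis .
qed

text \<open>The difference quotients of \<open>h\<close> over \<open>[v / l, v]\<close> and \<open>[v, l v]\<close> squeeze \<open>T v\<close>; then let \<open>l \<rightarrow> 1\<close>.\<close>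

lemma monotone_density:
  fixes h T :: "real \<Rightarrow> real"
  assumes a: "a > 0" and lim: "((\<lambda>v. v powr a * h v) \<longlongrightarrow> L) at_top"
    and lower: "\<And>v v'. 0 < v \<Longrightarrow> v \<le> v' \<Longrightarrow> (v' - v) * T v' \<le> h v - h v'"
    and upper: "\<And>v v'. 0 < v \<Longrightarrow> v \<le> v' \<Longrightarrow> h v - h v' \<le> (v' - v) * T v"
  shows "((\<lambda>v. v powr (a + 1) * T v) \<longlongrightarrow> a * L) at_top"
proof -
  define R where "R l v = v powr a * (h v - h (l * v)) / (l - 1)" for l v
  have R_lim: "(R l \<longlongrightarrow> L * (1 - l powr (- a)) / (l - 1)) at_top" if "l > 1" for l
  proof -
    have "filterlim (\<lambda>v. l * v) at_top at_top" using that by (intro filterlim_tendsto_pos_mult_at_top[OF tendsto_const]) (auto intro: filterlim_ident)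
    from filterlim_compose[OF lim this]
    have "((\<lambda>v. (l * v) powr a * h (l * v)) \<longlongrightarrow> L) at_top" .
    then have lim': "((\<lambda>v. (v powr a * h v - l powr (- a) * ((l * v) powr a * h (l * v))) / (l - 1)) \<longlongrightarrow> (L - l powr (- a) * L) / (l - 1)) at_top"
      using that by (intro tendsto_divide tendsto_diff tendsto_mult tendsto_const lim) auto
    have eq: "(v powr a * h v - l powr (- a) * ((l * v) powr a * h (l * v))) / (l - 1) = R l v" if "v > 0" for v
    proof -
      have "l powr (- a) * (l * v) powr a = v powr a"
        using \<open>l > 1\<close> that by (simp add: powr_mult powr_minus field_simps)
      then show ?thesis by (simp add: R_def right_diff_distrib mult.assoc[symmetric])
    qed
    have "\<forall>\<^sub>F v in at_top. (v powr a * h v - l powr (- a) * ((l * v) powr a * h (l * v))) / (l - 1) = R l v"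
      using eventually_gt_at_top[of 0] by eventually_elim (rule eq)
    with lim' have "(R l \<longlongrightarrow> (L - l powr (- a) * L) / (l - 1)) at_top" by (rule Lim_transform_eventually)
    then show ?thesis by (simp add: algebra_simps)
  qed
  have R_le: "R l v \<le> v powr (a + 1) * T v" if "l > 1" "v > 0" for l v
  proof -
    have "h v - h (l * v) \<le> (l * v - v) * T v" using upper[of v "l * v"] that by simp
    then have "v powr a * (h v - h (l * v)) \<le> v powr a * ((l * v - v) * T v)" by (intro mult_left_mono) auto
    also have "\<dots> = (l - 1) * (v powr (a + 1) * T v)" using that by (simp add: powr_add algebra_simps)
    finally show ?thesis using that by (simp add: R_def pos_divide_le_eq mult.commute)
  qed
  have le_R: "v powr (a + 1) * T v \<le> l powr (a + 1) * R l (v / l)" if "l > 1" "v > 0" for l v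
  proof -
    have vl: "v / l > 0" "v / l \<le> v" using that by (auto simp: field_simps)
    have "(v - v / l) * T v \<le> h (v / l) - h v" by (rule lower[OF vl])
    then have m: "(v / l) powr a * ((v - v / l) * T v) \<le> (v / l) powr a * (h (v / l) - h v)" by (intro mult_left_mono) auto
    have eq: "(v / l) powr a * ((v - v / l) * T v) = (l - 1) * ((v / l) powr (a + 1) * T v)"
      using that by (simp add: powr_add field_simps)
    have gen: "x \<le> z / (l - 1)" if "(l - 1) * x \<le> z" for x z
      using that \<open>l > 1\<close> by (simp add: pos_le_divide_eq mult.commute)
    have "R l (v / l) = (v / l) powr a * (h (v / l) - h v) / (l - 1)" using that by (simp add: R_def)
    then have "(v / l) powr (a + 1) * T v \<le> R l (v / l)" using gen[OF m[unfolded eq]] by (simp only:)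
    then have "l powr (a + 1) * ((v / l) powr (a + 1) * T v) \<le> l powr (a + 1) * R l (v / l)" by (intro mult_left_mono) auto
    then show ?thesis using that by (simp add: powr_divide)
  qed
  \<comment> \<open>Both squeezing bounds have the same limit as l decreases to 1: \<open>L\<close>
    times minus the derivative of l^(-a) at 1.\<close>
  have c1: "((\<lambda>l. L * (1 - l powr (- a)) / (l - 1)) \<longlongrightarrow> a * L) (at_right 1)"
    using a by real_asymp
  have c2: "((\<lambda>l. l powr (a + 1) * (L * (1 - l powr (- a)) / (l - 1))) \<longlongrightarrow> a * L) (at_right 1)"
    using a by real_asymp
  show ?thesis
  proof (rule order_tendstoI)
    fix y assume "y < a * L"
    from order_tendstoD(1)[OF c1 this] obtain l where l: "l > 1" "y < L * (1 - l powr (- a)) / (l - 1)"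
      using eventually_happens'[of "at_right (1::real)"] eventually_at_right_less[of "1::real"]
      by (metis (mono_tags, lifting) eventually_conj trivial_limit_at_right_real)
    from order_tendstoD(1)[OF R_lim[OF l(1)] l(2)] eventually_gt_at_top[of "0::real"]
    show "\<forall>\<^sub>F v in at_top. y < v powr (a + 1) * T v"
      by eventually_elim (use R_le[OF l(1)] less_le_trans in blast)
  next
    fix y assume "a * L < y"
    from order_tendstoD(2)[OF c2 this] obtain l where l: "l > 1" "l powr (a + 1) * (L * (1 - l powr (- a)) / (l - 1)) < y"
      using eventually_happens'[of "at_right (1::real)"] eventually_at_right_less[of "1::real"]
      by (metis (mono_tags, lifting) eventually_conj trivial_limit_at_right_real)
    have "filterlim (\<lambda>v. v / l) at_top at_top" using l by real_asymp
    from tendsto_mult[OF tendsto_const filterlim_compose[OF R_lim[OF l(1)] this]]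
    have "((\<lambda>v. l powr (a + 1) * R l (v / l)) \<longlongrightarrow> l powr (a + 1) * (L * (1 - l powr (- a)) / (l - 1))) at_top" .
    from order_tendstoD(2)[OF this l(2)] eventually_gt_at_top[of "0::real"]
    show "\<forall>\<^sub>F v in at_top. v powr (a + 1) * T v < y"
      by eventually_elim (use le_R[OF l(1)] le_less_trans in blast)
  qed
qed

context nonneg_summable
begin

text \<open>The excess of \<open>S\<close> is the gap plus the excesses of the terms. All parts are
  nonnegative, so integral and series may be exchanged, and the finite sum of powers is subtracted
  only at the end.\<close>

lemma nn_integral_gap:
  "(\<integral>\<^sup>+t. ennreal (exp (b * t) * gap (exp t)) \<partial>lborel) =
    ennreal ((S powr (b + 1) - (\<Sum>i. x i powr (b + 1))) / (b * (b + 1)))"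
proof -
  let ?c = "b * (b + 1)"
  have c: "?c > 0" using b_pos by simp
  let ?e = "\<lambda>t y. ennreal (exp (b * t) * excess (exp t) y)"
  have [measurable]: "(\<lambda>t. gap (exp t)) \<in> borel_measurable borel" unfolding gap_def by measurable
  have "?e t S = ennreal (exp (b * t) * gap (exp t)) + (\<Sum>i. ?e t (x i))" for t
  proof -
    have s: "summable (\<lambda>i. excess (exp t) (x i))" by (rule summable_excess) simp
    have "(\<Sum>i. ?e t (x i)) = ennreal (exp (b * t) * (\<Sum>i. excess (exp t) (x i)))"
      using s by (subst suminf_ennreal2) (auto simp: suminf_mult excess_nonneg intro: summable_mult)
    then show ?thesis
      using gap_nonneg[of "exp t"] s
      by (simp add: gap_def right_diff_distrib suminf_nonneg excess_nonneg flip: ennreal_plus)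
  qed
  then have "(\<integral>\<^sup>+t. ?e t S \<partial>lborel) = (\<integral>\<^sup>+t. ennreal (exp (b * t) * gap (exp t)) \<partial>lborel) + (\<Sum>i. \<integral>\<^sup>+t. ?e t (x i) \<partial>lborel)"
    by (simp add: nn_integral_add nn_integral_suminf)
  also have "(\<Sum>i. \<integral>\<^sup>+t. ?e t (x i) \<partial>lborel) = ennreal ((\<Sum>i. x i powr (b + 1)) / ?c)"
    using summable_powr c b_pos
    by (subst nn_integral_excess[OF b_pos nonneg], subst suminf_ennreal2)
      (auto simp: suminf_divide intro: summable_divide)
  finally have eq: "(\<integral>\<^sup>+t. ennreal (exp (b * t) * gap (exp t)) \<partial>lborel) + ennreal ((\<Sum>i. x i powr (b + 1)) / ?c) =
      ennreal (S powr (b + 1) / ?c)"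
    using nn_integral_excess[OF b_pos S_nonneg] by simp
  have "(\<integral>\<^sup>+t. ennreal (exp (b * t) * gap (exp t)) \<partial>lborel) = ennreal (S powr (b + 1) / ?c) - ennreal ((\<Sum>i. x i powr (b + 1)) / ?c)"
    unfolding eq[symmetric] by simp
  also have "\<dots> = ennreal (S powr (b + 1) / ?c - (\<Sum>i. x i powr (b + 1)) / ?c)"
    using c summable_powr by (intro ennreal_minus) (auto intro!: divide_nonneg_pos suminf_nonneg)
  finally show ?thesis by (simp add: diff_divide_distrib)
qed

end

definition exceed :: "real \<Rightarrow> real \<Rightarrow> real" where "exceed v y = indicator {v<..} y"

lemma exceed_measurable[measurable]:
  assumes [measurable]: "f \<in> borel_measurable M" "g \<in> borel_measurable M"
  shows "(\<lambda>z. exceed (f z) (g z)) \<in> borel_measurable M"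
proof -
  have "(\<lambda>z. exceed (f z) (g z)) = (\<lambda>z. if f z < g z then 1 else 0)" by (auto simp: exceed_def)
  then show ?thesis by simp
qed

lemma exceed_nonneg[simp]: "0 \<le> exceed v y" and exceed_le_1[simp]: "exceed v y \<le> 1"
  by (auto simp: exceed_def indicator_def)

context nonneg_summable
begin

text \<open>For a fixed sequence both parts are integrable separately. After taking expectations
  they need not be, which is why the absolute difference has its own bound by cross terms.\<close>

lemma integral_exceed_difference:
  shows "integrable lborel (\<lambda>v. indicator {0<..} v * (v powr b * (exceed v S - (\<Sum>i. exceed v (x i)))))"
    and "(\<integral>v. indicator {0<..} v * (v powr b * (exceed v S - (\<Sum>i. exceed v (x i)))) \<partial>lborel) =
      (S powr (b + 1) - (\<Sum>i. x i powr (b + 1))) / (b + 1)"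
proof -
  let ?E = "\<lambda>v y. indicator {0<..} v * ((b + 1) * v powr b * exceed v y)"
  have E_int: "(\<integral>\<^sup>+v. ennreal (?E v y) \<partial>lborel) = ennreal (y powr (b + 1))" if "y \<ge> 0" for y
    using nn_integral_powr_exceed[OF b_pos that]
    by (simp add: exceed_def ennreal_mult'[symmetric] ennreal_indicator[symmetric] mult.commute)
  have i1: "has_bochner_integral lborel (\<lambda>v. ?E v S) (S powr (b + 1))"
    by (rule has_bochner_integral_nn_integral) (use E_int[OF S_nonneg] b_pos in auto)
  have i2: "has_bochner_integral lborel (\<lambda>v. \<Sum>i. ?E v (x i)) (\<Sum>i. x i powr (b + 1))"
  proof (rule has_bochner_integral_nn_integral)
    have s: "summable (\<lambda>i. ?E v (x i))" for v
      using summable_exceed[of v] by (cases "v > 0") (auto simp: exceed_def intro!: summable_mult)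
    show "AE v in lborel. 0 \<le> (\<Sum>i. ?E v (x i))" using s b_pos by (auto intro!: AE_I2 suminf_nonneg)
    show "0 \<le> (\<Sum>i. x i powr (b + 1))" using summable_powr by (intro suminf_nonneg) auto
    have "(\<integral>\<^sup>+v. ennreal (\<Sum>i. ?E v (x i)) \<partial>lborel) = (\<integral>\<^sup>+v. (\<Sum>i. ennreal (?E v (x i))) \<partial>lborel)"
      using s b_pos by (intro nn_integral_cong) (subst suminf_ennreal2, auto)
    also have "\<dots> = (\<Sum>i. \<integral>\<^sup>+v. ennreal (?E v (x i)) \<partial>lborel)" by (rule nn_integral_suminf) measurable
    also have "\<dots> = ennreal (\<Sum>i. x i powr (b + 1))"
      using summable_powr nonneg by (simp only: E_int) (rule suminf_ennreal2, auto)
    finally show "(\<integral>\<^sup>+v. ennreal (\<Sum>i. ?E v (x i)) \<partial>lborel) = ennreal (\<Sum>i. x i powr (b + 1))" .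
  qed measurable
  have i3: "has_bochner_integral lborel (\<lambda>v. (?E v S - (\<Sum>i. ?E v (x i))) / (b + 1)) ((S powr (b + 1) - (\<Sum>i. x i powr (b + 1))) / (b + 1))"
    by (intro has_bochner_integral_divide has_bochner_integral_diff i1 i2)
  have "(?E v S - (\<Sum>i. ?E v (x i))) / (b + 1) = indicator {0<..} v * (v powr b * (exceed v S - (\<Sum>i. exceed v (x i))))" for v
  proof (cases "v > 0")
    case True
    then have "(\<Sum>i. (b + 1) * v powr b * exceed v (x i)) = (b + 1) * v powr b * (\<Sum>i. exceed v (x i))"
      using summable_exceed[OF True] by (intro suminf_mult) (simp add: exceed_def)
    then have "?E v S - (\<Sum>i. ?E v (x i)) = (b + 1) * (v powr b * (exceed v S - (\<Sum>i. exceed v (x i))))"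
      using True by (simp add: right_diff_distrib mult.assoc)
    then show ?thesis using True b_pos by simp
  qed simp
  with i3 show "integrable lborel (\<lambda>v. indicator {0<..} v * (v powr b * (exceed v S - (\<Sum>i. exceed v (x i)))))"
    "(\<integral>v. indicator {0<..} v * (v powr b * (exceed v S - (\<Sum>i. exceed v (x i)))) \<partial>lborel) =
      (S powr (b + 1) - (\<Sum>i. x i powr (b + 1))) / (b + 1)"
    by (simp_all add: has_bochner_integral_iff)
qed

end

section \<open>The renewal equation of the fixed law\<close>

locale fixed_law = weights_law M A \<alpha> \<rho> for M :: "'a measure" and A \<alpha> \<rho> +
  assumes fixed: "smoothing \<rho> = \<rho>" and law_mean_pos: "(\<integral>x. x \<partial>\<rho>) > 0"
    and moments_finite: "\<And>\<beta>. 1 \<le> \<beta> \<Longrightarrow> \<beta> < \<alpha> \<Longrightarrow> moment \<rho> \<beta> < \<top>"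
begin

abbreviation a where "a \<equiv> \<alpha> - 1"

lemma a_pos: "a > 0" using \<alpha>_gt_1 by simp

abbreviation x where "x z i \<equiv> A i (fst z) * snd z i"

lemma AE_nsum: "AE z in \<Omega>. nonneg_summable (x z) a"
  by (rule AE_nonneg_summable[OF a_pos])

lemma X_eq: "X z = suminf (x z)" by (simp add: X_def)

lemma distr_X: "distr \<Omega> borel X = \<rho>" using fixed smoothing_eq by simp

lemma integral_\<rho>_X: "h \<in> borel_measurable borel \<Longrightarrow> (\<integral>y. h y \<partial>\<rho>) = (\<integral>z. h (X z) \<partial>\<Omega>)" for h :: "real \<Rightarrow> real"
  by (subst distr_X[symmetric], subst integral_distr) auto

lemma integrable_\<rho>_X: "h \<in> borel_measurable borel \<Longrightarrow> integrable \<Omega> (\<lambda>z. h (X z)) \<longleftrightarrow> integrable \<rho> h" for h :: "real \<Rightarrow> real"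
  by (subst distr_X[symmetric], subst integrable_distr_eq) auto

definition h :: "real \<Rightarrow> real" where "h v = (\<integral>y. excess v y \<partial>\<rho>)"

lemma integrable_excess: "0 \<le> v \<Longrightarrow> integrable \<rho> (\<lambda>y. excess v y)"
proof (rule Bochner_Integration.integrable_bound[OF law.integrable_id])
  assume "0 \<le> v"
  show "AE y in \<rho>. norm (excess v y) \<le> norm y"
    using law.nonneg by eventually_elim (use \<open>0 \<le> v\<close> in \<open>auto simp: excess_def\<close>)
qed measurable

lemma h_nonneg: "0 \<le> h v"
  unfolding h_def by (rule Bochner_Integration.integral_nonneg) (rule excess_nonneg)

lemma h_antimono: "0 \<le> v \<Longrightarrow> v \<le> v' \<Longrightarrow> h v' \<le> h v"
  unfolding h_def by (intro integral_mono integrable_excess excess_antimono) auto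

lemma h_measurable[measurable]: "h \<in> borel_measurable borel"
  unfolding h_def by measurable

definition f :: "real \<Rightarrow> real" where "f t = exp (a * t) * h (exp t)"

lemma f_measurable[measurable]: "f \<in> borel_measurable borel"
  unfolding f_def by measurable

lemma f_nonneg: "0 \<le> f t" unfolding f_def using h_nonneg by simp

definition gap_at :: "real \<Rightarrow> 'a \<times> (nat \<Rightarrow> real) \<Rightarrow> real" where
  "gap_at v z = excess v (X z) - (\<Sum>i. excess v (x z i))"

lemma gap_at_measurable[measurable]:
  assumes [measurable]: "v \<in> borel_measurable N" "z \<in> measurable N \<Omega>"
  shows "(\<lambda>y. gap_at (v y) (z y)) \<in> borel_measurable N"
proof -
  have [measurable]: "(\<lambda>y. x (z y) i) \<in> borel_measurable N" for i
    by (rule measurable_compose[OF assms(2)]) measurable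
  show ?thesis unfolding gap_at_def by measurable
qed

lemma gap_at_eq: "nonneg_summable (x z) a \<Longrightarrow> gap_at v z = nonneg_summable.gap (x z) v"
  by (simp add: nonneg_summable.gap_def gap_at_def X_eq)

lemma integrable_excess_X: "0 \<le> v \<Longrightarrow> integrable \<Omega> (\<lambda>z. excess v (X z))"
  by (subst integrable_\<rho>_X) (auto intro: integrable_excess)

lemma AE_gap_at_nonneg: "v > 0 \<Longrightarrow> AE z in \<Omega>. 0 \<le> gap_at v z"
  using AE_nsum by eventually_elim (simp add: gap_at_eq nonneg_summable.gap_nonneg)

lemma integrable_excess_sum: "v > 0 \<Longrightarrow> integrable \<Omega> (\<lambda>z. \<Sum>i. excess v (x z i))"
proof (rule Bochner_Integration.integrable_bound[OF integrable_excess_X[of v]])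
  assume v: "v > 0"
  show "AE z in \<Omega>. norm (\<Sum>i. excess v (x z i)) \<le> norm (excess v (X z))"
    using AE_nsum AE_gap_at_nonneg[OF v]
  proof eventually_elim
    case (elim z)
    have "0 \<le> (\<Sum>i. excess v (x z i))"
      by (intro suminf_nonneg nonneg_summable.summable_excess[OF elim(1) v] excess_nonneg)
    then show ?case using elim(2) by (simp add: gap_at_def)
  qed
qed auto

lemma integrable_gap_at: "v > 0 \<Longrightarrow> integrable \<Omega> (gap_at v)"
  unfolding gap_at_def by (intro Bochner_Integration.integrable_diff integrable_excess_X integrable_excess_sum) auto

definition g :: "real \<Rightarrow> real" where "g t = exp (a * t) * (\<integral>z. gap_at (exp t) z \<partial>\<Omega>)"

lemma g_nonneg: "0 \<le> g t"
  unfolding g_def using integral_nonneg_AE[OF AE_gap_at_nonneg[of "exp t"]] by simp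

lemma g_measurable[measurable]: "g \<in> borel_measurable borel"
  unfolding g_def by measurable

text \<open>\<open>g t\<close> is exp (\<alpha> t) times the mean of gap v / v at v = exp t, and
  that quotient decreases in v. This one-sided control takes the place of direct Riemann
  integrability.\<close>

lemma g_scaled_antimono:
  assumes "s \<le> t"
  shows "g t \<le> exp (\<alpha> * (t - s)) * g s"
proof -
  have "(\<integral>z. gap_at (exp t) z / exp t \<partial>\<Omega>) \<le> (\<integral>z. gap_at (exp s) z / exp s \<partial>\<Omega>)"
  proof (rule integral_mono_AE)
    show "AE z in \<Omega>. gap_at (exp t) z / exp t \<le> gap_at (exp s) z / exp s"
      using AE_nsum
    proof eventually_elim
      case (elim z)
      then show ?case
        using nonneg_summable.gap_scaled_antimono[OF elim, of "exp s" "exp t"] assms by (simp only: gap_at_eq) simp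
    qed
  qed (auto intro!: integrable_divide integrable_gap_at)
  then have le: "(\<integral>z. gap_at (exp t) z \<partial>\<Omega>) / exp t \<le> (\<integral>z. gap_at (exp s) z \<partial>\<Omega>) / exp s" by simp
  have e: "g u = exp (\<alpha> * u) * ((\<integral>z. gap_at (exp u) z \<partial>\<Omega>) / exp u)" for u
    by (simp add: g_def left_diff_distrib exp_diff)
  have "g t \<le> exp (\<alpha> * t) * ((\<integral>z. gap_at (exp s) z \<partial>\<Omega>) / exp s)"
    unfolding e[of t] by (intro mult_left_mono le) auto
  also have "\<dots> = exp (\<alpha> * (t - s)) * g s"
    by (simp add: e[of s] right_diff_distrib exp_diff)
  finally show ?thesis .
qed

text \<open>Scaling moves the weight c from the argument of the excess to its level, and c^\<alpha>
  exp (a (t - ln c)) = exp (a t) c because \<alpha> - a = 1. For weight 0 both sides vanish, the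
  level exp t being positive.\<close>

lemma step_term:
  "ennreal (A i \<omega> powr \<alpha>) * ennreal (f (t - ln (A i \<omega>))) =
    ennreal (exp (a * t)) * (\<integral>\<^sup>+y. ennreal (excess (exp t) (A i \<omega> * y)) \<partial>\<rho>)"
proof (cases "A i \<omega> = 0")
  case True
  then show ?thesis by (simp add: excess_def max_def)
next
  case False
  define c where "c = A i \<omega>"
  have c: "c > 0" using False A_nonneg[of i \<omega>] by (simp add: c_def)
  have ex: "excess (exp t) (c * y) = c * excess (exp t / c) y" for y
    using excess_scale[OF c, of "exp t / c" y] c by simp
  have "(\<integral>\<^sup>+y. ennreal (excess (exp t) (c * y)) \<partial>\<rho>) = ennreal (\<integral>y. excess (exp t) (c * y) \<partial>\<rho>)"
    unfolding ex using c by (intro nn_integral_eq_integral) (auto intro!: integrable_mult_right integrable_excess simp: excess_nonneg)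
  also have "(\<integral>y. excess (exp t) (c * y) \<partial>\<rho>) = c * h (exp t / c)"
    unfolding ex h_def by simp
  finally have nn: "(\<integral>\<^sup>+y. ennreal (excess (exp t) (c * y)) \<partial>\<rho>) = ennreal (c * h (exp t / c))" .
  have "c powr \<alpha> * f (t - ln c) = c powr \<alpha> * exp (a * (t - ln c)) * h (exp t / c)"
    using c by (simp add: f_def exp_diff)
  also have "c powr \<alpha> * exp (a * (t - ln c)) = exp (a * t) * c"
  proof -
    have "c powr \<alpha> * exp (a * (t - ln c)) = exp (\<alpha> * ln c + a * (t - ln c))"
      using c by (simp add: powr_def flip: exp_add)
    also have "\<alpha> * ln c + a * (t - ln c) = a * t + ln c" by (simp add: algebra_simps)
    finally show ?thesis using c by (simp add: exp_add)
  qed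
  finally have "c powr \<alpha> * f (t - ln c) = exp (a * t) * (c * h (exp t / c))" by simp
  then show ?thesis
    unfolding c_def[symmetric] nn using c h_nonneg f_nonneg by (simp flip: ennreal_mult)
qed

text \<open>As \<rho> is fixed, \<open>h (exp t)\<close> is also the mean excess of the weighted
  sum. It splits into the excesses of the terms, which give the convolution, and the gap, which
  gives \<open>g\<close>.\<close>

lemma renewal_equality: "f t = (\<integral>u. f (t - u) \<partial>step_law) + g t"
proof -
  have "(\<integral>\<^sup>+u. ennreal (f (t - u)) \<partial>step_law) =
      (\<integral>\<^sup>+\<omega>. (\<Sum>i. ennreal (exp (a * t)) * (\<integral>\<^sup>+y. ennreal (excess (exp t) (A i \<omega> * y)) \<partial>\<rho>)) \<partial>M)"
    by (subst nn_integral_step_law) (auto simp: step_term)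
  also have "\<dots> = ennreal (exp (a * t)) * (\<integral>\<^sup>+\<omega>. (\<Sum>i. \<integral>\<^sup>+y. ennreal (excess (exp t) (A i \<omega> * y)) \<partial>\<rho>) \<partial>M)"
    by (simp add: nn_integral_cmult)
  also have "(\<integral>\<^sup>+\<omega>. (\<Sum>i. \<integral>\<^sup>+y. ennreal (excess (exp t) (A i \<omega> * y)) \<partial>\<rho>) \<partial>M) = (\<integral>\<^sup>+z. (\<Sum>i. ennreal (excess (exp t) (x z i))) \<partial>\<Omega>)"
    by (rule nn_integral_termwise[symmetric]) measurable
  also have "\<dots> = (\<integral>\<^sup>+z. ennreal (\<Sum>i. excess (exp t) (x z i)) \<partial>\<Omega>)"
    by (rule nn_integral_cong_AE, use AE_nsum in eventually_elim)
      (rule suminf_ennreal2, auto simp: excess_nonneg nonneg_summable.summable_excess)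
  also have "\<dots> = ennreal (\<integral>z. (\<Sum>i. excess (exp t) (x z i)) \<partial>\<Omega>)"
  proof (rule nn_integral_eq_integral[OF integrable_excess_sum])
    show "AE z in \<Omega>. 0 \<le> (\<Sum>i. excess (exp t) (x z i))"
      using AE_nsum by eventually_elim (auto intro!: suminf_nonneg simp: excess_nonneg nonneg_summable.summable_excess)
  qed simp
  finally have nn: "(\<integral>\<^sup>+u. ennreal (f (t - u)) \<partial>step_law) = ennreal (exp (a * t) * (\<integral>z. (\<Sum>i. excess (exp t) (x z i)) \<partial>\<Omega>))"
    by (simp add: ennreal_mult')
  have pos: "0 \<le> (\<integral>z. (\<Sum>i. excess (exp t) (x z i)) \<partial>\<Omega>)"
  proof (rule integral_nonneg_AE)
    show "AE z in \<Omega>. 0 \<le> (\<Sum>i. excess (exp t) (x z i))"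
      using AE_nsum by eventually_elim (auto intro!: suminf_nonneg simp: excess_nonneg nonneg_summable.summable_excess)
  qed
  have "(\<integral>u. f (t - u) \<partial>step_law) = exp (a * t) * (\<integral>z. (\<Sum>i. excess (exp t) (x z i)) \<partial>\<Omega>)"
    using f_nonneg pos by (subst integral_eq_nn_integral) (auto simp: nn)
  moreover have "(\<integral>z. gap_at (exp t) z \<partial>\<Omega>) = h (exp t) - (\<integral>z. (\<Sum>i. excess (exp t) (x z i)) \<partial>\<Omega>)"
    unfolding gap_at_def h_def
    by (subst Bochner_Integration.integral_diff[OF integrable_excess_X integrable_excess_sum]) (auto simp: integral_\<rho>_X)
  ultimately show ?thesis by (simp add: f_def g_def right_diff_distrib)
qed

definition D :: "'a \<times> (nat \<Rightarrow> real) \<Rightarrow> real" where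
  "D z = X z powr \<alpha> - (\<Sum>i. x z i powr \<alpha>)"

lemma D_measurable[measurable]: "D \<in> borel_measurable \<Omega>"
  unfolding D_def by measurable

lemma cross_measurable[measurable]: "(\<lambda>z. cross b (x z)) \<in> borel_measurable \<Omega>"
  unfolding cross_def by measurable

lemma nn_integral_cross_finite: "(\<integral>\<^sup>+z. ennreal (cross a (x z)) \<partial>\<Omega>) < \<top>"
proof -
  have "(\<integral>\<^sup>+z. ennreal (cross a (x z)) \<partial>\<Omega>) \<le> (\<integral>\<^sup>+\<omega>. ennreal (A_sum \<omega> powr (a + 1)) \<partial>M) * (moment \<rho> 1 * (1 + moment \<rho> (max a 1)))"
    by (rule nn_integral_cross[OF a_pos])
  also have "\<dots> < \<top>"
    using nn_integral_A_sum_powr_finite[of \<alpha>] moments_finite[of 1] moments_finite[of "max a 1"] \<alpha>_gt_1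
    by (auto simp: ennreal_mult_less_top)
  finally show ?thesis .
qed

lemma AE_D_bounds: "AE z in \<Omega>. 0 \<le> D z \<and> D z \<le> \<alpha> * 2 powr a * cross a (x z)"
  using AE_nsum
proof eventually_elim
  case (elim z)
  show ?case
    using nonneg_summable.powr_superadditive[OF elim] nonneg_summable.powr_suminf_le_cross[OF elim]
    by (simp add: D_def X_eq)
qed

lemma integrable_cross: "integrable \<Omega> (\<lambda>z. cross a (x z))"
proof (rule integrableI_nonneg)
  show "AE z in \<Omega>. 0 \<le> cross a (x z)"
    using AE_nsum by eventually_elim (rule nonneg_summable.cross_nonneg)
qed (use nn_integral_cross_finite in auto)

text \<open>The two parts of \<open>D\<close> need not be integrable separately. Their difference is
  bounded by cross terms, whose expectation uses only moments of \<rho> of order at most max a 1 <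
  \<alpha>.\<close>

lemma integrable_D: "integrable \<Omega> D"
proof (rule Bochner_Integration.integrable_bound)
  show "integrable \<Omega> (\<lambda>z. \<alpha> * 2 powr a * cross a (x z))" using integrable_cross by auto
  show "AE z in \<Omega>. norm (D z) \<le> norm (\<alpha> * 2 powr a * cross a (x z))"
    using AE_D_bounds by eventually_elim auto
qed measurable

lemma integral_D_nonneg: "0 \<le> (\<integral>z. D z \<partial>\<Omega>)"
  by (rule integral_nonneg_AE, use AE_D_bounds in eventually_elim) auto

lemma nn_integral_g: "(\<integral>\<^sup>+t. ennreal (g t) \<partial>lborel) = ennreal ((\<integral>z. D z \<partial>\<Omega>) / (a * \<alpha>))"
proof -
  interpret L: pair_sigma_finite lborel \<Omega> ..
  have "(\<integral>\<^sup>+t. ennreal (g t) \<partial>lborel) = (\<integral>\<^sup>+t. \<integral>\<^sup>+z. ennreal (exp (a * t) * gap_at (exp t) z) \<partial>\<Omega> \<partial>lborel)"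
  proof (rule nn_integral_cong)
    fix t :: real
    have "(\<integral>\<^sup>+z. ennreal (exp (a * t) * gap_at (exp t) z) \<partial>\<Omega>) = ennreal (\<integral>z. exp (a * t) * gap_at (exp t) z \<partial>\<Omega>)"
      by (rule nn_integral_eq_integral)
        (use integrable_gap_at[of "exp t"] AE_gap_at_nonneg[of "exp t"] in auto)
    then show "ennreal (g t) = (\<integral>\<^sup>+z. ennreal (exp (a * t) * gap_at (exp t) z) \<partial>\<Omega>)" by (simp add: g_def)
  qed
  also have "\<dots> = (\<integral>\<^sup>+z. \<integral>\<^sup>+t. ennreal (exp (a * t) * gap_at (exp t) z) \<partial>lborel \<partial>\<Omega>)"
    by (rule L.Fubini'[symmetric]) measurable
  also have "\<dots> = (\<integral>\<^sup>+z. ennreal (D z / (a * \<alpha>)) \<partial>\<Omega>)"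
  proof (rule nn_integral_cong_AE, use AE_nsum in eventually_elim)
    case (elim z)
    show ?case using nonneg_summable.nn_integral_gap[OF elim] by (simp add: gap_at_eq[OF elim] D_def X_eq)
  qed
  also have "\<dots> = ennreal (\<integral>z. D z / (a * \<alpha>) \<partial>\<Omega>)"
  proof (rule nn_integral_eq_integral)
    show "AE z in \<Omega>. 0 \<le> D z / (a * \<alpha>)" using AE_D_bounds by eventually_elim (use \<alpha>_gt_1 in auto)
  qed (use integrable_D in auto)
  finally show ?thesis by simp
qed

lemma integrable_g: "integrable lborel g"
  by (rule integrableI_nonneg) (auto simp: g_nonneg nn_integral_g)

lemma integral_g: "(\<integral>t. g t \<partial>lborel) = (\<integral>z. D z \<partial>\<Omega>) / (a * \<alpha>)"
  using integral_D_nonneg \<alpha>_gt_1 by (subst integral_eq_nn_integral) (auto simp: g_nonneg nn_integral_g)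

text \<open>Since exp (- \<alpha> t) g t is nonincreasing, \<open>g\<close> is at least exp (-
  \<alpha>) g t on the preceding unit interval. Integrability of \<open>g\<close> thus yields both
  its boundedness and its decay.\<close>

lemma g_le_window: "g t \<le> exp \<alpha> * (\<integral>s. indicator {t-1..t} s * g s \<partial>lborel)"
proof -
  have int: "integrable lborel (\<lambda>s. indicator {t-1..t} s * g s)"
    using integrable_real_mult_indicator[OF _ integrable_g, of "{t-1..t}"] by (simp add: mult.commute)
  have "g t = (\<integral>s. indicator {t-1..t} s * g t \<partial>lborel)" by simp
  also have "\<dots> \<le> (\<integral>s. exp \<alpha> * (indicator {t-1..t} s * g s) \<partial>lborel)"
  proof (rule integral_mono)
    fix s :: real
    show "indicator {t-1..t} s * g t \<le> exp \<alpha> * (indicator {t-1..t} s * g s)"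
    proof (cases "s \<in> {t-1..t}")
      case True
      then have "g t \<le> exp (\<alpha> * (t - s)) * g s" by (intro g_scaled_antimono) auto
      also have "\<dots> \<le> exp \<alpha> * g s"
        using True \<alpha>_gt_1 mult_left_mono[of "t - s" 1 \<alpha>] by (intro mult_right_mono g_nonneg) auto
      finally show ?thesis using True by simp
    qed simp
  qed (use int in auto)
  finally show ?thesis by simp
qed

lemma g_bounded: "g t \<le> exp \<alpha> * (\<integral>s. g s \<partial>lborel)"
proof -
  have "(\<integral>s. indicator {t-1..t} s * g s \<partial>lborel) \<le> (\<integral>s. g s \<partial>lborel)"
    using integrable_real_mult_indicator[OF _ integrable_g, of "{t-1..t}"]
    by (intro integral_mono integrable_g) (auto simp: mult.commute indicator_def g_nonneg)
  then show ?thesis using order_trans[OF g_le_window mult_left_mono] by simp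
qed

lemma g_tendsto_0: "(g \<longlongrightarrow> 0) at_top"
proof -
  have "((\<lambda>t. \<integral>s. indicator {t-1..t} s * g s \<partial>lborel) \<longlongrightarrow> (\<integral>s. 0 \<partial>(lborel :: real measure))) at_top"
  proof (rule integral_dominated_convergence_at_top[OF _ _ integrable_g])
    show "\<forall>\<^sub>F t in at_top. AE s in lborel. norm (indicator {t-1..t} s * g s) \<le> g s"
      by (auto intro!: always_eventually AE_I2 simp: indicator_def g_nonneg)
    show "AE s in lborel. ((\<lambda>t. indicator {t-1..t} s * g s) \<longlongrightarrow> 0) at_top"
    proof (intro AE_I2 tendsto_eventually)
      show "\<forall>\<^sub>F t in at_top. indicator {t-1..t} s * g s = 0" for s
        using eventually_gt_at_top[of "s + 1"] by eventually_elim simp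
    qed
  qed auto
  then have "((\<lambda>t. exp \<alpha> * (\<integral>s. indicator {t-1..t} s * g s \<partial>lborel)) \<longlongrightarrow> 0) at_top"
    by (intro tendsto_mult_right_zero) simp
  then show ?thesis
    by (rule Lim_null_comparison[rotated]) (simp add: g_nonneg g_le_window)
qed

text \<open>A Markov-type bound: for y \<ge> 0 the excess over v is at most v^(1 - \<beta>)
  y^\<beta>. With \<beta> = \<alpha> - \<epsilon> this reduces the factor exp (a t) to exp
  (\<epsilon> t), and \<epsilon> \<le> a ensures \<beta> \<ge> 1.\<close>

lemma f_growth:
  assumes "0 < \<epsilon>" "\<epsilon> \<le> a"
  shows "\<exists>C. \<forall>t. f t \<le> C * exp (\<epsilon> * t)"
proof -
  define \<beta> where "\<beta> = \<alpha> - \<epsilon>"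
  have \<beta>: "1 \<le> \<beta>" "\<beta> < \<alpha>" using assms by (auto simp: \<beta>_def)
  have int: "integrable \<rho> (\<lambda>y. y powr \<beta>)"
    by (rule integrableI_nonneg) (use moments_finite[OF \<beta>] in \<open>auto simp: moment_def\<close>)
  have "f t \<le> (\<integral>y. y powr \<beta> \<partial>\<rho>) * exp (\<epsilon> * t)" for t
  proof -
    have "h (exp t) \<le> (\<integral>y. exp t powr (1 - \<beta>) * y powr \<beta> \<partial>\<rho>)"
      unfolding h_def
    proof (rule integral_mono_AE)
      show "AE y in \<rho>. excess (exp t) y \<le> exp t powr (1 - \<beta>) * y powr \<beta>"
        using law.nonneg
      proof eventually_elim
        case (elim y)
        show ?case
        proof (cases "y \<le> exp t")
          case False
          then have "exp t powr (\<beta> - 1) \<le> y powr (\<beta> - 1)" using \<beta> by (intro powr_mono2) auto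
          then have "exp t powr (1 - \<beta>) * exp t powr (\<beta> - 1) \<le> exp t powr (1 - \<beta>) * y powr (\<beta> - 1)"
            by (intro mult_left_mono) auto
          then have "1 \<le> exp t powr (1 - \<beta>) * y powr (\<beta> - 1)" by (simp flip: powr_add)
          then have "y * 1 \<le> y * (exp t powr (1 - \<beta>) * y powr (\<beta> - 1))" using elim by (intro mult_left_mono) auto
          also have "\<dots> = exp t powr (1 - \<beta>) * y powr \<beta>" using powr_add_one[OF elim, of "\<beta> - 1"] by (simp add: mult_ac)
          finally show ?thesis using excess_le[of "exp t" y] elim by simp
        qed (simp add: excess_def)
      qed
    qed (use int in \<open>auto intro: integrable_excess\<close>)
    also have "\<dots> = exp t powr (1 - \<beta>) * (\<integral>y. y powr \<beta> \<partial>\<rho>)" by simp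
    finally have "f t \<le> exp (a * t) * (exp t powr (1 - \<beta>) * (\<integral>y. y powr \<beta> \<partial>\<rho>))"
      unfolding f_def by (rule mult_left_mono) simp
    also have "exp (a * t) * (exp t powr (1 - \<beta>) * (\<integral>y. y powr \<beta> \<partial>\<rho>)) = (\<integral>y. y powr \<beta> \<partial>\<rho>) * (exp (a * t) * exp t powr (1 - \<beta>))"
      by simp
    also have "exp (a * t) * exp t powr (1 - \<beta>) = exp (\<epsilon> * t)"
      by (simp add: powr_def \<beta>_def algebra_simps flip: exp_add)
    finally show ?thesis .
  qed
  then show ?thesis by blast
qed

definition T :: "real \<Rightarrow> real" where "T v = measure \<rho> {v<..}"

lemma T_eq: "T v = (\<integral>y. indicator {v<..} y \<partial>\<rho>)"
  unfolding T_def by (simp add: law.sets_\<rho>)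

lemma integrable_tail: "integrable \<rho> (\<lambda>y. c * indicator {v<..} y :: real)"
  by (intro integrable_mult_right) (simp add: integrable_indicator_iff law.emeasure_eq_measure law.sets_\<rho>)

text \<open>The tail probability is minus the slope of \<open>h\<close>; on [v, v'] it lies between
  \<open>T v'\<close> and \<open>T v\<close>.\<close>

lemma h_diff_ge: "0 < v \<Longrightarrow> v \<le> v' \<Longrightarrow> (v' - v) * T v' \<le> h v - h v'"
  and h_diff_le: "0 < v \<Longrightarrow> v \<le> v' \<Longrightarrow> h v - h v' \<le> (v' - v) * T v"
proof -
  assume v: "0 < v" "v \<le> v'"
  have d: "h v - h v' = (\<integral>y. excess v y - excess v' y \<partial>\<rho>)"
    unfolding h_def using v by (subst Bochner_Integration.integral_diff) (auto intro: integrable_excess)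
  have int: "integrable \<rho> (\<lambda>y. excess v y - excess v' y)"
    using v by (intro Bochner_Integration.integrable_diff integrable_excess) auto
  have "(v' - v) * T v' = (\<integral>y. (v' - v) * indicator {v'<..} y \<partial>\<rho>)" by (simp add: T_eq)
  also have "\<dots> \<le> h v - h v'" unfolding d
    by (intro integral_mono integrable_tail int) (use v in \<open>auto simp: excess_def indicator_def\<close>)
  finally show "(v' - v) * T v' \<le> h v - h v'" .
  have "h v - h v' \<le> (\<integral>y. (v' - v) * indicator {v<..} y \<partial>\<rho>)" unfolding d
    by (intro integral_mono integrable_tail int) (use v in \<open>auto simp: excess_def indicator_def\<close>)
  then show "h v - h v' \<le> (v' - v) * T v" by (simp add: T_eq)
qed

lemma f_upper:
  assumes "0 \<le> s"
  shows "f (t + s) \<le> exp (a * s) * f t"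
proof -
  have "h (exp (t + s)) \<le> h (exp t)" using assms by (intro h_antimono) auto
  then have "exp (a * (t + s)) * h (exp (t + s)) \<le> exp (a * (t + s)) * h (exp t)" by (rule mult_left_mono) simp
  then show ?thesis by (simp add: f_def distrib_left exp_add mult_ac)
qed

text \<open>With v = exp t, the fall of \<open>h\<close> from v to v exp s is at most v (exp s - 1)
  T v, and (v / 2) T v \<le> h (v / 2). The level v / 2 is the origin of the shift
  \<open>ln 2\<close> and of the factor 2; passing from exp (a t) to exp (a (t - ln 2)) costs
  \<open>2 powr a\<close>.\<close>

lemma f_lower:
  assumes s: "0 \<le> s"
  shows "f t - f (t + s) \<le> 2 * 2 powr a * (exp s - 1) * f (t - ln 2)"
proof -
  define v where "v = exp t"
  have v: "v > 0" by (simp add: v_def)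
  have vs: "exp (t + s) = v * exp s" by (simp add: v_def exp_add)
  have "v \<le> v * exp s" using v s by simp
  have "exp (a * t) * h (v * exp s) \<le> exp (a * (t + s)) * h (v * exp s)"
    using s a_pos by (intro mult_right_mono h_nonneg) auto
  then have "f t - f (t + s) \<le> exp (a * t) * (h v - h (v * exp s))"
    by (simp add: f_def vs v_def[symmetric] right_diff_distrib)
  also have "h v - h (v * exp s) \<le> (v * exp s - v) * T v" by (rule h_diff_le[OF v \<open>v \<le> v * exp s\<close>])
  also have "(v * exp s - v) * T v = (exp s - 1) * (2 * ((v - v / 2) * T v))" by (simp add: algebra_simps)
  also have "(v - v / 2) * T v \<le> h (v / 2)" using h_diff_ge[of "v / 2" v] h_nonneg[of v] v by simp
  finally have "f t - f (t + s) \<le> exp (a * t) * ((exp s - 1) * (2 * h (v / 2)))"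
    using s by (simp add: mult_left_mono)
  also have "\<dots> = 2 * 2 powr a * (exp s - 1) * f (t - ln 2)"
    by (simp add: f_def v_def exp_diff right_diff_distrib powr_def mult_ac)
  finally show ?thesis .
qed

sublocale R: renewal_equation step_law a f g a "2 * 2 powr a" "ln 2" "exp \<alpha> * (\<integral>s. g s \<partial>lborel)"
  by (intro renewal_equation.intro renewal_equation_axioms.intro renewal_step_law f_nonneg f_measurable
      g_nonneg integrable_g g_bounded g_tendsto_0 renewal_equality f_growth f_upper f_lower)
    (use a_pos in auto)

end

text \<open>Equality of the sums forces equality in every termwise bound \<open>term_le\<close>, and
  a positive term can be cancelled there.\<close>

lemma (in nonneg_summable) powr_sum_eqD:
  assumes eq: "(\<Sum>i. x i powr (b + 1)) = S powr (b + 1)" and pos: "x i > 0"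
  shows "x i = S"
proof -
  let ?d = "\<lambda>i. x i * S powr b - x i powr (b + 1)"
  have s: "summable ?d" "suminf ?d = 0"
    using summable_diff[OF sums_summable[OF suminf_S_powr] summable_powr]
      suminf_diff[OF sums_summable[OF suminf_S_powr] summable_powr] sums_unique[OF suminf_S_powr] eq by auto
  have "0 \<le> ?d j" for j using term_le[of j] by simp
  then have "?d i = 0" using suminf_eq_zero_iff[OF s(1)] s(2) by auto
  then have "x i powr b = S powr b" using pos by (simp add: powr_add_one)
  then show ?thesis using powr_inj[of b "x i" S] powr_less_mono2[of b "x i" S] b_pos pos le_S[of i] by fastforce
qed

section \<open>The tail constant and its two expressions\<close>

context fixed_law
begin

definition H :: real where "H = (\<integral>z. D z \<partial>\<Omega>) / (\<alpha> * step.mean)"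

lemma H_nonneg: "0 \<le> H"
  unfolding H_def using integral_D_nonneg \<alpha>_gt_1 step_law_mean_pos by (simp add: step.mean_def)

lemma f_limit: "(f \<longlongrightarrow> (\<integral>z. D z \<partial>\<Omega>) / (a * \<alpha>) / step.mean) at_top"
  using R.renewal_limit by (simp add: integral_g)

lemma tail_limit: "((\<lambda>v. v powr \<alpha> * T v) \<longlongrightarrow> H) at_top"
proof -
  let ?L = "(\<integral>z. D z \<partial>\<Omega>) / (a * \<alpha>) / step.mean"
  have "((\<lambda>v. f (ln v)) \<longlongrightarrow> ?L) at_top" by (rule filterlim_compose[OF f_limit ln_at_top])
  moreover have "\<forall>\<^sub>F v in at_top. f (ln v) = v powr a * h v"
    using eventually_gt_at_top[of 0] by eventually_elim (simp add: f_def powr_def)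
  ultimately have "((\<lambda>v. v powr a * h v) \<longlongrightarrow> ?L) at_top" by (rule Lim_transform_eventually)
  from monotone_density[OF a_pos this h_diff_ge h_diff_le]
  have "((\<lambda>v. v powr (a + 1) * T v) \<longlongrightarrow> a * ?L) at_top" .
  moreover have "a * ?L = H" using a_pos by (simp add: H_def)
  ultimately show ?thesis by simp
qed

lemma law_positive: "emeasure \<rho> {0<..} > 0"
proof (rule ccontr)
  assume "\<not> ?thesis"
  then have "emeasure \<rho> {0<..} = 0" by simp
  then have "AE y in \<rho>. y \<notin> {0<..}" by (intro AE_not_in) (auto simp: null_sets_def law.sets_\<rho>)
  then have "AE y in \<rho>. y = 0" using law.nonneg by eventually_elim auto
  then have "(\<integral>y. y \<partial>\<rho>) = (\<integral>y. 0 \<partial>\<rho>)" by (intro integral_cong_AE) auto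
  then show False using law_mean_pos by simp
qed

text \<open>\<open>D\<close> vanishes only if at most one term is positive. Some fixed pair of
  weights is simultaneously positive with positive probability, and the two copies attached to it
  are both positive with positive probability since \<rho> has positive mean.\<close>

lemma H_pos:
  assumes "emeasure M {\<omega>\<in>space M. \<exists>i j. i \<noteq> j \<and> A i \<omega> > 0 \<and> A j \<omega> > 0} > 0"
  shows "H > 0"
proof -
  have "\<exists>i j. i \<noteq> j \<and> emeasure M {\<omega>\<in>space M. A i \<omega> > 0 \<and> A j \<omega> > 0} > 0"
  proof (rule ccontr)
    assume none: "\<not> ?thesis"
    let ?I = "{(i, j). i \<noteq> (j::nat)}"
    have "(\<Union>(i, j)\<in>?I. {\<omega>\<in>space M. A i \<omega> > 0 \<and> A j \<omega> > 0}) \<in> null_sets M"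
      using none by (intro null_sets_UN') (auto simp: null_sets_def)
    moreover have "(\<Union>(i, j)\<in>?I. {\<omega>\<in>space M. A i \<omega> > 0 \<and> A j \<omega> > 0}) =
        {\<omega>\<in>space M. \<exists>i j. i \<noteq> j \<and> A i \<omega> > 0 \<and> A j \<omega> > 0}" by auto
    ultimately show False using assms by (simp add: null_sets_def)
  qed
  then obtain i j where ij: "i \<noteq> j" "emeasure M {\<omega>\<in>space M. A i \<omega> > 0 \<and> A j \<omega> > 0} > 0" by blast
  define U where "U = {\<omega>\<in>space M. A i \<omega> > 0 \<and> A j \<omega> > 0}"
  define V where "V = {r \<in> space law.P. \<forall>k\<in>{i, j}. r k \<in> {0<..}}"
  have U: "U \<in> sets M" unfolding U_def by measurable
  have V: "V \<in> sets law.P"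
  proof -
    have "V = {r \<in> space law.P. 0 < r i \<and> 0 < r j}" by (auto simp: V_def)
    also have "\<dots> \<in> sets law.P" by measurable
    finally show ?thesis .
  qed
  have "emeasure law.P V = (\<Prod>k\<in>{i, j}. emeasure \<rho> {0<..})"
    unfolding V_def by (rule law.P.emeasure_PiM_Collect) (auto simp: law.sets_\<rho>)
  then have "emeasure law.P V > 0" using law_positive ij(1) by (simp add: zero_less_iff_neq_zero)
  moreover have "emeasure \<Omega> (U \<times> V) = emeasure M U * emeasure law.P V"
    by (rule sigma_finite_measure.emeasure_pair_measure_Times[OF sigma_finite_P U V])
  ultimately have UV: "emeasure \<Omega> (U \<times> V) \<noteq> 0"
    using ij(2) by (auto simp: U_def[symmetric] zero_less_iff_neq_zero)
  have "(\<integral>z. D z \<partial>\<Omega>) \<noteq> 0"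
  proof
    assume "(\<integral>z. D z \<partial>\<Omega>) = 0"
    moreover have "AE z in \<Omega>. 0 \<le> D z" using AE_D_bounds by eventually_elim auto
    ultimately have "AE z in \<Omega>. D z = 0" using integral_nonneg_eq_0_iff_AE[OF integrable_D] by simp
    then have "AE z in \<Omega>. z \<notin> U \<times> V"
      using AE_nsum
    proof eventually_elim
      case (elim z)
      interpret ns: nonneg_summable "x z" a by (rule elim)
      show ?case
      proof
        assume "z \<in> U \<times> V"
        then have pos: "x z i > 0" "x z j > 0" by (auto simp: U_def V_def)
        have "(\<Sum>k. x z k powr (a + 1)) = ns.S powr (a + 1)" using elim(1) by (simp add: D_def X_eq)
        then have "x z i = ns.S" by (rule ns.powr_sum_eqD) (rule pos)
        moreover have "x z i + x z j \<le> ns.S"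
          using sum_le_suminf[OF ns.summable, of "{i, j}"] ns.nonneg ij(1) by simp
        ultimately show False using pos by simp
      qed
    qed
    then have "emeasure \<Omega> (U \<times> V) = 0"
      using AE_iff_null_sets[of "U \<times> V" \<Omega>] U V by auto
    then show False using UV by simp
  qed
  then have "(\<integral>z. D z \<partial>\<Omega>) > 0" using integral_D_nonneg by simp
  then show ?thesis unfolding H_def using \<alpha>_gt_1 step_law_mean_pos by (simp add: step.mean_def)
qed

text \<open>Each summand involves a single copy, so by linearity the expectation does not depend on
  whether all terms share the copy \<open>snd z 0\<close> or have one each. This links the
  expression for H with one R to the one with the copies.\<close>

lemma nn_integral_termwise_0:
  fixes k :: "real \<Rightarrow> ennreal"
  assumes [measurable]: "k \<in> borel_measurable borel"
  shows "(\<integral>\<^sup>+z. (\<Sum>i. k (A i (fst z) * snd z 0)) \<partial>\<Omega>) = (\<integral>\<^sup>+z. (\<Sum>i. k (x z i)) \<partial>\<Omega>)"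
proof -
  have "(\<integral>\<^sup>+z. (\<Sum>i. k (A i (fst z) * snd z 0)) \<partial>\<Omega>) = (\<integral>\<^sup>+\<omega>. \<integral>\<^sup>+r. (\<Sum>i. k (A i \<omega> * r 0)) \<partial>law.P \<partial>M)"
    by (subst sigma_finite_measure.nn_integral_fst[OF sigma_finite_P, symmetric]) auto
  also have "\<dots> = (\<integral>\<^sup>+\<omega>. (\<Sum>i. \<integral>\<^sup>+r. k (A i \<omega> * r 0) \<partial>law.P) \<partial>M)"
    by (intro nn_integral_cong nn_integral_suminf) measurable
  also have "\<dots> = (\<integral>\<^sup>+\<omega>. (\<Sum>i. \<integral>\<^sup>+y. k (A i \<omega> * y) \<partial>\<rho>) \<partial>M)"
    using law.nn_integral_component[of "\<lambda>y. k (A _ _ * y)" 0] by simp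
  finally show ?thesis by (simp add: nn_integral_termwise)
qed

lemma AE_nsum_0: "AE z in \<Omega>. nonneg_summable (\<lambda>i. A i (fst z) * snd z 0) a"
  using AE_regular by eventually_elim (use a_pos in \<open>auto simp: nonneg_summable_def A_nonneg intro!: summable_mult2 A_summable\<close>)

definition exceed_mean :: "real \<Rightarrow> real" where "exceed_mean v = (\<integral>z. (\<Sum>i. exceed v (x z i)) \<partial>\<Omega>)"

lemma nn_integral_exceed:
  assumes v: "v > 0"
  shows "(\<integral>\<^sup>+z. ennreal (\<Sum>i. exceed v (x z i)) \<partial>\<Omega>) < \<top>"
    and "(\<integral>\<^sup>+z. ennreal (\<Sum>i. exceed v (A i (fst z) * snd z 0)) \<partial>\<Omega>) = (\<integral>\<^sup>+z. ennreal (\<Sum>i. exceed v (x z i)) \<partial>\<Omega>)"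
proof -
  have "(\<integral>\<^sup>+z. ennreal (\<Sum>i. exceed v (x z i)) \<partial>\<Omega>) \<le> (\<integral>\<^sup>+z. ennreal (1 / v) * ennreal (X z) \<partial>\<Omega>)"
  proof (rule nn_integral_mono_AE, use AE_nsum in eventually_elim)
    case (elim z)
    interpret ns: nonneg_summable "x z" a by (rule elim)
    have "(\<Sum>i. exceed v (x z i)) \<le> (\<Sum>i. x z i / v)"
    proof (rule suminf_le)
      show "exceed v (x z i) \<le> x z i / v" for i using v ns.nonneg[of i] by (auto simp: exceed_def indicator_def field_simps)
    qed (use ns.summable_exceed[OF v] ns.summable in \<open>auto simp: exceed_def intro: summable_divide\<close>)
    also have "\<dots> = 1 / v * X z" using ns.summable by (simp add: suminf_divide X_eq)
    finally show ?case using v ns.S_nonneg by (simp add: ennreal_leI X_eq flip: ennreal_mult)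
  qed
  also have "\<dots> = ennreal (1 / v) * moment \<rho> 1" by (simp add: nn_integral_cmult nn_integral_X)
  also have "\<dots> < \<top>" using moments_finite[of 1] \<alpha>_gt_1 by (simp add: ennreal_mult_less_top)
  finally show "(\<integral>\<^sup>+z. ennreal (\<Sum>i. exceed v (x z i)) \<partial>\<Omega>) < \<top>" .
  have "(\<integral>\<^sup>+z. ennreal (\<Sum>i. exceed v (A i (fst z) * snd z 0)) \<partial>\<Omega>) = (\<integral>\<^sup>+z. (\<Sum>i. ennreal (exceed v (A i (fst z) * snd z 0))) \<partial>\<Omega>)"
  proof (rule nn_integral_cong_AE, use AE_nsum_0 in eventually_elim)
    case (elim z)
    then show ?case using nonneg_summable.summable_exceed[OF elim v]
      by (subst suminf_ennreal2) (auto simp: exceed_def)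
  qed
  also have "\<dots> = (\<integral>\<^sup>+z. (\<Sum>i. ennreal (exceed v (x z i))) \<partial>\<Omega>)" by (rule nn_integral_termwise_0) measurable
  also have "\<dots> = (\<integral>\<^sup>+z. ennreal (\<Sum>i. exceed v (x z i)) \<partial>\<Omega>)"
  proof (rule nn_integral_cong_AE, use AE_nsum in eventually_elim)
    case (elim z)
    then show ?case using nonneg_summable.summable_exceed[OF elim v]
      by (subst suminf_ennreal2) (auto simp: exceed_def)
  qed
  finally show "(\<integral>\<^sup>+z. ennreal (\<Sum>i. exceed v (A i (fst z) * snd z 0)) \<partial>\<Omega>) = (\<integral>\<^sup>+z. ennreal (\<Sum>i. exceed v (x z i)) \<partial>\<Omega>)" .
qed

lemma AE_exceed_sum_nonneg:
  assumes v: "v > 0"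
  shows "AE z in \<Omega>. 0 \<le> (\<Sum>i. exceed v (x z i))" "AE z in \<Omega>. 0 \<le> (\<Sum>i. exceed v (A i (fst z) * snd z 0))"
proof -
  show "AE z in \<Omega>. 0 \<le> (\<Sum>i. exceed v (x z i))"
    using AE_nsum by eventually_elim
      (rule suminf_nonneg, auto dest: nonneg_summable.summable_exceed[OF _ v] simp: exceed_def)
  show "AE z in \<Omega>. 0 \<le> (\<Sum>i. exceed v (A i (fst z) * snd z 0))"
    using AE_nsum_0 by eventually_elim
      (rule suminf_nonneg, auto dest: nonneg_summable.summable_exceed[OF _ v] simp: exceed_def)
qed

lemma integrable_exceed:
  assumes v: "v > 0"
  shows "integrable \<Omega> (\<lambda>z. \<Sum>i. exceed v (x z i))"
    and "integrable \<Omega> (\<lambda>z. \<Sum>i. exceed v (A i (fst z) * snd z 0))"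
    and "(\<integral>z. (\<Sum>i. exceed v (A i (fst z) * snd z 0)) \<partial>\<Omega>) = exceed_mean v"
proof -
  show "integrable \<Omega> (\<lambda>z. \<Sum>i. exceed v (x z i))"
    by (rule integrableI_nonneg) (use nn_integral_exceed[OF v] AE_exceed_sum_nonneg[OF v] in auto)
  show "integrable \<Omega> (\<lambda>z. \<Sum>i. exceed v (A i (fst z) * snd z 0))"
    by (rule integrableI_nonneg) (use nn_integral_exceed[OF v] AE_exceed_sum_nonneg[OF v] in auto)
  show "(\<integral>z. (\<Sum>i. exceed v (A i (fst z) * snd z 0)) \<partial>\<Omega>) = exceed_mean v"
    unfolding exceed_mean_def using AE_exceed_sum_nonneg[OF v]
    by (simp add: integral_eq_nn_integral nn_integral_exceed(2)[OF v])
qed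

text \<open>The signed integrand \<open>K\<close> is integrated in both orders: over the sample
  space first it gives the tail minus the mean number of exceedances, over the levels first
  \<open>D / \<alpha>\<close>. Absolute integrability comes from the cross terms.\<close>

lemma integral_tail_difference:
  shows "integrable lborel (\<lambda>v. indicator {0<..} v * (v powr a * (T v - exceed_mean v)))"
    and "(\<integral>v. indicator {0<..} v * (v powr a * (T v - exceed_mean v)) \<partial>lborel) = (\<integral>z. D z \<partial>\<Omega>) / \<alpha>"
proof -
  interpret L: pair_sigma_finite lborel \<Omega> ..
  define K where "K v z = indicator {0<..} v * (v powr a * (exceed v (X z) - (\<Sum>i. exceed v (x z i))))" for v z
  have [measurable]: "case_prod K \<in> borel_measurable (lborel \<Otimes>\<^sub>M \<Omega>)" unfolding K_def by measurable
  have int: "integrable (lborel \<Otimes>\<^sub>M \<Omega>) (case_prod K)"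
  proof (rule integrableI_bounded)
    have "(\<integral>\<^sup>+p. ennreal (norm (case_prod K p)) \<partial>(lborel \<Otimes>\<^sub>M \<Omega>)) = (\<integral>\<^sup>+z. \<integral>\<^sup>+v. ennreal (norm (K v z)) \<partial>lborel \<partial>\<Omega>)"
      by (subst L.nn_integral_snd[symmetric]) auto
    also have "\<dots> \<le> (\<integral>\<^sup>+z. ennreal ((\<alpha> * 2 powr a + 1) * cross a (x z)) \<partial>\<Omega>)"
    proof (rule nn_integral_mono_AE, use AE_nsum in eventually_elim)
      case (elim z)
      have "(\<integral>\<^sup>+v. ennreal (norm (K v z)) \<partial>lborel) \<le> (\<integral>\<^sup>+v\<in>{0<..}. ennreal ((a + 1) * v powr a *
          \<bar>indicator {v<..} (suminf (x z)) - (\<Sum>i. indicator {v<..} (x z i))\<bar>) \<partial>lborel)"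
      proof (rule nn_integral_mono)
        fix v :: real
        let ?d = "v powr a * \<bar>indicator {v<..} (suminf (x z)) - (\<Sum>i. indicator {v<..} (x z i))\<bar>"
        have "?d * 1 \<le> ?d * (a + 1)" using a_pos by (intro mult_left_mono) auto
        then show "ennreal (norm (K v z)) \<le> ennreal ((a + 1) * v powr a *
          \<bar>indicator {v<..} (suminf (x z)) - (\<Sum>i. indicator {v<..} (x z i))\<bar>) * indicator {0<..} v"
          by (cases "v > 0") (simp_all add: K_def exceed_def X_eq abs_mult ennreal_leI mult_ac)
      qed
      also have "\<dots> \<le> ennreal ((\<alpha> * 2 powr a + 1) * cross a (x z))"
        using nonneg_summable.nn_integral_exceed_difference[OF elim] by simp
      finally show ?case .
    qed
    also have "\<dots> = ennreal (\<alpha> * 2 powr a + 1) * (\<integral>\<^sup>+z. ennreal (cross a (x z)) \<partial>\<Omega>)"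
      using \<alpha>_gt_1 by (simp add: ennreal_mult' nn_integral_cmult)
    also have "\<dots> < \<top>" using nn_integral_cross_finite by (simp add: ennreal_mult_less_top)
    finally show "(\<integral>\<^sup>+p. ennreal (norm (case_prod K p)) \<partial>(lborel \<Otimes>\<^sub>M \<Omega>)) < \<infinity>" by simp
  qed measurable
  have inner: "(\<integral>z. K v z \<partial>\<Omega>) = indicator {0<..} v * (v powr a * (T v - exceed_mean v))" for v
  proof (cases "v > 0")
    case True
    have "integrable \<Omega> (\<lambda>z. exceed v (X z))" by (rule \<Omega>.integrable_const_bound[of _ 1]) auto
    moreover have "(\<integral>z. exceed v (X z) \<partial>\<Omega>) = T v"
      unfolding T_eq exceed_def[symmetric] by (rule integral_\<rho>_X[symmetric]) measurable
    ultimately show ?thesis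
      using True integrable_exceed(1)[OF True] by (simp add: K_def exceed_mean_def)
  qed (simp add: K_def)
  have outer: "AE z in \<Omega>. (\<integral>v. K v z \<partial>lborel) = D z / \<alpha>"
    using AE_nsum
  proof eventually_elim
    case (elim z)
    show ?case using nonneg_summable.integral_exceed_difference(2)[OF elim] by (simp add: K_def D_def X_eq)
  qed
  show "integrable lborel (\<lambda>v. indicator {0<..} v * (v powr a * (T v - exceed_mean v)))"
    using L.integrable_fst[OF int] unfolding inner .
  have "(\<integral>v. indicator {0<..} v * (v powr a * (T v - exceed_mean v)) \<partial>lborel) = (\<integral>z. (\<integral>v. K v z \<partial>lborel) \<partial>\<Omega>)"
    using L.Fubini_integral[OF int] unfolding inner by simp
  also have "\<dots> = (\<integral>z. D z / \<alpha> \<partial>\<Omega>)"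
    by (rule integral_cong_AE) (use outer in auto)
  finally show "(\<integral>v. indicator {0<..} v * (v powr a * (T v - exceed_mean v)) \<partial>lborel) = (\<integral>z. D z \<partial>\<Omega>) / \<alpha>" by simp
qed

end

context weights
begin

lemma step_mean_eq: "step.mean = (\<integral>\<omega>. (\<Sum>i. A i \<omega> powr \<alpha> * ln (A i \<omega>)) \<partial>M)"
proof -
  interpret N: sigma_finite_measure "count_space (UNIV::nat set)" by (rule sigma_finite_measure_count_space)
  interpret MN: pair_sigma_finite M "count_space (UNIV::nat set)" ..
  let ?Q = "M \<Otimes>\<^sub>M count_space (UNIV::nat set)"
  let ?k = "\<lambda>z. A (snd z) (fst z) powr \<alpha> * ln (A (snd z) (fst z))"
  have int: "integrable ?Q ?k"
    using integrable_step_law_id unfolding step_law_def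
    by (subst (asm) integrable_distr_eq) (auto simp: integrable_density)
  have "step.mean = (\<integral>u. u \<partial>step_law)" by (rule step.mean_def)
  also have "\<dots> = (\<integral>z. ?k z \<partial>?Q)"
    unfolding step_law_def by (subst integral_distr) (auto simp: integral_density)
  also have "\<dots> = (\<integral>\<omega>. (\<integral>i. A i \<omega> powr \<alpha> * ln (A i \<omega>) \<partial>count_space UNIV) \<partial>M)"
    using MN.integral_fst'[OF int] by simp
  also have "\<dots> = (\<integral>\<omega>. (\<Sum>i. A i \<omega> powr \<alpha> * ln (A i \<omega>)) \<partial>M)"
  proof (rule integral_cong_AE)
    show "AE \<omega> in M. (\<integral>i. A i \<omega> powr \<alpha> * ln (A i \<omega>) \<partial>count_space UNIV) = (\<Sum>i. A i \<omega> powr \<alpha> * ln (A i \<omega>))"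
      using MN.AE_integrable_fst'[OF int] by eventually_elim (simp add: integral_count_space_nat)
    show "(\<lambda>\<omega>. \<integral>i. A i \<omega> powr \<alpha> * ln (A i \<omega>) \<partial>count_space UNIV) \<in> borel_measurable M"
      using MN.integrable_fst'[OF int] by auto
  qed measurable
  finally show ?thesis .
qed

end

section \<open>The smoothing equation\<close>

text \<open>The cutoff at N moves from the summand into the weight whenever the summand vanishes at
  weight 0. By the conventions at 0 this covers powers and logarithmic terms, and also indicators of
  exceeding a level v \<ge> 0.\<close>

lemma sum_upto_cut:
  assumes "\<And>i. F i 0 = 0"
  shows "sum_upto n (\<lambda>i. F i (c i)) = (\<Sum>i. F i (if enat i < n then c i else 0))"
  unfolding sum_upto_def by (rule suminf_cong) (simp add: assms)

lemma distr_pair_snd: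
  assumes "prob_space M" "prob_space K"
  shows "distr (M \<Otimes>\<^sub>M K) K snd = K"
proof (rule measure_eqI)
  interpret M: prob_space M by fact
  interpret K: prob_space K by fact
  fix B assume "B \<in> sets (distr (M \<Otimes>\<^sub>M K) K snd)"
  then have B: "B \<in> sets K" by simp
  then have "snd -` B \<inter> space (M \<Otimes>\<^sub>M K) = space M \<times> B"
    using sets.sets_into_space[OF B] by (auto simp: space_pair_measure)
  then show "emeasure (distr (M \<Otimes>\<^sub>M K) K snd) B = emeasure K B"
    using B by (simp add: emeasure_distr K.emeasure_pair_measure_Times M.emeasure_space_1)
qed simp

lemma indep_rv_fst_snd:
  assumes "prob_space M" "prob_space K" and f: "f \<in> measurable M S" and g: "g \<in> measurable K T"
  shows "indep_rv (M \<Otimes>\<^sub>M K) S (\<lambda>z. f (fst z)) T (\<lambda>z. g (snd z))"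
proof -
  interpret M: prob_space M by fact
  interpret K: prob_space K by fact
  interpret MK: pair_prob_space M K ..
  have fm: "(\<lambda>z. f (fst z)) \<in> measurable (M \<Otimes>\<^sub>M K) S" using measurable_compose[OF measurable_fst f] .
  have gm: "(\<lambda>z. g (snd z)) \<in> measurable (M \<Otimes>\<^sub>M K) T" using measurable_compose[OF measurable_snd g] .
  let ?\<Omega> = "M \<Otimes>\<^sub>M K"
  let ?F = "sets (vimage_algebra (space ?\<Omega>) (\<lambda>z. f (fst z)) S)"
  let ?G = "sets (vimage_algebra (space ?\<Omega>) (\<lambda>z. g (snd z)) T)"
  have F: "?F = {(\<lambda>z. f (fst z)) -` B \<inter> space ?\<Omega> |B. B \<in> sets S}"
    by (rule sets_vimage_algebra2) (use measurable_space[OF fm] in auto)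
  have G: "?G = {(\<lambda>z. g (snd z)) -` B \<inter> space ?\<Omega> |B. B \<in> sets T}"
    by (rule sets_vimage_algebra2) (use measurable_space[OF gm] in auto)
  have "MK.indep_set ?F ?G"
  proof (rule MK.indep_setI)
    show "?F \<subseteq> sets ?\<Omega>" unfolding F using measurable_sets[OF fm] by auto
    show "?G \<subseteq> sets ?\<Omega>" unfolding G using measurable_sets[OF gm] by auto
    fix a b assume "a \<in> ?F" "b \<in> ?G"
    then obtain B B' where B: "B \<in> sets S" "a = (\<lambda>z. f (fst z)) -` B \<inter> space ?\<Omega>"
      and B': "B' \<in> sets T" "b = (\<lambda>z. g (snd z)) -` B' \<inter> space ?\<Omega>"
      unfolding F G by blast
    define U where "U = f -` B \<inter> space M"
    define V where "V = g -` B' \<inter> space K"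
    have U: "U \<in> sets M" unfolding U_def by (rule measurable_sets[OF f B(1)])
    have V: "V \<in> sets K" unfolding V_def by (rule measurable_sets[OF g B'(1)])
    have ab: "a = U \<times> space K" "b = space M \<times> V" "a \<inter> b = U \<times> V"
      by (auto simp: B(2) B'(2) U_def V_def space_pair_measure)
    have times: "MK.prob (A \<times> A') = measure M A * measure K A'" if "A \<in> sets M" "A' \<in> sets K" for A A'
      using that by (simp add: measure_def K.emeasure_pair_measure_Times enn2real_mult)
    show "MK.prob (a \<inter> b) = MK.prob a * MK.prob b"
      using U V by (simp only: ab(3)) (simp add: ab(1,2) times M.prob_space K.prob_space)
  qed
  then show ?thesis using fm gm by (simp add: indep_rv_def)
qed

lemma emeasure_log_law_on:
  assumes [measurable]: "f \<in> borel_measurable M" "Measurable.pred M Q" "B \<in> sets borel"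
  shows "emeasure (log_law_on M Q f) B = emeasure M {\<omega> \<in> space M. f \<omega> > 0 \<and> Q \<omega> \<and> ln (f \<omega>) \<in> B}"
proof -
  let ?E = "{\<omega> \<in> space M. f \<omega> > 0 \<and> Q \<omega>}"
  have E: "?E \<inter> space M \<in> sets M" by measurable
  have "emeasure (log_law_on M Q f) B = emeasure (restrict_space M ?E) ((\<lambda>\<omega>. ln (f \<omega>)) -` B \<inter> space (restrict_space M ?E))"
    unfolding log_law_on_def by (rule emeasure_distr) (auto intro: measurable_restrict_space1)
  also have "\<dots> = emeasure M ((\<lambda>\<omega>. ln (f \<omega>)) -` B \<inter> space (restrict_space M ?E))"
    by (rule emeasure_restrict_space[OF E]) (auto simp: space_restrict_space)
  also have "(\<lambda>\<omega>. ln (f \<omega>)) -` B \<inter> space (restrict_space M ?E) = {\<omega> \<in> space M. f \<omega> > 0 \<and> Q \<omega> \<and> ln (f \<omega>) \<in> B}"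
    by (auto simp: space_restrict_space)
  finally show ?thesis .
qed

lemma suminf_indicator_ge_2D:
  fixes c :: "nat \<Rightarrow> real"
  assumes "(\<Sum>i. indicator {0<..} (c i) :: ennreal) \<ge> 2"
  shows "\<exists>i j. i \<noteq> j \<and> c i > 0 \<and> c j > 0"
proof (rule ccontr)
  assume none: "\<not> ?thesis"
  have "(\<Sum>i. indicator {0<..} (c i) :: ennreal) \<le> 1"
  proof (cases "\<exists>i. c i > 0")
    case True
    then obtain i where i: "c i > 0" by blast
    then have "(\<Sum>i. indicator {0<..} (c i) :: ennreal) = (\<Sum>k\<in>{i}. indicator {0<..} (c k))"
      using none by (intro suminf_finite) (auto simp: indicator_def)
    then show ?thesis using i by simp
  next
    case False
    then have "(\<lambda>i. indicator {0<..} (c i) :: ennreal) = (\<lambda>i. 0)" by (auto simp: fun_eq_iff indicator_def)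
    then show ?thesis by simp
  qed
  with assms have "(2::ennreal) \<le> 1" by (rule order_trans)
  then show False by simp
qed

text \<open>The space is extended by a factor \<open>K\<close> that carries the copies, since
  \<open>M\<close> need not support variables independent of the weights.\<close>

theorem theorem4p2:
  fixes M :: "'a measure" and N :: "'a \<Rightarrow> enat" and C :: "nat \<Rightarrow> 'a \<Rightarrow> real" and \<alpha> :: real
  assumes "prob_space M"
    and "N \<in> measurable M (count_space UNIV)"
    and "\<And>i. C i \<in> borel_measurable M"
    and "AE \<omega> in M. \<forall>i. 0 \<le> C i \<omega>"
    and "\<exists>j. \<P>(\<omega> in M. enat j < N \<omega> \<and> C j \<omega> > 0) > 0 \<and>
              nonarithmetic (log_law_on M (\<lambda>\<omega>. enat j < N \<omega>) (C j))"
    and "\<alpha> > 1"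
    and "integrable M (\<lambda>\<omega>. sum_upto (N \<omega>) (\<lambda>i. C i \<omega>) powr \<alpha>)"
    and "(\<integral>\<^sup>+\<omega>. sum_upto (N \<omega>) (\<lambda>i. ennreal (C i \<omega> powr \<alpha> * max (ln (C i \<omega>)) 0)) \<partial>M) < \<infinity>"
    and "(\<integral>\<^sup>+\<omega>. sum_upto (N \<omega>) (\<lambda>i. ennreal (C i \<omega>)) \<partial>M) = 1"
    and "(\<integral>\<^sup>+\<omega>. sum_upto (N \<omega>) (\<lambda>i. ennreal (C i \<omega> powr \<alpha>)) \<partial>M) = 1"
  shows "\<exists>(K :: (nat \<Rightarrow> real) measure) R Rs H.
    prob_space K \<and>
    (let \<Omega> = M \<Otimes>\<^sub>M K; N' = (\<lambda>\<omega>. N (fst \<omega>)); C' = (\<lambda>i \<omega>. C i (fst \<omega>));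
         \<mu> = (\<integral>\<omega>. sum_upto (N \<omega>) (\<lambda>i. C i \<omega> powr \<alpha> * ln (C i \<omega>)) \<partial>M);
         g = (\<lambda>v. v powr (\<alpha> - 1) * (\<P>(\<omega> in \<Omega>. R \<omega> > v) -
               (\<integral>\<omega>. sum_upto (N' \<omega>) (\<lambda>i. indicator {v<..} (C' i \<omega> * R \<omega>)) \<partial>\<Omega>)));
         D = (\<lambda>\<omega>. sum_upto (N' \<omega>) (\<lambda>i. C' i \<omega> * Rs i \<omega>) powr \<alpha> -
               sum_upto (N' \<omega>) (\<lambda>i. (C' i \<omega> * Rs i \<omega>) powr \<alpha>))
     in smoothing_solution \<Omega> N' C' R Rs \<and>
        indep_rv \<Omega> weight_space (\<lambda>\<omega>. (N' \<omega>, \<lambda>i. C' i \<omega>)) borel R \<and>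
        integrable \<Omega> R \<and> 0 < (\<integral>\<omega>. R \<omega> \<partial>\<Omega>) \<and>
        ((\<lambda>t. t powr \<alpha> * \<P>(\<omega> in \<Omega>. R \<omega> > t)) \<longlongrightarrow> H) at_top \<and>
        0 \<le> H \<and>
        (\<forall>v>0. integrable \<Omega> (\<lambda>\<omega>. sum_upto (N' \<omega>) (\<lambda>i. indicator {v<..} (C' i \<omega> * R \<omega>) :: real))) \<and>
        set_integrable lborel {0<..} g \<and>
        H = (1 / \<mu>) * (LBINT v:{0<..}. g v) \<and>
        integrable \<Omega> D \<and>
        H = (\<integral>\<omega>. D \<omega> \<partial>\<Omega>) / (\<alpha> * \<mu>) \<and>
        (\<P>(\<omega> in M. sum_upto (N \<omega>) (\<lambda>i. indicator {0<..} (C i \<omega>) :: ennreal) \<ge> 2) > 0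
           \<longrightarrow> H > 0))"
proof -
  interpret M: prob_space M by fact
  note [measurable] = assms(2,3)
  \<comment> \<open>Off this event of full measure the weights are set to 0, which makes them
    nonnegative and summable everywhere. Convergence is phrased with an extended series to keep the
    event measurable.\<close>
  define good where "good \<omega> \<longleftrightarrow> (\<forall>i. 0 \<le> C i \<omega>) \<and> (\<Sum>i. ennreal (if enat i < N \<omega> then C i \<omega> else 0)) < \<top>" for \<omega>
  have [measurable]: "Measurable.pred M (\<lambda>\<omega>. enat i < N \<omega>)" for i
    by (rule measurable_compose[OF assms(2)]) simp
  have [measurable]: "Measurable.pred M good" unfolding good_def by measurable
  have "AE \<omega> in M. sum_upto (N \<omega>) (\<lambda>i. ennreal (C i \<omega>)) \<noteq> \<infinity>"
    by (rule nn_integral_PInf_AE) (use assms(9) in \<open>auto simp: sum_upto_def\<close>)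
  then have good: "AE \<omega> in M. good \<omega>"
    using assms(4)
  proof eventually_elim
    case (elim \<omega>)
    then show ?case
      using sum_upto_cut[of "\<lambda>_. ennreal" "N \<omega>" "\<lambda>i. C i \<omega>"] by (simp add: good_def less_top)
  qed
  define A where "A i \<omega> = (if good \<omega> \<and> enat i < N \<omega> then C i \<omega> else 0)" for i \<omega>
  have [measurable]: "A i \<in> borel_measurable M" for i unfolding A_def by measurable
  have A_nonneg: "0 \<le> A i \<omega>" for i \<omega> by (auto simp: A_def good_def)
  have A_summable: "summable (\<lambda>i. A i \<omega>)" for \<omega>
  proof (cases "good \<omega>")
    case True
    then have "(\<Sum>i. ennreal (A i \<omega>)) < \<top>" by (simp add: A_def) (simp add: good_def)
    then show ?thesis by (intro summable_suminf_not_top A_nonneg) auto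
  qed (simp add: A_def)
  have "weights M A \<alpha>"
  proof unfold_locales
    show "integrable M (\<lambda>\<omega>. (\<Sum>i. A i \<omega>) powr \<alpha>)"
    proof (rule integrable_cong_AE_imp[OF assms(7)])
      show "AE \<omega> in M. sum_upto (N \<omega>) (\<lambda>i. C i \<omega>) powr \<alpha> = (\<Sum>i. A i \<omega>) powr \<alpha>"
        using good by eventually_elim (simp add: sum_upto_cut[where F = "\<lambda>_ c. c"] A_def)
    qed measurable
    show "(\<integral>\<^sup>+\<omega>. (\<Sum>i. ennreal (A i \<omega>)) \<partial>M) = 1"
      unfolding assms(9)[symmetric]
      by (rule nn_integral_cong_AE, use good in eventually_elim) (simp add: sum_upto_cut[where F = "\<lambda>_. ennreal"] A_def)
    show "(\<integral>\<^sup>+\<omega>. (\<Sum>i. ennreal (A i \<omega> powr \<alpha>)) \<partial>M) = 1"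
      unfolding assms(10)[symmetric]
      by (rule nn_integral_cong_AE, use good in eventually_elim) (simp add: sum_upto_cut[where F = "\<lambda>_ c. ennreal (c powr \<alpha>)"] A_def)
    have "(\<integral>\<^sup>+\<omega>. (\<Sum>i. ennreal (A i \<omega> powr \<alpha> * max (ln (A i \<omega>)) 0)) \<partial>M) =
        (\<integral>\<^sup>+\<omega>. sum_upto (N \<omega>) (\<lambda>i. ennreal (C i \<omega> powr \<alpha> * max (ln (C i \<omega>)) 0)) \<partial>M)"
      by (rule nn_integral_cong_AE, use good in eventually_elim)
        (simp add: sum_upto_cut[where F = "\<lambda>_ c. ennreal (c powr \<alpha> * max (ln c) 0)"] A_def)
    then show "(\<integral>\<^sup>+\<omega>. (\<Sum>i. ennreal (A i \<omega> powr \<alpha> * max (ln (A i \<omega>)) 0)) \<partial>M) < \<infinity>" using assms(8) by simp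
    obtain j where j: "nonarithmetic (log_law_on M (\<lambda>\<omega>. enat j < N \<omega>) (C j))" using assms(5) by blast
    show "\<exists>j. \<forall>d>0. emeasure M {\<omega> \<in> space M. A j \<omega> > 0 \<and> ln (A j \<omega>) \<notin> range (\<lambda>k::int. d * of_int k)} > 0"
    proof (intro exI[of _ j] allI impI)
      fix d :: real assume "d > 0"
      define Z where "Z = range (\<lambda>k::int. d * of_int k)"
      have "countable Z" by (simp add: Z_def)
      then have "Z \<in> sets borel" by (rule sets.countable[rotated]) auto
      then have Z[measurable]: "UNIV - Z \<in> sets borel" by auto
      have "emeasure M {\<omega> \<in> space M. C j \<omega> > 0 \<and> enat j < N \<omega> \<and> ln (C j \<omega>) \<in> UNIV - Z} =
          emeasure M {\<omega> \<in> space M. A j \<omega> > 0 \<and> ln (A j \<omega>) \<in> UNIV - Z}"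
      proof (rule emeasure_eq_AE)
        show "AE \<omega> in M. \<omega> \<in> {\<omega> \<in> space M. C j \<omega> > 0 \<and> enat j < N \<omega> \<and> ln (C j \<omega>) \<in> UNIV - Z} \<longleftrightarrow>
            \<omega> \<in> {\<omega> \<in> space M. A j \<omega> > 0 \<and> ln (A j \<omega>) \<in> UNIV - Z}"
          using good by eventually_elim (auto simp: A_def)
      qed measurable
      moreover have "emeasure (log_law_on M (\<lambda>\<omega>. enat j < N \<omega>) (C j)) (UNIV - Z) > 0"
        using j \<open>d > 0\<close> by (simp add: nonarithmetic_def Z_def)
      ultimately show "emeasure M {\<omega> \<in> space M. A j \<omega> > 0 \<and> ln (A j \<omega>) \<notin> range (\<lambda>k::int. d * of_int k)} > 0"
        by (simp add: emeasure_log_law_on flip: Z_def)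
    qed
  qed (use A_nonneg A_summable assms(6) in auto)
  then interpret W: weights M A \<alpha> .
  obtain \<rho> where \<rho>: "nonneg_law \<rho>" "W.smoothing \<rho> = \<rho>" "(\<integral>x. x \<partial>\<rho>) > 0"
    "\<And>\<beta>. 1 \<le> \<beta> \<Longrightarrow> \<beta> < \<alpha> \<Longrightarrow> moment \<rho> \<beta> < \<top>"
    by (rule W.exists_fixed_law) blast
  interpret F: fixed_law M A \<alpha> \<rho>
    using \<rho> W.weights_axioms by (intro fixed_law.intro weights_law.intro fixed_law_axioms.intro) auto
  define K where "K = PiM (UNIV :: nat set) (\<lambda>_. \<rho>)"
  \<comment> \<open>\<open>R\<close> may coincide with the first copy: it must be independent of the
    weights, not of the copies.\<close>
  define R where "R z = snd z 0" for z :: "'a \<times> (nat \<Rightarrow> real)"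
  define Rs where "Rs i z = snd z i" for i and z :: "'a \<times> (nat \<Rightarrow> real)"
  let ?\<Omega> = "M \<Otimes>\<^sub>M K"
  have K: "prob_space K" unfolding K_def by (rule F.law.prob_space_P)
  interpret \<Omega>: prob_space ?\<Omega> unfolding K_def by (rule F.\<Omega>.prob_space_axioms)
  have [measurable]: "R \<in> borel_measurable ?\<Omega>" "Rs i \<in> borel_measurable ?\<Omega>" for i
    unfolding R_def Rs_def K_def by measurable
  have [measurable]: "Measurable.pred ?\<Omega> (\<lambda>z. enat i < N (fst z))" for i by measurable
  have good': "AE z in ?\<Omega>. good (fst z)"
  proof -
    have "AE \<omega> in distr ?\<Omega> M fst. good \<omega>" by (subst prob_space.distr_pair_fst[OF K]) (rule good)
    then show ?thesis by (rule AE_distrD[OF measurable_fst])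
  qed
  have regular: "AE z in ?\<Omega>. (\<forall>i. 0 \<le> Rs i z) \<and> summable (\<lambda>i. A i (fst z) * Rs i z)"
    unfolding K_def Rs_def by (rule F.AE_regular)
  have law_Rs: "distr ?\<Omega> borel (Rs i) = \<rho>" for i
  proof -
    have "distr ?\<Omega> borel (Rs i) = distr (distr ?\<Omega> K snd) borel (\<lambda>r. r i)"
      unfolding Rs_def K_def by (subst distr_distr) (auto simp: o_def)
    also have "\<dots> = distr K borel (\<lambda>r. r i)" by (simp add: distr_pair_snd[OF assms(1) K])
    also have "\<dots> = distr K \<rho> (\<lambda>r. r i)" by (rule distr_cong) (auto simp: F.law.sets_\<rho>)
    finally show ?thesis by (simp add: K_def F.law.distr_component)
  qed
  have law_R: "distr ?\<Omega> borel R = \<rho>" using law_Rs[of 0] by (simp add: R_def[abs_def] Rs_def[abs_def])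
  have weight_measurable: "(\<lambda>\<omega>. (N \<omega>, \<lambda>i. C i \<omega>)) \<in> measurable M weight_space"
    by (intro measurable_Pair assms(2) measurable_PiM_single') (auto simp: assms(3))
  have X_eq: "AE z in ?\<Omega>. sum_upto (N (fst z)) (\<lambda>i. C i (fst z) * Rs i z) = F.X z"
    using good'
  proof eventually_elim
    case (elim z)
    then show ?case by (subst sum_upto_cut[where F = "\<lambda>i c. c * Rs i z"]) (simp_all add: A_def F.X_def Rs_def)
  qed
  have c1: "smoothing_solution ?\<Omega> (\<lambda>\<omega>. N (fst \<omega>)) (\<lambda>i \<omega>. C i (fst \<omega>)) R Rs"
    unfolding smoothing_solution_def
  proof (intro conjI allI)
    show "AE \<omega> in ?\<Omega>. 0 \<le> R \<omega>" using regular by eventually_elim (auto simp: R_def Rs_def)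
    show "distr ?\<Omega> borel (Rs i) = distr ?\<Omega> borel R" for i by (simp add: law_Rs law_R)
    have sets_K: "sets K = sets (PiM UNIV (\<lambda>_. borel :: real measure))" unfolding K_def by (rule F.law.sets_P)
    show "\<Omega>.indep_vars (\<lambda>_. borel) Rs UNIV"
    proof (subst \<Omega>.indep_vars_iff_distr_eq_PiM')
      have "distr ?\<Omega> (PiM UNIV (\<lambda>_. borel)) (\<lambda>z. \<lambda>i\<in>UNIV. Rs i z) = distr ?\<Omega> K snd"
        by (rule distr_cong) (auto simp: sets_K Rs_def)
      also have "\<dots> = K" by (rule distr_pair_snd[OF assms(1) K])
      also have "K = PiM UNIV (\<lambda>i. distr ?\<Omega> borel (Rs i))" unfolding law_Rs by (rule K_def)
      finally show "distr ?\<Omega> (PiM UNIV (\<lambda>_. borel)) (\<lambda>z. \<lambda>i\<in>UNIV. Rs i z) = PiM UNIV (\<lambda>i. distr ?\<Omega> borel (Rs i))" .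
    qed auto
    have "(\<lambda>r. r) \<in> measurable K (PiM UNIV (\<lambda>_. borel :: real measure))" using sets_K by (simp cong: measurable_cong_sets)
    from indep_rv_fst_snd[OF assms(1) K weight_measurable this]
    show "indep_rv ?\<Omega> weight_space (\<lambda>\<omega>. (N (fst \<omega>), \<lambda>i. C i (fst \<omega>))) (PiM UNIV (\<lambda>i. borel)) (\<lambda>\<omega> i. Rs i \<omega>)"
      by (simp add: Rs_def)
    have "distr ?\<Omega> borel (\<lambda>\<omega>. sum_upto (N (fst \<omega>)) (\<lambda>i. ennreal (C i (fst \<omega>) * Rs i \<omega>))) = distr ?\<Omega> borel (\<lambda>\<omega>. ennreal (F.X \<omega>))"
    proof (rule distr_cong_AE[OF refl refl])
      show "AE z in ?\<Omega>. sum_upto (N (fst z)) (\<lambda>i. ennreal (C i (fst z) * Rs i z)) = ennreal (F.X z)"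
        using good' regular
      proof eventually_elim
        case (elim z)
        then have "sum_upto (N (fst z)) (\<lambda>i. ennreal (C i (fst z) * Rs i z)) = (\<Sum>i. ennreal (A i (fst z) * Rs i z))"
          by (simp add: sum_upto_cut[where F = "\<lambda>i c. ennreal (c * Rs i z)"] A_def)
        also have "\<dots> = ennreal (F.X z)"
          unfolding F.X_def using elim A_nonneg by (subst suminf_ennreal2) (auto simp: Rs_def)
        finally show ?case .
      qed
      show "(\<lambda>z. sum_upto (N (fst z)) (\<lambda>i. ennreal (C i (fst z) * Rs i z))) \<in> borel_measurable ?\<Omega>"
        unfolding sum_upto_def by measurable
      show "(\<lambda>z. ennreal (F.X z)) \<in> borel_measurable ?\<Omega>" unfolding K_def by measurable
    qed
    also have "\<dots> = distr (distr ?\<Omega> borel F.X) borel ennreal"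
      unfolding K_def by (subst distr_distr) (auto simp: o_def)
    also have "\<dots> = distr (distr ?\<Omega> borel R) borel ennreal"
      unfolding law_R by (simp only: K_def F.distr_X)
    also have "\<dots> = distr ?\<Omega> borel (\<lambda>\<omega>. ennreal (R \<omega>))" by (subst distr_distr) (auto simp: o_def)
    finally show "distr ?\<Omega> borel (\<lambda>\<omega>. ennreal (R \<omega>)) =
        distr ?\<Omega> borel (\<lambda>\<omega>. sum_upto (N (fst \<omega>)) (\<lambda>i. ennreal (C i (fst \<omega>) * Rs i \<omega>)))" ..
  qed auto
  have c2: "indep_rv ?\<Omega> weight_space (\<lambda>\<omega>. (N (fst \<omega>), \<lambda>i. C i (fst \<omega>))) borel R"
  proof -
    have "(\<lambda>r. r 0) \<in> borel_measurable K" unfolding K_def by measurable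
    from indep_rv_fst_snd[OF assms(1) K weight_measurable this] show ?thesis by (simp add: R_def[abs_def])
  qed
  have c3: "integrable ?\<Omega> R"
  proof -
    have "integrable (distr ?\<Omega> borel R) (\<lambda>x. x)" unfolding law_R by (rule F.law.integrable_id)
    then show ?thesis by (subst (asm) integrable_distr_eq) measurable
  qed
  have c4: "0 < (\<integral>\<omega>. R \<omega> \<partial>?\<Omega>)"
  proof -
    have "0 < (\<integral>x. x \<partial>distr ?\<Omega> borel R)" unfolding law_R by (rule F.law_mean_pos)
    then show ?thesis by (subst (asm) integral_distr) measurable
  qed
  have tail: "\<P>(\<omega> in ?\<Omega>. R \<omega> > t) = F.T t" for t
  proof -
    have "F.T t = measure (distr ?\<Omega> borel R) {t<..}" by (simp add: F.T_def law_R)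
    also have "\<dots> = \<P>(\<omega> in ?\<Omega>. R \<omega> > t)"
      by (subst measure_distr) (auto intro!: arg_cong[where f = "measure ?\<Omega>"])
    finally show ?thesis ..
  qed
  have c5: "((\<lambda>t. t powr \<alpha> * \<P>(\<omega> in ?\<Omega>. R \<omega> > t)) \<longlongrightarrow> F.H) at_top"
    unfolding tail by (rule F.tail_limit)
  have c6: "0 \<le> F.H" by (rule F.H_nonneg)
  have exceed_AE: "AE z in ?\<Omega>. sum_upto (N (fst z)) (\<lambda>i. indicator {v<..} (C i (fst z) * R z)) = (\<Sum>i. exceed v (A i (fst z) * snd z 0))"
    if "v > 0" for v
    using good'
  proof eventually_elim
    case (elim z)
    then show ?case
      using that by (subst sum_upto_cut[where F = "\<lambda>i c. indicator {v<..} (c * R z)"]) (simp_all add: A_def exceed_def R_def)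
  qed
  have exceed_measurable': "(\<lambda>z. sum_upto (N (fst z)) (\<lambda>i. indicator {v<..} (C i (fst z) * R z) :: real)) \<in> borel_measurable ?\<Omega>" for v
    unfolding sum_upto_def exceed_def[symmetric] by measurable
  have exceed_measurable'': "(\<lambda>z. \<Sum>i. exceed v (A i (fst z) * snd z 0)) \<in> borel_measurable ?\<Omega>" for v
    unfolding K_def by measurable
  have c7: "integrable ?\<Omega> (\<lambda>\<omega>. sum_upto (N (fst \<omega>)) (\<lambda>i. indicator {v<..} (C i (fst \<omega>) * R \<omega>) :: real))"
    if v: "v > 0" for v
    using integrable_cong_AE[OF exceed_measurable' exceed_measurable'' exceed_AE[OF v]] F.integrable_exceed(2)[OF v]
    by (simp add: K_def)
  have exceed_integral: "(\<integral>\<omega>. sum_upto (N (fst \<omega>)) (\<lambda>i. indicator {v<..} (C i (fst \<omega>) * R \<omega>)) \<partial>?\<Omega>) = F.exceed_mean v"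
    if v: "v > 0" for v
    using integral_cong_AE[OF exceed_measurable' exceed_measurable'' exceed_AE[OF v]] F.integrable_exceed(3)[OF v]
    by (simp add: K_def)
  let ?g = "\<lambda>v. v powr (\<alpha> - 1) * (\<P>(\<omega> in ?\<Omega>. R \<omega> > v) -
      (\<integral>\<omega>. sum_upto (N (fst \<omega>)) (\<lambda>i. indicator {v<..} (C i (fst \<omega>) * R \<omega>)) \<partial>?\<Omega>))"
  \<comment> \<open>\<open>exceed_integral\<close> is available for positive levels only; elsewhere
    the indicator makes both sides 0.\<close>
  have g_eq: "indicator {0<..} v *\<^sub>R ?g v = indicator {0<..} v * (v powr (\<alpha> - 1) * (F.T v - F.exceed_mean v))" for v
    by (cases "v > 0") (simp_all only: tail exceed_integral, simp_all)
  have c8: "set_integrable lborel {0<..} ?g"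
    unfolding set_integrable_def g_eq by (rule F.integral_tail_difference(1))
  have g_int: "(LBINT v:{0<..}. ?g v) = (\<integral>z. F.D z \<partial>?\<Omega>) / \<alpha>"
    unfolding set_lebesgue_integral_def g_eq by (simp only: F.integral_tail_difference(2) K_def)
  have \<mu>: "(\<integral>\<omega>. sum_upto (N \<omega>) (\<lambda>i. C i \<omega> powr \<alpha> * ln (C i \<omega>)) \<partial>M) = W.step.mean"
    unfolding W.step_mean_eq
  proof (rule integral_cong_AE)
    show "AE \<omega> in M. sum_upto (N \<omega>) (\<lambda>i. C i \<omega> powr \<alpha> * ln (C i \<omega>)) = (\<Sum>i. A i \<omega> powr \<alpha> * ln (A i \<omega>))"
      using good by eventually_elim (simp add: sum_upto_cut[where F = "\<lambda>_ c. c powr \<alpha> * ln c"] A_def)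
    show "(\<lambda>\<omega>. sum_upto (N \<omega>) (\<lambda>i. C i \<omega> powr \<alpha> * ln (C i \<omega>))) \<in> borel_measurable M"
      unfolding sum_upto_def by measurable
  qed measurable
  let ?D = "\<lambda>\<omega>. sum_upto (N (fst \<omega>)) (\<lambda>i. C i (fst \<omega>) * Rs i \<omega>) powr \<alpha> -
      sum_upto (N (fst \<omega>)) (\<lambda>i. (C i (fst \<omega>) * Rs i \<omega>) powr \<alpha>)"
  have D_AE: "AE z in ?\<Omega>. ?D z = F.D z"
    using good' X_eq
  proof eventually_elim
    case (elim z)
    then show ?case by (subst sum_upto_cut[where F = "\<lambda>i c. (c * Rs i z) powr \<alpha>"]) (simp_all add: A_def F.D_def Rs_def)
  qed
  have D_measurable: "?D \<in> borel_measurable ?\<Omega>" unfolding sum_upto_def by measurable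
  have D_measurable': "F.D \<in> borel_measurable ?\<Omega>" unfolding K_def by measurable
  have c9: "F.H = (1 / (\<integral>\<omega>. sum_upto (N \<omega>) (\<lambda>i. C i \<omega> powr \<alpha> * ln (C i \<omega>)) \<partial>M)) * (LBINT v:{0<..}. ?g v)"
    unfolding \<mu> g_int by (simp add: F.H_def K_def)
  have c10: "integrable ?\<Omega> ?D"
    using integrable_cong_AE[OF D_measurable D_measurable' D_AE] F.integrable_D by (simp add: K_def)
  have c11: "F.H = (\<integral>\<omega>. ?D \<omega> \<partial>?\<Omega>) / (\<alpha> * (\<integral>\<omega>. sum_upto (N \<omega>) (\<lambda>i. C i \<omega> powr \<alpha> * ln (C i \<omega>)) \<partial>M))"
    unfolding \<mu> integral_cong_AE[OF D_measurable D_measurable' D_AE] by (simp add: F.H_def K_def)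
  have c12: "F.H > 0" if "\<P>(\<omega> in M. sum_upto (N \<omega>) (\<lambda>i. indicator {0<..} (C i \<omega>) :: ennreal) \<ge> 2) > 0"
  proof (rule F.H_pos)
    have "0 < emeasure M {\<omega> \<in> space M. sum_upto (N \<omega>) (\<lambda>i. indicator {0<..} (C i \<omega>) :: ennreal) \<ge> 2}"
      using that by (simp add: M.emeasure_eq_measure)
    also have "\<dots> \<le> emeasure M {\<omega> \<in> space M. \<exists>i j. i \<noteq> j \<and> A i \<omega> > 0 \<and> A j \<omega> > 0}"
    proof (rule emeasure_mono_AE)
      show "AE \<omega> in M. \<omega> \<in> {\<omega> \<in> space M. sum_upto (N \<omega>) (\<lambda>i. indicator {0<..} (C i \<omega>) :: ennreal) \<ge> 2} \<longrightarrow>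
          \<omega> \<in> {\<omega> \<in> space M. \<exists>i j. i \<noteq> j \<and> A i \<omega> > 0 \<and> A j \<omega> > 0}"
        using good
      proof eventually_elim
        case (elim \<omega>)
        then have "sum_upto (N \<omega>) (\<lambda>i. indicator {0<..} (C i \<omega>) :: ennreal) = (\<Sum>i. indicator {0<..} (A i \<omega>))"
          by (simp add: sum_upto_cut[where F = "\<lambda>_. indicator {0<..}"] A_def)
        then show ?case using suminf_indicator_ge_2D[of "\<lambda>i. A i \<omega>"] by simp
      qed
    qed measurable
    finally show "0 < emeasure M {\<omega> \<in> space M. \<exists>i j. i \<noteq> j \<and> A i \<omega> > 0 \<and> A j \<omega> > 0}" .
  qed
  show ?thesis
    unfolding Let_def
    by (rule exI[of _ K], rule exI[of _ R], rule exI[of _ Rs], rule exI[of _ F.H])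
      (intro conjI allI impI K c1 c2 c3 c4 c5 c6 c7 c8 c9 c10 c11 c12)
qed

end
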